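(* Let $M$ be a $3$-manifold, let $r\ge 3$ be a differentiability class, and let $f_0,f_1\in \mathrm{Diff}^r(M)$ be such that, for $j=0,1$, $f_j$ has a hyperbolic fixed point $p_j$ and a homoclinic quadratic tangency $q_j$ positively associated with $p_j$. Suppose the following conditions hold. (a) For $j=0,1$ there is a neighborhood $U(p_j)$ of $p_j$ in $M$ such that $f_j|_{U(p_j)}$ is linear, and $Df_j(p_j)$ has non-real eigenvalues $r_je^{\pm\sqrt{-1}\theta_j}$ and a real eigenvalue $\lambda_j$ with $r_j>1$, $\theta_j\not\equiv 0 \bmod \pi$ and $0<\lambda_j<1$. (b) $f_0$ is topologically conjugate to $f_1$ by a homeomorphism $h:M\to M$ (that is, $f_1=h\circ f_0\circ h^{-1}$) with $h(p_0)=p_1$ and $h(q_0)=q_1$. (c) $\theta_0/2\pi$ is irrational. Then: (1) $\lambda_0=\lambda_1$ and $r_0=r_1$. (2) The restriction $h|_{W^u_{\mathrm{loc}}(p_0)}:W^u_{\mathrm{loc}}(p_0)\to W^u_{\mathrm{loc}}(p_1)$ is a uniquely determined linear conformal map; here "uniquely determined" means that any two homeomorphisms $h,\widetilde h$ of $M$ satisfying (b) have the same restriction to $W^u_{\mathrm{loc}}(p_0)$.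
   Context: $\mathrm{Diff}^r(M)$ is the space of $C^r$-diffeomorphisms of $M$. "$f_j|_{U(p_j)}$ is linear" means that $f_j$ is linear with respect to some local coordinate of $M$ on $U(p_j)$ centered at $p_j$. $W^u(p_j)$ and $W^s(p_j)$ denote the unstable manifold (here of dimension 2) and stable manifold (here of dimension 1) of $p_j$ for $f_j$, and $W^u_{\mathrm{loc}}(p_j)$ is the local unstable manifold of $p_j$ in $U(p_j)$. A homoclinic quadratic tangency associated with $p_j$ is a point $q_j\in W^u(p_j)\cap W^s(p_j)$, $q_j\ne p_j$, at which the curve $W^s(p_j)$ is tangent to the surface $W^u(p_j)$ with contact exactly quadratic (if $W^u(p_j)$ is straightened near $q_j$ to $\{\tau=0\}$ in local coordinates, then along a regular parametrization of $W^s(p_j)$ with $q_j$ at parameter $0$ the function $\tau$ vanishes together with its first derivative, but not its second derivative, at $0$). The tangency $q_j$ is positively associated with $p_j$ if both $f_j^n(q_j)$ and $f_j^{-n}(\alpha\setminus\{q_j\})$ lie in the same component of $U(p_j)\setminus W^u_{\mathrm{loc}}(p_j)$ for sufficiently large $n\in\mathbb{N}$ and any (sufficiently) small curve $\alpha$ in $W^s(p_j)$ containing $q_j$. Linear conformal map: $W^u_{\mathrm{loc}}(p_0)$ and $W^u_{\mathrm{loc}}(p_1)$ are identified with neighborhoods of the origin in $\mathbb{C}$ via linearizing coordinates, chosen so that $f_j$ acts on $W^u_{\mathrm{loc}}(p_j)$ as multiplication by the complex number $r_je^{\sqrt{-1}\theta_j}$ or its conjugate; the complex coordinates are chosen suitably,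 i.e. a coordinate $z$ may be replaced by $\bar z$ (which replaces $\theta_j$ by $-\theta_j$). The restriction is a linear conformal map if under this identification it has the form $z\mapsto \rho e^{\sqrt{-1}\omega}z$ $(z\in W^u_{\mathrm{loc}}(p_0))$ for some $\rho\in\mathbb{R}\setminus\{0\}$ and $\omega\in\mathbb{R}$. The local unstable manifold $W^u_{\mathrm{loc}}(p_0)$ is taken small enough that its image under the conjugacies lies in the linearized region $W^u_{\mathrm{loc}}(p_1)$. *)

theory Defs
  imports "HOL-Analysis.Analysis"
begin

section \<open>Manifolds of class \<open>C\<^sup>r\<close> and their diffeomorphisms\<close>

text \<open>Used for open \<open>S\<close> only.\<close>

primrec Ck_on :: "nat \<Rightarrow> 'a::real_normed_vector set \<Rightarrow> ('a \<Rightarrow> 'b::real_normed_vector) \<Rightarrow> bool" where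
  "Ck_on 0 S f \<longleftrightarrow> continuous_on S f"
| "Ck_on (Suc k) S f \<longleftrightarrow>
     (\<forall>x\<in>S. f differentiable (at x)) \<and> (\<forall>v. Ck_on k S (\<lambda>x. frechet_derivative f (at x) v))"

definition Cr_on :: "enat \<Rightarrow> 'a::real_normed_vector set \<Rightarrow> ('a \<Rightarrow> 'b::real_normed_vector) \<Rightarrow> bool" where
  "Cr_on r S f \<longleftrightarrow> (\<forall>k. enat k \<le> r \<longrightarrow> Ck_on k S f)"

text \<open>A chart is a pair of an open domain and a coordinate map; the manifold is the whole
  type \<open>'m\<close>, which the theorem takes to be Hausdorff and second countable.\<close>

type_synonym 'm chart3 = "'m set \<times> ('m \<Rightarrow> real ^ 3)"

definition chart :: "'m::topological_space set \<Rightarrow> ('m \<Rightarrow> real ^ 3) \<Rightarrow> bool" where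
  "chart U \<phi> \<longleftrightarrow> open U \<and> open (\<phi> ` U) \<and> homeomorphism U (\<phi> ` U) \<phi> (inv_into U \<phi>)"

definition Cr_compatible :: "enat \<Rightarrow> 'm chart3 \<Rightarrow> 'm chart3 \<Rightarrow> bool" where
  "Cr_compatible r = (\<lambda>(U, \<phi>) (V, \<psi>).
     Cr_on r (\<phi> ` (U \<inter> V)) (\<psi> \<circ> inv_into U \<phi>) \<and>
     Cr_on r (\<psi> ` (U \<inter> V)) (\<phi> \<circ> inv_into V \<psi>))"

definition Cr_atlas :: "enat \<Rightarrow> 'm::topological_space chart3 set \<Rightarrow> bool" where
  "Cr_atlas r A \<longleftrightarrow>
     (\<forall>(U, \<phi>)\<in>A. chart U \<phi>) \<and> \<Union> (fst ` A) = UNIV \<and> (\<forall>c\<in>A. \<forall>d\<in>A. Cr_compatible r c d)"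

text \<open>Local coordinates: the elements of the maximal atlas generated by \<open>A\<close>.\<close>

definition local_coord ::
    "enat \<Rightarrow> 'm::topological_space chart3 set \<Rightarrow> 'm set \<Rightarrow> ('m \<Rightarrow> real ^ 3) \<Rightarrow> bool" where
  "local_coord r A U \<phi> \<longleftrightarrow> chart U \<phi> \<and> (\<forall>c\<in>A. Cr_compatible r (U, \<phi>) c)"

definition Cr_map :: "enat \<Rightarrow> 'm::topological_space chart3 set \<Rightarrow> ('m \<Rightarrow> 'm) \<Rightarrow> bool" where
  "Cr_map r A f \<longleftrightarrow> continuous_on UNIV f \<and>
     (\<forall>(U, \<phi>)\<in>A. \<forall>(V, \<psi>)\<in>A. Cr_on r (\<phi> ` (U \<inter> f -` V)) (\<psi> \<circ> f \<circ> inv_into U \<phi>))"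

definition Diff :: "enat \<Rightarrow> 'm::topological_space chart3 set \<Rightarrow> ('m \<Rightarrow> 'm) set" where
  "Diff r A = {f. bij f \<and> Cr_map r A f \<and> Cr_map r A (inv f)}"


section \<open>Hyperbolic fixed points, stable and unstable manifolds\<close>

definition deriv_in_coord ::
    "'m set \<Rightarrow> ('m \<Rightarrow> real ^ 3) \<Rightarrow> ('m \<Rightarrow> 'm) \<Rightarrow> 'm \<Rightarrow> real ^ 3 \<Rightarrow> real ^ 3" where
  "deriv_in_coord U \<phi> f p = frechet_derivative (\<phi> \<circ> f \<circ> inv_into U \<phi>) (at (\<phi> p))"

definition complex_eigenvalues :: "(real ^ 3 \<Rightarrow> real ^ 3) \<Rightarrow> complex set" where
  "complex_eigenvalues L =
     {\<mu>. \<exists>v::complex ^ 3. v \<noteq> 0 \<and> (\<chi> i j. complex_of_real (matrix L $ i $ j)) *v v = \<mu> *s v}"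

definition hyperbolic_fixed_point :: "'m chart3 set \<Rightarrow> ('m \<Rightarrow> 'm) \<Rightarrow> 'm \<Rightarrow> bool" where
  "hyperbolic_fixed_point A f p \<longleftrightarrow> f p = p \<and>
     (\<forall>(U, \<phi>)\<in>A. p \<in> U \<longrightarrow> (\<forall>\<mu>\<in>complex_eigenvalues (deriv_in_coord U \<phi> f p). cmod \<mu> \<noteq> 1))"

definition stable_mfd :: "('a \<Rightarrow> 'a) \<Rightarrow> 'a::topological_space \<Rightarrow> 'a set" where
  "stable_mfd f p = {x. (\<lambda>n. (f ^^ n) x) \<longlonglongrightarrow> p}"

definition unstable_mfd :: "('a \<Rightarrow> 'a) \<Rightarrow> 'a::topological_space \<Rightarrow> 'a set" where
  "unstable_mfd f p = stable_mfd (inv f) p"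

definition local_stable_mfd :: "'a set \<Rightarrow> ('a \<Rightarrow> 'a) \<Rightarrow> 'a::topological_space \<Rightarrow> 'a set" where
  "local_stable_mfd U f p = {x \<in> stable_mfd f p. \<forall>n. (f ^^ n) x \<in> U}"

definition local_unstable_mfd :: "'a set \<Rightarrow> ('a \<Rightarrow> 'a) \<Rightarrow> 'a::topological_space \<Rightarrow> 'a set" where
  "local_unstable_mfd U f p = local_stable_mfd U (inv f) p"

definition linear_in_coord :: "'m set \<Rightarrow> ('m \<Rightarrow> real ^ 3) \<Rightarrow> ('m \<Rightarrow> 'm) \<Rightarrow> bool" where
  "linear_in_coord U \<phi> f \<longleftrightarrow> (\<exists>L. linear L \<and> (\<forall>x\<in>U. f x \<in> U \<longrightarrow> \<phi> (f x) = L (\<phi> x)))"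

text \<open>
  A neighbourhood \<open>U\<close> of \<open>p\<close> with a coordinate centred at \<open>p\<close> in which \<open>f\<close> is linear.
  The last two conditions only fix the shape of \<open>U\<close>: in the coordinate, \<open>U\<close> is convex and its
  local unstable manifold is the whole slice by the unstable eigenspace of the derivative
  (the unstable manifold of the origin for that linear map). They make the local unstable
  manifold cut \<open>U\<close> into two sides. Every neighbourhood on which \<open>f\<close> is linear contains such a
  \<open>U\<close>, for the same coordinate: a small product of an ellipse in the unstable plane, adapted to
  the derivative, and an interval in the stable line.\<close>

definition linearizing_nbhd :: "enat \<Rightarrow> 'm::topological_space chart3 set \<Rightarrow>
    ('m \<Rightarrow> 'm) \<Rightarrow> 'm \<Rightarrow> 'm set \<Rightarrow> ('m \<Rightarrow> real ^ 3) \<Rightarrow> bool" where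
  "linearizing_nbhd r A f p U \<phi> \<longleftrightarrow>
     local_coord r A U \<phi> \<and> p \<in> U \<and> \<phi> p = 0 \<and> linear_in_coord U \<phi> f \<and>
     convex (\<phi> ` U) \<and>
     local_unstable_mfd U f p = {x \<in> U. \<phi> x \<in> unstable_mfd (deriv_in_coord U \<phi> f p) 0}"


section \<open>Homoclinic quadratic tangencies\<close>

text \<open>
  Regular \<open>C\<^sup>r\<close> parametrizations, defined on the open interval from \<open>-\<epsilon>\<close> to \<open>\<epsilon>\<close>, of arcs of the
  stable manifold with \<open>q\<close> at parameter \<open>0\<close>. The stable manifold is only an injectively immersed
  curve; that \<open>\<gamma>\<close> follows it in its intrinsic topology is expressed by some forward iterate
  carrying \<open>\<gamma>\<close> into the local stable manifold.\<close>

definition stable_arc :: "enat \<Rightarrow> 'm::topological_space chart3 set \<Rightarrow>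
    ('m \<Rightarrow> 'm) \<Rightarrow> 'm \<Rightarrow> 'm set \<Rightarrow> 'm \<Rightarrow> real \<Rightarrow> (real \<Rightarrow> 'm) \<Rightarrow> bool" where
  "stable_arc r A f p U q \<epsilon> \<gamma> \<longleftrightarrow>
     \<epsilon> > 0 \<and> \<gamma> 0 = q \<and> continuous_on {-\<epsilon><..<\<epsilon>} \<gamma> \<and>
     (\<forall>(V, \<psi>)\<in>A. Cr_on r {t \<in> {-\<epsilon><..<\<epsilon>}. \<gamma> t \<in> V} (\<psi> \<circ> \<gamma>) \<and>
        (\<forall>t\<in>{-\<epsilon><..<\<epsilon>}. \<gamma> t \<in> V \<longrightarrow> vector_derivative (\<psi> \<circ> \<gamma>) (at t) \<noteq> 0)) \<and>
     (\<exists>n. (f ^^ n) ` \<gamma> ` {-\<epsilon><..<\<epsilon>} \<subseteq> local_stable_mfd U f p)"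

text \<open>
  In the coordinate \<open>\<psi>\<close> on \<open>V\<close> the third component plays the role of \<open>\<tau>\<close>. Its zero set is
  required to be a relatively open piece of a forward iterate of the local unstable manifold:
  it is the sheet of the unstable manifold through \<open>q\<close>, whereas the whole unstable manifold may
  meet \<open>V\<close> in further sheets.\<close>

definition homoclinic_quadratic_tangency :: "enat \<Rightarrow> 'm::topological_space chart3 set \<Rightarrow>
    ('m \<Rightarrow> 'm) \<Rightarrow> 'm \<Rightarrow> 'm set \<Rightarrow> 'm \<Rightarrow> bool" where
  "homoclinic_quadratic_tangency r A f p U q \<longleftrightarrow>
     q \<in> unstable_mfd f p \<inter> stable_mfd f p \<and> q \<noteq> p \<and>
     (\<exists>V \<psi> m \<epsilon> \<gamma>. local_coord r A V \<psi> \<and> q \<in> V \<and>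
        openin (top_of_set ((f ^^ m) ` local_unstable_mfd U f p)) {x \<in> V. \<psi> x $ 3 = 0} \<and>
        stable_arc r A f p U q \<epsilon> \<gamma> \<and>
        (let \<tau> = (\<lambda>t. \<psi> (\<gamma> t) $ 3)
         in \<tau> 0 = 0 \<and> deriv \<tau> 0 = 0 \<and> deriv (deriv \<tau>) 0 \<noteq> 0))"

text \<open>
  How small the arc must be depends on \<open>n\<close>, because the backward iterates expand a fixed arc
  of the stable manifold out of \<open>U\<close>.\<close>

definition positively_associated :: "enat \<Rightarrow> 'm::topological_space chart3 set \<Rightarrow>
    ('m \<Rightarrow> 'm) \<Rightarrow> 'm \<Rightarrow> 'm set \<Rightarrow> 'm \<Rightarrow> bool" where
  "positively_associated r A f p U q \<longleftrightarrow>
     (\<exists>N. \<forall>n\<ge>N. \<exists>V. open V \<and> q \<in> V \<and>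
        (\<forall>\<epsilon> \<gamma>. stable_arc r A f p U q \<epsilon> \<gamma> \<and> \<gamma> ` {-\<epsilon><..<\<epsilon>} \<subseteq> V \<longrightarrow>
           (\<exists>C\<in>components (U - local_unstable_mfd U f p).
              (f ^^ n) q \<in> C \<and> (inv f ^^ n) ` (\<gamma> ` {-\<epsilon><..<\<epsilon>} - {q}) \<subseteq> C)))"


section \<open>Conjugacies and linear conformal maps\<close>

definition conjugacy ::
    "('m::topological_space \<Rightarrow> 'm) \<Rightarrow> ('m \<Rightarrow> 'm) \<Rightarrow> ('m \<Rightarrow> 'm) \<Rightarrow> bool" where
  "conjugacy f g h \<longleftrightarrow> homeomorphism UNIV UNIV h (inv h) \<and> g = h \<circ> f \<circ> inv h"

text \<open>
  Complex coordinates on the local unstable manifold: a linearizing coordinate \<open>\<phi>\<close> followed by a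
  real-linear identification \<open>T\<close> of the unstable eigenspace with the complex plane, such that \<open>f\<close>
  acts as multiplication by \<open>\<rho> e\<^sup>i\<^sup>\<theta>\<close> or by its conjugate.\<close>

definition unstable_complex_coord :: "'m::topological_space set \<Rightarrow> ('m \<Rightarrow> real ^ 3) \<Rightarrow>
    ('m \<Rightarrow> 'm) \<Rightarrow> 'm \<Rightarrow> real \<Rightarrow> real \<Rightarrow> ('m \<Rightarrow> complex) \<Rightarrow> bool" where
  "unstable_complex_coord U \<phi> f p \<rho> \<theta> z \<longleftrightarrow>
     (\<exists>T. linear T \<and> bij_betw T (unstable_mfd (deriv_in_coord U \<phi> f p) 0) UNIV \<and>
        (\<forall>x\<in>local_unstable_mfd U f p. z x = T (\<phi> x))) \<and>
     (\<exists>c\<in>{rcis \<rho> \<theta>, cnj (rcis \<rho> \<theta>)}.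
        \<forall>x\<in>local_unstable_mfd U f p. f x \<in> local_unstable_mfd U f p \<longrightarrow> z (f x) = c * z x)"

definition linear_conformal_on ::
    "'m set \<Rightarrow> ('m \<Rightarrow> complex) \<Rightarrow> ('m \<Rightarrow> complex) \<Rightarrow> ('m \<Rightarrow> 'm) \<Rightarrow> bool" where
  "linear_conformal_on D z w h \<longleftrightarrow>
     (\<exists>\<rho> \<omega>. \<rho> \<noteq> 0 \<and> (\<forall>x\<in>D. w (h x) = complex_of_real \<rho> * exp (\<i> * complex_of_real \<omega>) * z x))"

text \<open>\<open>D\<close> is a neighbourhood of \<open>p\<close> in the local unstable manifold \<open>W\<close>, small enough for \<open>h\<close> to
  map it into the local unstable manifold \<open>W'\<close>.\<close>

definition small_unstable_nbhd ::
    "'m::topological_space set \<Rightarrow> 'm \<Rightarrow> 'm set \<Rightarrow> ('m \<Rightarrow> 'm) \<Rightarrow> 'm set \<Rightarrow> bool" where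
  "small_unstable_nbhd W p W' h D \<longleftrightarrow> openin (top_of_set W) D \<and> p \<in> D \<and> h ` D \<subseteq> W'"

end

theory Submission
  imports Defs
begin

text \<open>
Near \<open>p\<close> the diffeomorphism is \<open>(z, t) \<mapsto> (\<mu> z, \<lambda> t)\<close> on \<open>\<complex> \<times> \<real>\<close>, with \<open>\<mu> = r e\<^sup>i\<^sup>\<theta>\<close>. Because \<open>f\<close>
acts linearly near \<open>p\<close>, the coordinate \<open>z\<close> of the local unstable manifold extends by
equivariance to a bijection \<open>Z\<close> of the whole unstable manifold onto \<open>\<complex>\<close>. A conjugacy \<open>h\<close> then
becomes a homeomorphism \<open>H\<close> of \<open>\<complex>\<close> with \<open>H (\<mu>\<^sub>0 z) = \<mu>\<^sub>1 H z\<close>. The theorem follows once \<open>H\<close> is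
shown to be the identity or complex conjugation in coordinates that are suitably normalised; no
choice is then left for \<open>h\<close> on the unstable manifold either, since the two cases need different
values of \<open>\<theta>\<^sub>1\<close>.

Rigidity comes from subsets of the unstable manifold that are defined topologically and yet are
half-planes in the coordinate \<open>Z\<close>. For sequences \<open>n\<^sub>k\<close> and \<open>m\<^sub>k\<close> that tend to infinity, take the
limits \<open>x\<close> of points that start near \<open>q\<close>, spend a passage of \<open>n\<^sub>k\<close> steps near \<open>p\<close>, come back near \<open>q\<close>
and spend a second passage of \<open>m\<^sub>k\<close> steps near \<open>p\<close> before they arrive near \<open>x\<close> (\<open>reach\<close>). The orbit
of \<open>q\<close> has a point \<open>(0, t\<^sub>*)\<close> on the stable axis. When the orbits come near this point for the
second time, between the two passages, their height over the sheet of the unstable manifold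
through it is about \<open>\<lambda>\<^sup>n t\<^sub>*\<close>, up to a constant factor. If \<open>\<Phi>\<close> is this height, then
\<open>\<Phi> (\<zeta>, t) = Re (A \<zeta>) + \<Phi> (0, t) + o(|\<zeta>|)\<close>, and the quadratic tangency says that
\<open>\<Phi> (0, t)\<close> vanishes at \<open>t\<^sub>*\<close> and has a strict constant sign at the other \<open>t\<close> nearby. So, up to
errors that disappear in the limit, the given height is attained over \<open>\<zeta>\<close> exactly when \<open>Re (A \<zeta>)\<close>
lies on the appropriate side of it. The second passage multiplies \<open>\<zeta>\<close> by \<open>\<mu>\<^sup>m\<close>, and in the limit the points reached fill the half-plane
bounded by the line \<open>Re (cnj u z) = \<rho>\<close>, where \<open>\<rho> = lim r\<^sup>m \<lambda>\<^sup>n\<close> and \<open>u = lim e\<^sup>i\<^sup>m\<^sup>\<theta>\<close>, after \<open>Z\<close>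
has been rescaled to absorb \<open>A\<close> and \<open>t\<^sub>*\<close> (\<open>reach_halfplane\<close>).

Conjugacies preserve \<open>reach\<close>, so \<open>H\<close> matches the half-planes that belong to the same sequences
(\<open>halfplane_conjugacy\<close>). Sequences with \<open>\<rho> = 0\<close> give a bijection \<open>u\<^sub>0 \<mapsto> u\<^sub>1\<close> of the circle that is
a continuous homomorphism, hence the identity or conjugation (\<open>corresponding_character\<close>); this
uses that the powers of \<open>e\<^sup>i\<^sup>\<theta>\<close> are dense. After a conjugation \<open>H\<close> preserves every line through \<open>0\<close>.
Choosing \<open>m\<close> in proportion to \<open>n\<close> gives a line at positive distance from \<open>0\<close>, and the distance of
its image is governed by the ratios of logarithms \<open>- ln \<lambda> / ln r\<close>, which must agree. On that
line \<open>H\<close> is multiplication by one constant; comparison with the image line under \<open>\<mu>\<^sub>0\<close>, which meets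
it, forces \<open>r\<^sub>0 = r\<^sub>1\<close> and makes the constant \<open>1\<close>. The backward images of the line under \<open>\<mu>\<^sub>0\<close> come
close to every point, so \<open>H\<close> is the identity (\<open>planar_rigidity\<close>).\<close>

section \<open>Characters of the circle and irrational rotations\<close>

lemma continuous_additive_eq_scaleR:
  fixes g :: "real \<Rightarrow> 'a::real_normed_vector"
  assumes cont: "continuous_on UNIV g" and add: "\<And>x y. g (x + y) = g x + g y"
  shows "g x = x *\<^sub>R g 1"
proof -
  have zero: "g 0 = 0" using add[of 0 0] by simp
  have neg: "g (- x) = - g x" for x using add[of x "-x"] zero by (simp add: eq_neg_iff_add_eq_0 add.commute)
  have nat: "g (of_nat n * x) = of_nat n *\<^sub>R g x" for n x
    by (induction n) (simp_all add: zero add algebra_simps)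
  have int: "g (of_int i * x) = of_int i *\<^sub>R g x" for i x
  proof (cases i)
    case (nonneg n) then show ?thesis using nat[of n x] by simp
  next
    case (neg n)
    have "g (- (real (Suc n) * x)) = - (real (Suc n) *\<^sub>R g x)" using nat[of "Suc n" x] \<open>\<And>x. g (- x) = - g x\<close> by simp
    moreover have "of_int i = - real (Suc n)" using neg by simp
    ultimately show ?thesis by (simp only: mult_minus_left scaleR_minus_left)
  qed
  have rat: "g x = x *\<^sub>R g 1" if "x \<in> \<rat>" for x
  proof -
    from \<open>x \<in> \<rat>\<close> obtain i n' :: int where x': "n' > 0" "x = of_int i / of_int n'"
      by (rule Rats_cases') blast
    define n where "n = nat n'"
    have x: "x = of_int i / of_nat n" "n \<noteq> 0" using x' by (auto simp: n_def)
    have "of_nat n *\<^sub>R g x = g (of_int i * 1)" using nat[of n x] x by simp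
    also have "\<dots> = of_int i *\<^sub>R g 1" by (rule int)
    finally have "(1 / real n) *\<^sub>R (of_nat n *\<^sub>R g x) = (1 / real n) *\<^sub>R (of_int i *\<^sub>R g 1)" by simp
    then show ?thesis using x by simp
  qed
  have "closed {x. g x = x *\<^sub>R g 1}"
    by (intro closed_Collect_eq continuous_intros cont)
  then have "closure \<rat> \<subseteq> {x. g x = x *\<^sub>R g 1}"
    by (intro closure_minimal subsetI CollectI rat)
  moreover have "x \<in> closure \<rat>" by (simp add: Rats_closure_real)
  ultimately show ?thesis by blast
qed

text \<open>
Lifting along \<open>cis\<close> and then along \<open>exp\<close> turns \<open>F\<close> into a continuous function on \<open>\<real>\<close> that is
additive up to multiples of \<open>2 \<pi> \<i>\<close>, and hence additive by connectedness. So \<open>F u = u\<^sup>n\<close> for an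
integer \<open>n\<close>, and injectivity leaves only \<open>n = 1\<close> and \<open>n = -1\<close>.\<close>

lemma circle_automorphism_id_or_cnj:
  fixes F :: "complex \<Rightarrow> complex"
  assumes cont: "continuous_on (sphere 0 1) F"
    and unit: "\<And>u. norm u = 1 \<Longrightarrow> norm (F u) = 1"
    and mult: "\<And>u v. norm u = 1 \<Longrightarrow> norm v = 1 \<Longrightarrow> F (u * v) = F u * F v"
    and inj: "inj_on F (sphere 0 1)"
  shows "(\<forall>u. norm u = 1 \<longrightarrow> F u = u) \<or> (\<forall>u. norm u = 1 \<longrightarrow> F u = cnj u)"
proof -
  have F1: "F 1 = 1" using mult[of 1 1] unit[of 1] by auto
  have "continuous_on UNIV (F \<circ> cis)"
    by (rule continuous_on_compose) (auto intro!: continuous_on_cis continuous_intros continuous_on_subset[OF cont])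
  then obtain g0 where g0: "continuous_on (UNIV::real set) g0" "\<And>x. (F \<circ> cis) x = exp (g0 x)"
  proof (rule continuous_logarithm_on_contractible)
    show "contractible (UNIV::real set)" by simp
    show "(F \<circ> cis) x \<noteq> 0" for x using unit[of "cis x"] by auto
  qed auto
  define g where "g x = g0 x - g0 0" for x
  have contg: "continuous_on UNIV g" unfolding g_def by (intro continuous_intros g0)
  have "exp (g0 0) = 1" using g0(2)[of 0] F1 by simp
  then have Fg: "F (cis x) = exp (g x)" for x using g0(2)[of x] by (simp add: g_def exp_diff)
  have "g (x + y) = g x + g y" for x y
  proof -
    let ?d = "\<lambda>x. g (x + y) - g x"
    have ed: "exp (?d x) = F (cis y)" for x
      using Fg[of "x+y"] Fg[of x] mult[of "cis x" "cis y"] unit[of "cis x"]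
      by (auto simp: exp_diff cis_mult divide_simps mult.commute)
    have "?d constant_on UNIV"
    proof (rule continuous_discrete_range_constant)
      show "connected (UNIV :: real set)" by simp
      show "continuous_on UNIV ?d"
        by (intro continuous_intros continuous_on_compose2[OF contg]) auto
      fix x
      have "2 * pi \<le> norm (?d z - ?d x)" if "?d z \<noteq> ?d x" for z
      proof -
        have "exp (?d z) = exp (?d x)" using ed by metis
        then obtain n :: int where n: "?d z = ?d x + (of_int (2 * n) * pi) * \<i>" by (auto simp: exp_eq)
        then have "n \<noteq> 0" using that by auto
        then have "1 \<le> \<bar>real_of_int n\<bar>" by linarith
        moreover have "norm (?d z - ?d x) = 2 * pi * \<bar>real_of_int n\<bar>" using n by (simp add: norm_mult)
        ultimately show ?thesis by simp
      qed
      then show "\<exists>e>0. \<forall>z. z \<in> UNIV \<and> ?d z \<noteq> ?d x \<longrightarrow> e \<le> norm (?d z - ?d x)"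
        by (intro exI[of _ "2*pi"]) auto
    qed
    then have "?d x = ?d 0" unfolding constant_on_def by (metis UNIV_I)
    then show ?thesis by (simp add: g_def algebra_simps)
  qed
  then have lin: "g x = x *\<^sub>R g 1" for x using continuous_additive_eq_scaleR[OF contg] by blast
  have "norm (exp (g 1)) = 1" using Fg[of 1] unit[of "cis 1"] by simp
  then have "Re (g 1) = 0" by simp
  define d where "d = Im (g 1)"
  have Fd: "F (cis x) = cis (d * x)" for x
  proof -
    have "g x = \<i> * complex_of_real (d * x)"
      using \<open>Re (g 1) = 0\<close> by (subst lin) (simp add: complex_eq_iff d_def)
    then show ?thesis using Fg[of x] by (simp add: cis_conv_exp)
  qed
  have cis1: "cis x = 1 \<longleftrightarrow> (\<exists>n::int. x = 2 * pi * n)" for x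
    by (auto simp: cis_conv_exp exp_eq_1)
  have inj1: "cis x = 1" if "cis (d * x) = 1" for x
    using inj_onD[OF inj, of "cis x" 1] that Fd[of x] F1 by simp
  have "cis (d * (2 * pi)) = 1" using Fd[of "2 * pi"] F1 by (simp only: cis_2pi)
  then obtain n :: int where "d * (2 * pi) = 2 * pi * n" unfolding cis1 by blast
  then have n: "d = n" by simp
  have "n \<noteq> 0"
  proof
    assume "n = 0"
    then have "cis (d * pi) = 1" using n by simp
    then have "cis pi = 1" by (rule inj1)
    then show False by simp
  qed
  have "d * (2 * pi / n) = 2 * pi" using n \<open>n \<noteq> 0\<close> by simp
  then have "cis (d * (2 * pi / n)) = 1" by (simp only: cis_2pi)
  then have "cis (2 * pi / n) = 1" by (rule inj1)
  then obtain k :: int where "2 * pi / n = 2 * pi * k" unfolding cis1 by blast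
  then have "1 = real_of_int k * real_of_int n" using \<open>n \<noteq> 0\<close> by (simp add: field_simps)
  then have "1 = k * n" by (metis of_int_eq_1_iff of_int_mult)
  then have "n = 1 \<or> n = -1" by (metis zmult_eq_1_iff)
  have u: "\<exists>t. u = cis t" if "norm u = 1" for u
    using rcis_cmod_Arg[of u] that by (metis mult_1 of_real_1 rcis_def)
  from \<open>n = 1 \<or> n = -1\<close> show ?thesis
  proof
    assume "n = 1"
    then have "F u = u" if "norm u = 1" for u using u[OF that] Fd n \<open>n = 1\<close> by auto
    then show ?thesis by auto
  next
    assume "n = -1"
    then have "F u = cnj u" if "norm u = 1" for u using u[OF that] Fd n \<open>n = -1\<close> by (auto simp: cis_cnj)
    then show ?thesis by auto
  qed
qed

text \<open>
To force the exponents to infinity, the target is first rotated back \<open>k\<close> times; a positive power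
that comes within \<open>1 / (k + 1)\<close> of the rotated target then gives an exponent larger than \<open>k\<close>.\<close>

lemma irrational_rotation_dense:
  fixes \<theta> :: real
  assumes irr: "\<theta> / (2 * pi) \<notin> \<rat>" and "norm u = 1"
  shows "\<exists>m. filterlim m at_top sequentially \<and> (\<lambda>k. cis \<theta> ^ m k) \<longlonglongrightarrow> u"
proof -
  define \<alpha> where "\<alpha> k = Arg u - real k * \<theta>" for k
  have u: "u = cis (\<alpha> k) * cis \<theta> ^ k" for k
  proof -
    have "cis (\<alpha> k) * cis \<theta> ^ k = cis (Arg u)" by (simp add: \<alpha>_def Complex.DeMoivre cis_mult)
    also have "\<dots> = u" using rcis_cmod_Arg[of u] assms(2) by (metis mult_1 of_real_1 rcis_def)
    finally show ?thesis by simp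
  qed
  have "\<exists>i j. i > 0 \<and> \<bar>of_int i * (\<theta> / (2 * pi)) - of_int j - \<alpha> k / (2 * pi)\<bar> < 1 / (real k + 1)" for k :: nat
  proof -
    have "0 < 1 / (real k + 1)" by simp
    from sequence_of_fractional_parts_is_dense[OF irr this, of "\<alpha> k / (2 * pi)"] show ?thesis
      by blast
  qed
  then obtain i j :: "nat \<Rightarrow> int" where i: "\<And>k. i k > 0"
    and ij: "\<And>k. \<bar>of_int (i k) * (\<theta> / (2 * pi)) - of_int (j k) - \<alpha> k / (2 * pi)\<bar> < 1 / (real k + 1)" by metis
  define e where "e k = of_int (i k) * \<theta> - 2 * pi * of_int (j k) - \<alpha> k" for k
  have "e \<longlonglongrightarrow> 0"
  proof (rule Lim_null_comparison)
    have "\<bar>e k\<bar> \<le> 2 * pi * inverse (real (Suc k))" for k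
    proof -
      let ?x = "of_int (i k) * (\<theta> / (2 * pi)) - of_int (j k) - \<alpha> k / (2 * pi)"
      have "e k = 2 * pi * ?x" by (simp add: e_def field_simps)
      then have "\<bar>e k\<bar> = 2 * pi * \<bar>?x\<bar>" by (simp only: abs_mult) simp
      also have "\<dots> \<le> 2 * pi * (1 / (real k + 1))"
        by (rule mult_left_mono[OF less_imp_le[OF ij]]) simp
      finally show ?thesis by (simp add: divide_inverse add.commute)
    qed
    then show "\<forall>\<^sub>F k in sequentially. norm (e k) \<le> 2 * pi * inverse (real (Suc k))"
      by (intro always_eventually allI) (simp only: real_norm_def)
    show "(\<lambda>k. 2 * pi * inverse (real (Suc k))) \<longlonglongrightarrow> 0"
      by (rule tendsto_mult_right_zero[OF LIMSEQ_inverse_real_of_nat])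
  qed
  then have lim: "(\<lambda>k. u * cis (e k)) \<longlonglongrightarrow> u"
    using tendsto_mult[OF tendsto_const[of u] tendsto_cis[of e 0]] by simp
  have "cis \<theta> ^ (nat (i k) + k) = u * cis (e k)" for k
  proof -
    have "cis (- (2 * pi * of_int (j k))) = 1" using cis_multiple_2pi[of "of_int (- j k)"] by (simp add: mult.assoc)
    moreover have "e k = (of_int (i k) * \<theta> - \<alpha> k) + (- (2 * pi * of_int (j k)))" by (simp add: e_def)
    ultimately have "cis (e k) = cis (of_int (i k) * \<theta> - \<alpha> k)" by (metis cis_mult mult.right_neutral)
    then have "u * cis (e k) = cis \<theta> ^ k * cis (of_int (i k) * \<theta>)"
      by (subst u[of k]) (simp add: cis_mult Complex.DeMoivre algebra_simps)
    also have "cis (of_int (i k) * \<theta>) = cis \<theta> ^ nat (i k)" using i[of k] by (simp add: Complex.DeMoivre)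
    finally show ?thesis by (simp add: power_add mult.commute)
  qed
  then have "(\<lambda>k. cis \<theta> ^ (nat (i k) + k)) \<longlonglongrightarrow> u" using lim by simp
  moreover have "filterlim (\<lambda>k. nat (i k) + k) at_top sequentially"
    by (rule filterlim_at_top_mono[OF filterlim_ident]) auto
  ultimately show ?thesis by blast
qed

section \<open>Homeomorphisms of the plane that match half-planes\<close>

text \<open>
Every point of a closed half-plane is a limit of interior points, obtained by moving it along the
normal \<open>u\<close>.\<close>

lemma halfplane_transfer_closed:
  fixes h :: "complex \<Rightarrow> complex"
  assumes h: "continuous_on UNIV h" and s: "s \<noteq> 0" and u: "norm u = 1"
    and imp: "\<And>z. s * (\<rho> - Re (cnj u * z)) > 0 \<Longrightarrow> s' * (\<rho>' - Re (cnj u' * h z)) \<ge> 0"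
    and z: "s * (\<rho> - Re (cnj u * z)) \<ge> 0"
  shows "s' * (\<rho>' - Re (cnj u' * h z)) \<ge> 0"
proof -
  define w where "w n = z - complex_of_real (s * inverse (real (Suc n))) * u" for n
  have cu: "cnj u * u = 1" using u by (simp add: mult.commute complex_norm_square[symmetric])
  have "Re (cnj u * w n) = Re (cnj u * z) - s * inverse (real (Suc n))" for n
  proof -
    have "cnj u * w n = cnj u * z - complex_of_real (s * inverse (real (Suc n))) * (cnj u * u)"
      by (simp only: w_def right_diff_distrib mult_ac)
    then show ?thesis by (simp only: cu mult_1_right minus_complex.sel Re_complex_of_real)
  qed
  then have "s * (\<rho> - Re (cnj u * w n)) = s * (\<rho> - Re (cnj u * z)) + s * s * inverse (real (Suc n))" for n
    by (simp only:) (simp add: algebra_simps)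
  moreover have "s * s * inverse (real (Suc n)) > 0" for n using s by (auto simp: zero_less_mult_iff)
  ultimately have "s * (\<rho> - Re (cnj u * w n)) > 0" for n using z by (smt (verit))
  then have w: "s' * (\<rho>' - Re (cnj u' * h (w n))) \<ge> 0" for n by (rule imp)
  have "(\<lambda>n. complex_of_real (s * inverse (real (Suc n))) * u) \<longlonglongrightarrow> of_real (s * 0) * u"
    by (intro tendsto_intros LIMSEQ_inverse_real_of_nat)
  then have "w \<longlonglongrightarrow> z" unfolding w_def using tendsto_diff[OF tendsto_const[of z]] by fastforce
  then have "(\<lambda>n. h (w n)) \<longlonglongrightarrow> h z"
    using h by (metis UNIV_I continuous_on_eq_continuous_at isCont_tendsto_compose open_UNIV)
  then have "(\<lambda>n. s' * (\<rho>' - Re (cnj u' * h (w n)))) \<longlonglongrightarrow> s' * (\<rho>' - Re (cnj u' * h z))"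
    by (intro tendsto_intros)
  then show ?thesis using w by (intro LIMSEQ_le_const) auto
qed

text \<open>
An interior point whose image lay on or beyond the boundary line would be mapped by \<open>k\<close> into the
closure of the exterior: this is the previous lemma for the complementary half-planes.\<close>

lemma halfplane_transfer_open:
  fixes h k :: "complex \<Rightarrow> complex"
  assumes hk: "homeomorphism UNIV UNIV h k" and s: "s' \<noteq> 0" and u: "norm u' = 1"
    and imp: "\<And>z. s * (\<rho> - Re (cnj u * z)) > 0 \<Longrightarrow> s' * (\<rho>' - Re (cnj u' * h z)) \<ge> 0"
    and z: "s * (\<rho> - Re (cnj u * z)) > 0"
  shows "s' * (\<rho>' - Re (cnj u' * h z)) > 0"
proof (rule ccontr)
  assume neg: "\<not> ?thesis"
  have k: "continuous_on UNIV k" using hk by (simp add: homeomorphism_def)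
  have s': "- s' \<noteq> 0" using s by simp
  have hz: "- s' * (\<rho>' - Re (cnj u' * h z)) \<ge> 0" using neg by simp
  have bk: "- s * (\<rho> - Re (cnj u * k w)) \<ge> 0" if "- s' * (\<rho>' - Re (cnj u' * w)) > 0" for w
  proof -
    have "h (k w) = w" using hk by (simp add: homeomorphism_def)
    then show ?thesis using imp[of "k w"] that by force
  qed
  have "- s * (\<rho> - Re (cnj u * k (h z))) \<ge> 0"
    by (rule halfplane_transfer_closed[OF k s' u bk hz])
  moreover have "k (h z) = z" using hk by (simp add: homeomorphism_def)
  ultimately show False using z by simp
qed

text \<open>
The planar data of a conjugacy between two saddle-foci: \<open>r\<^sub>0 a\<close> and \<open>r\<^sub>1 b\<close> are the expanding
multipliers and \<open>l\<^sub>0\<close>, \<open>l\<^sub>1\<close> the contracting ones. The sign of \<open>s\<^sub>j\<close> tells on which side of its boundary line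
a half-plane lies. Only interior points are assumed to have their images in the closed half-plane,
which is all that the dynamics yields; that closed half-planes and lines match is then a consequence.\<close>

locale halfplane_conjugacy =
  fixes h k :: "complex \<Rightarrow> complex" and r\<^sub>0 l\<^sub>0 s\<^sub>0 r\<^sub>1 l\<^sub>1 s\<^sub>1 :: real and a b :: complex
  assumes homeo: "homeomorphism UNIV UNIV h k" and h0: "h 0 = 0"
    and a: "norm a = 1" and b: "norm b = 1" and r: "r\<^sub>0 > 1" "r\<^sub>1 > 1"
    and l: "0 < l\<^sub>0" "l\<^sub>0 < 1" "0 < l\<^sub>1" "l\<^sub>1 < 1" and s: "s\<^sub>0 \<noteq> 0" "s\<^sub>1 \<noteq> 0"
    and corr: "\<And>n m :: nat \<Rightarrow> nat. \<And>\<rho>\<^sub>0 \<rho>\<^sub>1 u\<^sub>0 u\<^sub>1 z. filterlim n at_top sequentially \<Longrightarrow>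
      filterlim m at_top sequentially \<Longrightarrow>
      (\<lambda>k. r\<^sub>0 ^ m k * l\<^sub>0 ^ n k) \<longlonglongrightarrow> \<rho>\<^sub>0 \<Longrightarrow> (\<lambda>k. r\<^sub>1 ^ m k * l\<^sub>1 ^ n k) \<longlonglongrightarrow> \<rho>\<^sub>1 \<Longrightarrow>
      (\<lambda>k. a ^ m k) \<longlonglongrightarrow> u\<^sub>0 \<Longrightarrow> (\<lambda>k. b ^ m k) \<longlonglongrightarrow> u\<^sub>1 \<Longrightarrow>
      (s\<^sub>0 * (\<rho>\<^sub>0 - Re (cnj u\<^sub>0 * z)) > 0 \<longrightarrow> s\<^sub>1 * (\<rho>\<^sub>1 - Re (cnj u\<^sub>1 * h z)) \<ge> 0) \<and>
      (s\<^sub>1 * (\<rho>\<^sub>1 - Re (cnj u\<^sub>1 * h z)) > 0 \<longrightarrow> s\<^sub>0 * (\<rho>\<^sub>0 - Re (cnj u\<^sub>0 * z)) \<ge> 0)"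
begin

lemma hk [simp]: "h (k z) = z" and kh [simp]: "k (h z) = z"
  using homeo by (simp_all add: homeomorphism_def)

lemma contin: "continuous_on UNIV h" "continuous_on UNIV k"
  using homeo by (simp_all add: homeomorphism_def)

lemma homeo_inv: "homeomorphism UNIV UNIV k h"
  using homeo by (rule homeomorphism_symD)

lemma halfplane_conjugacy_inverse: "halfplane_conjugacy k h r\<^sub>1 l\<^sub>1 s\<^sub>1 r\<^sub>0 l\<^sub>0 s\<^sub>0 b a"
proof
  fix n m :: "nat \<Rightarrow> nat" and \<rho>\<^sub>0 \<rho>\<^sub>1 :: real and u\<^sub>0 u\<^sub>1 z :: complex
  assume "filterlim n at_top sequentially" "filterlim m at_top sequentially"
    "(\<lambda>k. r\<^sub>1 ^ m k * l\<^sub>1 ^ n k) \<longlonglongrightarrow> \<rho>\<^sub>0" "(\<lambda>k. r\<^sub>0 ^ m k * l\<^sub>0 ^ n k) \<longlonglongrightarrow> \<rho>\<^sub>1"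
    "(\<lambda>k. b ^ m k) \<longlonglongrightarrow> u\<^sub>0" "(\<lambda>k. a ^ m k) \<longlonglongrightarrow> u\<^sub>1"
  with corr[of n m \<rho>\<^sub>1 \<rho>\<^sub>0 u\<^sub>1 u\<^sub>0 "k z"]
  show "(s\<^sub>1 * (\<rho>\<^sub>0 - Re (cnj u\<^sub>0 * z)) > 0 \<longrightarrow> s\<^sub>0 * (\<rho>\<^sub>1 - Re (cnj u\<^sub>1 * k z)) \<ge> 0) \<and>
      (s\<^sub>0 * (\<rho>\<^sub>1 - Re (cnj u\<^sub>1 * k z)) > 0 \<longrightarrow> s\<^sub>1 * (\<rho>\<^sub>0 - Re (cnj u\<^sub>0 * z)) \<ge> 0)"
    by simp
qed (use a b r l s homeo_inv h0 kh[of 0] in auto)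

text \<open>
Conjugating the target plane reduces the orientation-reversing case to the other one.\<close>

lemma halfplane_conjugacy_cnj: "halfplane_conjugacy (cnj \<circ> h) (k \<circ> cnj) r\<^sub>0 l\<^sub>0 s\<^sub>0 r\<^sub>1 l\<^sub>1 s\<^sub>1 a (cnj b)"
proof
  have "homeomorphism UNIV UNIV cnj cnj"
    by (auto simp: homeomorphism_def intro!: continuous_intros surjI[of cnj cnj])
  with homeo show "homeomorphism UNIV UNIV (cnj \<circ> h) (k \<circ> cnj)" by (rule homeomorphism_compose)
  fix n m :: "nat \<Rightarrow> nat" and \<rho>\<^sub>0 \<rho>\<^sub>1 :: real and u\<^sub>0 u\<^sub>1 z :: complex
  assume *: "filterlim n at_top sequentially" "filterlim m at_top sequentially"
    "(\<lambda>k. r\<^sub>0 ^ m k * l\<^sub>0 ^ n k) \<longlonglongrightarrow> \<rho>\<^sub>0" "(\<lambda>k. r\<^sub>1 ^ m k * l\<^sub>1 ^ n k) \<longlonglongrightarrow> \<rho>\<^sub>1"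
    "(\<lambda>k. a ^ m k) \<longlonglongrightarrow> u\<^sub>0" "(\<lambda>k. cnj b ^ m k) \<longlonglongrightarrow> u\<^sub>1"
  have "(\<lambda>k. b ^ m k) \<longlonglongrightarrow> cnj u\<^sub>1" using tendsto_cnj[OF *(6)] by simp
  moreover have "Re (cnj (cnj u\<^sub>1) * h z) = Re (cnj u\<^sub>1 * (cnj \<circ> h) z)" by simp
  ultimately show "(s\<^sub>0 * (\<rho>\<^sub>0 - Re (cnj u\<^sub>0 * z)) > 0 \<longrightarrow> s\<^sub>1 * (\<rho>\<^sub>1 - Re (cnj u\<^sub>1 * (cnj \<circ> h) z)) \<ge> 0) \<and>
      (s\<^sub>1 * (\<rho>\<^sub>1 - Re (cnj u\<^sub>1 * (cnj \<circ> h) z)) > 0 \<longrightarrow> s\<^sub>0 * (\<rho>\<^sub>0 - Re (cnj u\<^sub>0 * z)) \<ge> 0)"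
    using corr[OF *(1-5), of "cnj u\<^sub>1" z] by metis
qed (use a b r l s h0 in auto)

lemma limit_unit:
  assumes "(\<lambda>k. c ^ m k) \<longlonglongrightarrow> u" and "norm c = 1"
  shows "norm (u :: complex) = 1"
proof -
  have "(\<lambda>k. norm (c ^ m k)) \<longlonglongrightarrow> norm u" by (intro tendsto_intros assms)
  then show ?thesis using assms(2) by (simp add: norm_power LIMSEQ_const_iff)
qed

lemma limit_halfplane:
  assumes lim: "filterlim n at_top sequentially" "filterlim m at_top sequentially"
      "(\<lambda>k. r\<^sub>0 ^ m k * l\<^sub>0 ^ n k) \<longlonglongrightarrow> \<rho>\<^sub>0" "(\<lambda>k. r\<^sub>1 ^ m k * l\<^sub>1 ^ n k) \<longlonglongrightarrow> \<rho>\<^sub>1"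
      "(\<lambda>k. a ^ m k) \<longlonglongrightarrow> u\<^sub>0" "(\<lambda>k. b ^ m k) \<longlonglongrightarrow> u\<^sub>1"
  shows "s\<^sub>0 * (\<rho>\<^sub>0 - Re (cnj u\<^sub>0 * z)) \<ge> 0 \<longleftrightarrow> s\<^sub>1 * (\<rho>\<^sub>1 - Re (cnj u\<^sub>1 * h z)) \<ge> 0"
    and "Re (cnj u\<^sub>0 * z) = \<rho>\<^sub>0 \<longleftrightarrow> Re (cnj u\<^sub>1 * h z) = \<rho>\<^sub>1"
proof -
  have u: "norm u\<^sub>0 = 1" "norm u\<^sub>1 = 1" using limit_unit lim a b by blast+
  interpret inv: halfplane_conjugacy k h r\<^sub>1 l\<^sub>1 s\<^sub>1 r\<^sub>0 l\<^sub>0 s\<^sub>0 b a by (rule halfplane_conjugacy_inverse)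
  have 1: "s\<^sub>1 * (\<rho>\<^sub>1 - Re (cnj u\<^sub>1 * h z)) \<ge> 0" if "s\<^sub>0 * (\<rho>\<^sub>0 - Re (cnj u\<^sub>0 * z)) \<ge> 0" for z
    using halfplane_transfer_closed[OF contin(1) s(1) u(1) _ that] corr[OF lim] by blast
  have 2: "s\<^sub>1 * (\<rho>\<^sub>1 - Re (cnj u\<^sub>1 * h z)) > 0" if "s\<^sub>0 * (\<rho>\<^sub>0 - Re (cnj u\<^sub>0 * z)) > 0" for z
    using halfplane_transfer_open[OF homeo s(2) u(2) _ that] corr[OF lim] by blast
  have 3: "s\<^sub>0 * (\<rho>\<^sub>0 - Re (cnj u\<^sub>0 * k z)) \<ge> 0" if "s\<^sub>1 * (\<rho>\<^sub>1 - Re (cnj u\<^sub>1 * z)) \<ge> 0" for z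
    using halfplane_transfer_closed[OF contin(2) s(2) u(2) _ that] inv.corr[OF lim(1,2,4,3,6,5)] by blast
  have 4: "s\<^sub>0 * (\<rho>\<^sub>0 - Re (cnj u\<^sub>0 * k z)) > 0" if "s\<^sub>1 * (\<rho>\<^sub>1 - Re (cnj u\<^sub>1 * z)) > 0" for z
    using halfplane_transfer_open[OF homeo_inv s(1) u(1) _ that] inv.corr[OF lim(1,2,4,3,6,5)] by blast
  show le: "s\<^sub>0 * (\<rho>\<^sub>0 - Re (cnj u\<^sub>0 * z)) \<ge> 0 \<longleftrightarrow> s\<^sub>1 * (\<rho>\<^sub>1 - Re (cnj u\<^sub>1 * h z)) \<ge> 0"
    using 1[of z] 3[of "h z"] kh by auto
  have lt: "s\<^sub>0 * (\<rho>\<^sub>0 - Re (cnj u\<^sub>0 * z)) > 0 \<longleftrightarrow> s\<^sub>1 * (\<rho>\<^sub>1 - Re (cnj u\<^sub>1 * h z)) > 0"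
    using 2[of z] 4[of "h z"] kh by auto
  have "Re (cnj u\<^sub>0 * z) = \<rho>\<^sub>0 \<longleftrightarrow> s\<^sub>0 * (\<rho>\<^sub>0 - Re (cnj u\<^sub>0 * z)) = 0" using s by auto
  also have "\<dots> \<longleftrightarrow> s\<^sub>1 * (\<rho>\<^sub>1 - Re (cnj u\<^sub>1 * h z)) = 0" using le lt by linarith
  also have "\<dots> \<longleftrightarrow> Re (cnj u\<^sub>1 * h z) = \<rho>\<^sub>1" using s by auto
  finally show "Re (cnj u\<^sub>0 * z) = \<rho>\<^sub>0 \<longleftrightarrow> Re (cnj u\<^sub>1 * h z) = \<rho>\<^sub>1" .
qed

end

text \<open>
Testing with the two opposite vectors on the boundary line of the second half-plane shows that the
lines agree; testing with its normal shows that the sides agree.\<close>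

lemma unit_eq_if_halfplanes_eq:
  fixes u v :: complex
  assumes u: "norm u = 1" and v: "norm v = 1" and s: "s \<noteq> 0"
    and eq: "\<And>z. s * Re (cnj u * z) \<le> 0 \<longleftrightarrow> s * Re (cnj v * z) \<le> 0"
  shows "u = v"
proof -
  define c where "c = cnj u * v"
  have vv: "cnj v * v = 1" using v by (simp add: mult.commute complex_norm_square[symmetric])
  have uu: "u * cnj u = 1" using u by (simp add: complex_norm_square[symmetric])
  have z: "cnj u * (w * v) = w * c" "cnj v * (w * v) = w" for w
    using vv by (simp_all add: c_def mult_ac)
  have e: "s * Re (w * c) \<le> 0 \<longleftrightarrow> s * Re w \<le> 0" for w
    using eq[of "w * v"] by (simp only: z)
  have "s * Im c = 0" using e[of \<i>] e[of "- \<i>"] by simp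
  then have im: "Im c = 0" using s by simp
  have "s * s * Re c \<ge> 0" using e[of "complex_of_real (- s)"] by simp
  then have "Re c \<ge> 0" using s by (metis mult_le_cancel_left_pos mult_zero_right not_real_square_gt_zero)
  moreover have "norm c = 1" using u v by (simp add: c_def norm_mult)
  ultimately have "c = 1" using im by (simp add: complex_eq_iff cmod_def)
  then have "u * (cnj u * v) = u" by (simp add: c_def)
  then show ?thesis using uu by (simp add: mult.assoc[symmetric])
qed

text \<open>
The least \<open>m\<close> for which \<open>r\<^sup>m l\<^sup>k \<ge> 1\<close>.\<close>

definition balanced_exponent :: "real \<Rightarrow> real \<Rightarrow> nat \<Rightarrow> nat" where
  "balanced_exponent r l k = nat \<lceil>- ln l / ln r * real k\<rceil>"

text \<open>
In terms of \<open>\<kappa> = - ln l / ln r\<close> one has \<open>r\<^sup>m l\<^sup>k = exp (ln r * (m - \<kappa> * k))\<close>. With \<open>m\<close> chosen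
as above, \<open>m - \<kappa> * k\<close> stays in the unit interval. A second pair \<open>r'\<close>, \<open>l'\<close> of the same
ratio therefore gives a power of the same quantity, and one of larger ratio makes it tend to \<open>0\<close>.\<close>

lemma balanced_exponents:
  fixes r l :: real
  assumes r: "r > 1" and l: "0 < l" "l < 1"
  defines "m \<equiv> balanced_exponent r l"
  shows "filterlim m at_top sequentially"
    and "r ^ m k * l ^ k \<in> {1..r}"
    and "\<lbrakk>r' > 1; 0 < l'; l' < 1; - ln l' / ln r' = - ln l / ln r\<rbrakk> \<Longrightarrow>
      r' ^ m k * l' ^ k = (r ^ m k * l ^ k) powr (ln r' / ln r)"
    and "\<lbrakk>r' > 1; 0 < l'; l' < 1; - ln l' / ln r' > - ln l / ln r\<rbrakk> \<Longrightarrow>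
      (\<lambda>k. r' ^ m k * l' ^ k) \<longlonglongrightarrow> 0"
proof -
  define \<kappa> where "\<kappa> = - ln l / ln r"
  have lnr: "ln r > 0" and lnl: "ln l < 0" using r l by auto
  have \<kappa>: "\<kappa> > 0" using divide_neg_pos[OF lnl lnr] by (simp add: \<kappa>_def)
  have m: "real (m k) = of_int \<lceil>\<kappa> * real k\<rceil>" for k
  proof -
    have "0 \<le> \<kappa> * real k" using \<kappa> by simp
    then have "0 \<le> \<lceil>\<kappa> * real k\<rceil>" by linarith
    then show ?thesis by (simp add: m_def \<kappa>_def balanced_exponent_def)
  qed
  have mb: "0 \<le> real (m k) - \<kappa> * k" "real (m k) - \<kappa> * k \<le> 1" for k
    using m[of k] by linarith+
  have formula: "r' ^ m k * l' ^ k = exp (ln r' * (real (m k) - (- ln l' / ln r') * k))"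
    if "r' > 1" "0 < l'" for r' l' k
  proof -
    have e: "ln r' * (real (m k) - (- ln l' / ln r') * k) = real (m k) * ln r' + real k * ln l'"
      using that by (simp add: field_simps)
    have "exp (real (m k) * ln r') = r' ^ m k" "exp (real k * ln l') = l' ^ k"
      using that by (simp_all add: exp_of_nat_mult)
    then show ?thesis unfolding e exp_add by simp
  qed
  show "filterlim m at_top sequentially"
  proof -
    have "filterlim (\<lambda>k. \<kappa> * real k) at_top sequentially"
      using \<kappa> by (intro filterlim_tendsto_pos_mult_at_top[OF tendsto_const] filterlim_real_sequentially)
    then have "filterlim (\<lambda>k. real (m k)) at_top sequentially"
      by (rule filterlim_at_top_mono) (use mb in \<open>auto intro!: always_eventually simp: algebra_simps\<close>)
    then show ?thesis by (simp add: filterlim_sequentially_iff_filterlim_real)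
  qed
  show "r ^ m k * l ^ k \<in> {1..r}"
  proof -
    have "ln r * (real (m k) - \<kappa> * k) \<ge> 0" using mb(1)[of k] lnr by simp
    moreover have "ln r * (real (m k) - \<kappa> * k) \<le> ln r * 1" using mb(2)[of k] lnr by (intro mult_left_mono) auto
    moreover have "exp (ln r) = r" using r by simp
    ultimately show ?thesis
      using formula[OF r l(1), of k] by (simp only: \<kappa>_def[symmetric] atLeastAtMost_iff) (metis exp_le_cancel_iff exp_zero mult.right_neutral)
  qed
  show "r' ^ m k * l' ^ k = (r ^ m k * l ^ k) powr (ln r' / ln r)"
    if *: "r' > 1" "0 < l'" "l' < 1" "- ln l' / ln r' = - ln l / ln r"
  proof -
    have "r' ^ m k * l' ^ k = exp (ln r' * (real (m k) - \<kappa> * k))"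
      using formula[OF *(1,2), of k] *(4) by (simp only: \<kappa>_def)
    also have "\<dots> = exp (ln r' / ln r * (ln r * (real (m k) - \<kappa> * k)))" using lnr by simp
    also have "\<dots> = (exp (ln r * (real (m k) - \<kappa> * k))) powr (ln r' / ln r)" by (simp add: powr_def)
    also have "exp (ln r * (real (m k) - \<kappa> * k)) = r ^ m k * l ^ k"
      using formula[OF r l(1), of k] by (simp only: \<kappa>_def)
    finally show ?thesis .
  qed
  show "(\<lambda>k. r' ^ m k * l' ^ k) \<longlonglongrightarrow> 0"
    if *: "r' > 1" "0 < l'" "l' < 1" "- ln l' / ln r' > - ln l / ln r"
  proof -
    define d where "d = - ln l' / ln r' - \<kappa>"
    have d: "d > 0" using * by (simp add: d_def \<kappa>_def)
    have lnr': "ln r' > 0" using * by simp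
    have le: "norm (r' ^ m k * l' ^ k) \<le> r' * exp (- (ln r' * d)) ^ k" for k
    proof -
      have "real (m k) - (- ln l' / ln r') * k \<le> 1 - d * k"
        using mb(2)[of k] by (simp add: d_def algebra_simps)
      then have "ln r' * (real (m k) - (- ln l' / ln r') * k) \<le> ln r' * (1 - d * k)"
        using lnr' by (intro mult_left_mono) auto
      then have "r' ^ m k * l' ^ k \<le> exp (ln r' * (1 - d * k))"
        unfolding formula[OF *(1,2)] by simp
      also have "ln r' * (1 - d * k) = ln r' + real k * (- (ln r' * d))" by (simp add: algebra_simps)
      also have "exp \<dots> = r' * exp (- (ln r' * d)) ^ k" using * by (simp only: exp_add exp_of_nat_mult) simp
      finally show ?thesis using * by simp
    qed
    have "exp (- (ln r' * d)) < 1" using lnr' d by simp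
    then have "(\<lambda>k. exp (- (ln r' * d)) ^ k) \<longlonglongrightarrow> 0" by (intro LIMSEQ_power_zero) simp
    then have lim: "(\<lambda>k. r' * exp (- (ln r' * d)) ^ k) \<longlonglongrightarrow> 0" by (rule tendsto_mult_right_zero)
    show ?thesis
      by (rule Lim_null_comparison[OF _ lim]) (rule always_eventually, rule allI, rule le)
  qed
qed

context halfplane_conjugacy
begin

text \<open>
A number \<open>n\<close> of steps in the first passage that is a large multiple of \<open>m\<close> sends the offsets of both
half-planes to \<open>0\<close>.\<close>

lemma limit_halfplane_through_0:
  assumes m: "filterlim m at_top sequentially"
    and u: "(\<lambda>k. a ^ m k) \<longlonglongrightarrow> u\<^sub>0" "(\<lambda>k. b ^ m k) \<longlonglongrightarrow> u\<^sub>1"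
  shows "s\<^sub>0 * Re (cnj u\<^sub>0 * z) \<le> 0 \<longleftrightarrow> s\<^sub>1 * Re (cnj u\<^sub>1 * h z) \<le> 0"
    and "Re (cnj u\<^sub>0 * z) = 0 \<longleftrightarrow> Re (cnj u\<^sub>1 * h z) = 0"
proof -
  have ex: "\<forall>\<^sub>F c in sequentially. r * l ^ c < 1" if "0 < l" "l < 1" for r l :: real
  proof -
    have "(\<lambda>c. r * l ^ c) \<longlonglongrightarrow> 0" using that by (intro tendsto_mult_right_zero LIMSEQ_power_zero) simp
    then show ?thesis by (rule order_tendstoD) simp
  qed
  have "\<forall>\<^sub>F c in sequentially. r\<^sub>0 * l\<^sub>0 ^ c < 1 \<and> r\<^sub>1 * l\<^sub>1 ^ c < 1 \<and> 1 \<le> c"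
    by (intro eventually_conj ex l eventually_ge_at_top)
  then obtain c where c: "r\<^sub>0 * l\<^sub>0 ^ c < 1" "r\<^sub>1 * l\<^sub>1 ^ c < 1" "1 \<le> c"
    by (metis (mono_tags, lifting) eventually_sequentially order_refl)
  have lim0: "(\<lambda>k. r ^ m k * l ^ (c * m k)) \<longlonglongrightarrow> 0" if "r * l ^ c < 1" "0 < l" "1 < r" for r l :: real
  proof -
    have "(\<lambda>k. (r * l ^ c) ^ k) \<longlonglongrightarrow> 0" using that by (intro LIMSEQ_power_zero) simp
    then have "(\<lambda>k. (r * l ^ c) ^ m k) \<longlonglongrightarrow> 0" using m by (rule filterlim_compose)
    then show ?thesis by (simp add: power_mult_distrib power_mult)
  qed
  have n: "filterlim (\<lambda>k. c * m k) at_top sequentially"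
    by (rule filterlim_at_top_mono[OF m]) (use c in auto)
  note L = limit_halfplane[OF n m lim0[OF c(1) l(1) r(1)] lim0[OF c(2) l(3) r(2)] u, of z]
  show "s\<^sub>0 * Re (cnj u\<^sub>0 * z) \<le> 0 \<longleftrightarrow> s\<^sub>1 * Re (cnj u\<^sub>1 * h z) \<le> 0" using L(1) by (simp only: diff_0 mult_minus_right neg_0_le_iff_le)
  show "Re (cnj u\<^sub>0 * z) = 0 \<longleftrightarrow> Re (cnj u\<^sub>1 * h z) = 0" using L(2) .
qed

text \<open>
Normals of matched half-planes with the origin on their boundaries. Each sequence of exponents with
offsets tending to \<open>0\<close> contributes such a pair.\<close>

definition corresponding :: "complex \<Rightarrow> complex \<Rightarrow> bool" where
  "corresponding u v \<longleftrightarrow> norm u = 1 \<and> norm v = 1 \<and>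
     (\<forall>z. s\<^sub>0 * Re (cnj u * z) \<le> 0 \<longleftrightarrow> s\<^sub>1 * Re (cnj v * h z) \<le> 0)"

lemma corresponding_unique_right: "corresponding u v \<Longrightarrow> corresponding u v' \<Longrightarrow> v = v'"
  using unit_eq_if_halfplanes_eq[OF _ _ s(2), of v v'] hk unfolding corresponding_def by metis

lemma corresponding_unique_left: "corresponding u v \<Longrightarrow> corresponding u' v \<Longrightarrow> u = u'"
  using unit_eq_if_halfplanes_eq[OF _ _ s(1), of u u'] unfolding corresponding_def by metis

lemma corresponding_limit_iterates:
  "filterlim m at_top sequentially \<Longrightarrow> (\<lambda>k. a ^ m k) \<longlonglongrightarrow> u \<Longrightarrow> (\<lambda>k. b ^ m k) \<longlonglongrightarrow> v \<Longrightarrow>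
    corresponding u v"
  unfolding corresponding_def using limit_unit a b limit_halfplane_through_0(1) by blast

lemma corresponding_closed:
  assumes uv: "\<And>n :: nat. corresponding (u n) (v n)" and lim: "u \<longlonglongrightarrow> u'" "v \<longlonglongrightarrow> v'"
  shows "corresponding u' v'"
proof -
  interpret inv: halfplane_conjugacy k h r\<^sub>1 l\<^sub>1 s\<^sub>1 r\<^sub>0 l\<^sub>0 s\<^sub>0 b a by (rule halfplane_conjugacy_inverse)
  have nu: "norm u' = 1" "norm v' = 1"
    using uv tendsto_norm[OF lim(1)] tendsto_norm[OF lim(2)] by (auto simp: corresponding_def LIMSEQ_const_iff)
  have 1: "s\<^sub>1 * (0 - Re (cnj v' * h z)) \<ge> 0" if "s\<^sub>0 * (0 - Re (cnj u' * z)) > 0" for z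
  proof -
    have "(\<lambda>n. s\<^sub>0 * (0 - Re (cnj (u n) * z))) \<longlonglongrightarrow> s\<^sub>0 * (0 - Re (cnj u' * z))"
      by (intro tendsto_intros lim)
    then have "\<forall>\<^sub>F n in sequentially. s\<^sub>0 * (0 - Re (cnj (u n) * z)) > 0"
      using that by (rule order_tendstoD)
    then have ev: "\<forall>\<^sub>F n in sequentially. s\<^sub>1 * (0 - Re (cnj (v n) * h z)) \<ge> 0"
    proof eventually_elim
      case (elim n)
      then have "s\<^sub>0 * Re (cnj (u n) * z) \<le> 0" by (simp only: diff_0 mult_minus_right neg_0_less_iff_less less_imp_le)
      then have "s\<^sub>1 * Re (cnj (v n) * h z) \<le> 0" using uv[of n] unfolding corresponding_def by blast
      then show ?case by (simp only: diff_0 mult_minus_right neg_0_le_iff_le)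
    qed
    have "(\<lambda>n. s\<^sub>1 * (0 - Re (cnj (v n) * h z))) \<longlonglongrightarrow> s\<^sub>1 * (0 - Re (cnj v' * h z))"
      by (intro tendsto_intros lim)
    then show ?thesis using ev by (rule tendsto_lowerbound) simp
  qed
  have 2: "s\<^sub>0 * (0 - Re (cnj u' * k z)) \<ge> 0" if "s\<^sub>1 * (0 - Re (cnj v' * z)) > 0" for z
  proof -
    have "(\<lambda>n. s\<^sub>1 * (0 - Re (cnj (v n) * z))) \<longlonglongrightarrow> s\<^sub>1 * (0 - Re (cnj v' * z))"
      by (intro tendsto_intros lim)
    then have "\<forall>\<^sub>F n in sequentially. s\<^sub>1 * (0 - Re (cnj (v n) * z)) > 0"
      using that by (rule order_tendstoD)
    then have ev: "\<forall>\<^sub>F n in sequentially. s\<^sub>0 * (0 - Re (cnj (u n) * k z)) \<ge> 0"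
    proof eventually_elim
      case (elim n)
      then have "s\<^sub>1 * Re (cnj (v n) * h (k z)) \<le> 0"
        by (simp only: hk diff_0 mult_minus_right neg_0_less_iff_less less_imp_le)
      then have "s\<^sub>0 * Re (cnj (u n) * k z) \<le> 0" using uv[of n] unfolding corresponding_def by blast
      then show ?case by (simp only: diff_0 mult_minus_right neg_0_le_iff_le)
    qed
    have "(\<lambda>n. s\<^sub>0 * (0 - Re (cnj (u n) * k z))) \<longlonglongrightarrow> s\<^sub>0 * (0 - Re (cnj u' * k z))"
      by (intro tendsto_intros lim)
    then show ?thesis using ev by (rule tendsto_lowerbound) simp
  qed
  have "s\<^sub>0 * Re (cnj u' * z) \<le> 0 \<longleftrightarrow> s\<^sub>1 * Re (cnj v' * h z) \<le> 0" for z
  proof -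
    have "s\<^sub>1 * (0 - Re (cnj v' * h z)) \<ge> 0" if "s\<^sub>0 * (0 - Re (cnj u' * z)) \<ge> 0"
      by (rule halfplane_transfer_closed[OF contin(1) s(1) nu(1) 1 that])
    moreover have "s\<^sub>0 * (0 - Re (cnj u' * k (h z))) \<ge> 0" if "s\<^sub>1 * (0 - Re (cnj v' * h z)) \<ge> 0"
      by (rule halfplane_transfer_closed[OF contin(2) s(2) nu(2) 2 that])
    ultimately show ?thesis
      by (simp only: kh diff_0 mult_minus_right neg_0_le_iff_le) blast
  qed
  then show ?thesis using nu by (simp add: corresponding_def)
qed

text \<open>
Otherwise the exponents that are balanced for the first map would give a line at distance at least
\<open>1\<close> from \<open>0\<close>, matched with a line through \<open>0\<close>. But \<open>H\<close> fixes \<open>0\<close>.\<close>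

lemma exponent_ratio_le: "- ln l\<^sub>1 / ln r\<^sub>1 \<le> - ln l\<^sub>0 / ln r\<^sub>0"
proof (rule ccontr)
  assume "\<not> ?thesis"
  then have lt: "- ln l\<^sub>1 / ln r\<^sub>1 > - ln l\<^sub>0 / ln r\<^sub>0" by simp
  define m where "m = balanced_exponent r\<^sub>0 l\<^sub>0"
  note m = balanced_exponents[OF r(1) l(1,2), folded m_def]
  define X where "X k = (r\<^sub>0 ^ m k * l\<^sub>0 ^ k, a ^ m k, b ^ m k)" for k
  have "compact ({1..r\<^sub>0} \<times> sphere 0 1 \<times> sphere (0::complex) 1 :: (real \<times> complex \<times> complex) set)" by (intro compact_Times) auto
  moreover have "\<forall>k. X k \<in> {1..r\<^sub>0} \<times> sphere 0 1 \<times> sphere 0 1"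
    using m(2) a b by (auto simp: X_def norm_power)
  ultimately obtain L \<phi> where L: "L \<in> {1..r\<^sub>0} \<times> sphere 0 1 \<times> sphere 0 1" "strict_mono \<phi>" "(X \<circ> \<phi>) \<longlonglongrightarrow> L"
    by (meson compact_def)
  obtain \<rho> u v where Leq: "L = (\<rho>, u, v)" by (cases L)
  note sub = filterlim_subseq[OF L(2)]
  have lims: "(\<lambda>k. r\<^sub>0 ^ m (\<phi> k) * l\<^sub>0 ^ \<phi> k) \<longlonglongrightarrow> \<rho>" "(\<lambda>k. a ^ m (\<phi> k)) \<longlonglongrightarrow> u" "(\<lambda>k. b ^ m (\<phi> k)) \<longlonglongrightarrow> v"
    using tendsto_fst[OF L(3)] tendsto_fst[OF tendsto_snd[OF L(3)]] tendsto_snd[OF tendsto_snd[OF L(3)]]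
    by (simp_all add: X_def Leq o_def)
  have "(\<lambda>k. r\<^sub>1 ^ m (\<phi> k) * l\<^sub>1 ^ \<phi> k) \<longlonglongrightarrow> 0"
    using LIMSEQ_subseq_LIMSEQ[OF m(4)[OF r(2) l(3,4) lt] L(2)] by (simp add: o_def)
  from limit_halfplane(2)[OF sub filterlim_compose[OF m(1) sub] lims(1) this lims(2,3), of 0]
  have "\<rho> = 0" by (simp add: h0)
  then show False using L(1) Leq by simp
qed

lemma exponent_ratio_eq: "- ln l\<^sub>1 / ln r\<^sub>1 = - ln l\<^sub>0 / ln r\<^sub>0"
proof -
  interpret inv: halfplane_conjugacy k h r\<^sub>1 l\<^sub>1 s\<^sub>1 r\<^sub>0 l\<^sub>0 s\<^sub>0 b a by (rule halfplane_conjugacy_inverse)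
  show ?thesis using exponent_ratio_le inv.exponent_ratio_le by linarith
qed

text \<open>
Equality of the ratios makes the two offsets powers of each other, and equality of the rotations
makes the two normals the same.\<close>

lemma offset_line:
  assumes "b = a"
  obtains \<rho> u where "\<rho> \<ge> 1" "norm u = 1"
    "\<And>z. Re (cnj u * z) = \<rho> \<longleftrightarrow> Re (cnj u * h z) = \<rho> powr (ln r\<^sub>1 / ln r\<^sub>0)"
proof -
  define m where "m = balanced_exponent r\<^sub>0 l\<^sub>0"
  note m = balanced_exponents[OF r(1) l(1,2), folded m_def]
  define X where "X k = (r\<^sub>0 ^ m k * l\<^sub>0 ^ k, a ^ m k)" for k
  have "compact ({1..r\<^sub>0} \<times> sphere (0::complex) 1 :: (real \<times> complex) set)" by (intro compact_Times) auto
  moreover have "\<forall>k. X k \<in> {1..r\<^sub>0} \<times> sphere 0 1"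
    using m(2) a b by (auto simp: X_def norm_power)
  ultimately obtain L \<phi> where L: "L \<in> {1..r\<^sub>0} \<times> sphere 0 1" "strict_mono \<phi>" "(X \<circ> \<phi>) \<longlonglongrightarrow> L"
    by (meson compact_def)
  obtain \<rho> u where Leq: "L = (\<rho>, u)" by (cases L)
  note sub = filterlim_subseq[OF L(2)]
  have lims: "(\<lambda>k. r\<^sub>0 ^ m (\<phi> k) * l\<^sub>0 ^ \<phi> k) \<longlonglongrightarrow> \<rho>" "(\<lambda>k. a ^ m (\<phi> k)) \<longlonglongrightarrow> u"
    using tendsto_fst[OF L(3)] tendsto_snd[OF L(3)] by (simp_all add: X_def Leq o_def)
  have \<rho>: "\<rho> \<ge> 1" using L(1) Leq by simp
  have "(\<lambda>k. (r\<^sub>0 ^ m (\<phi> k) * l\<^sub>0 ^ \<phi> k) powr (ln r\<^sub>1 / ln r\<^sub>0)) \<longlonglongrightarrow> \<rho> powr (ln r\<^sub>1 / ln r\<^sub>0)"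
    using \<rho> by (intro tendsto_intros lims) simp
  then have lim1: "(\<lambda>k. r\<^sub>1 ^ m (\<phi> k) * l\<^sub>1 ^ \<phi> k) \<longlonglongrightarrow> \<rho> powr (ln r\<^sub>1 / ln r\<^sub>0)"
    unfolding m(3)[OF r(2) l(3,4) exponent_ratio_eq] .
  show thesis
  proof
    show "\<rho> \<ge> 1" by (rule \<rho>)
    show "norm u = 1" using L(1) Leq by simp
    show "Re (cnj u * z) = \<rho> \<longleftrightarrow> Re (cnj u * h z) = \<rho> powr (ln r\<^sub>1 / ln r\<^sub>0)" for z
      using limit_halfplane(2)[OF sub filterlim_compose[OF m(1) sub] lims(1) lim1 lims(2) lims(2)[folded assms]] .
  qed
qed

end

lemma unit_mult_cnj: "norm u = 1 \<Longrightarrow> cnj u * u = 1" "norm u = 1 \<Longrightarrow> u * cnj u = 1" for u :: complex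
  by (simp_all add: mult.commute complex_norm_square[symmetric])

lemma cnj_sgn_mult: "z \<noteq> 0 \<Longrightarrow> cnj (sgn z) * z = of_real (norm z)" for z :: complex
proof -
  assume "z \<noteq> 0"
  have "cnj z * z = of_real (norm z * norm z)"
    by (metis complex_norm_square mult.commute power2_eq_square)
  then show ?thesis using \<open>z \<noteq> 0\<close> by (simp add: sgn_eq)
qed

lemma Re_of_real_mult: "Re (of_real c * z) = c * Re z"
  by simp

context halfplane_conjugacy
begin

text \<open>
Both directions of uniqueness turn \<open>corresponding\<close> into an injective function on the circle.
It is multiplicative because sequences of exponents can be added, and continuous because its graph is
closed in a compact space.\<close>

lemma corresponding_character:
  assumes dense: "\<And>u. norm u = 1 \<Longrightarrow> \<exists>m. filterlim m at_top sequentially \<and> (\<lambda>k. a ^ m k) \<longlonglongrightarrow> u"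
  shows "(\<forall>u. norm u = 1 \<longrightarrow> corresponding u u) \<or> (\<forall>u. norm u = 1 \<longrightarrow> corresponding u (cnj u))"
proof -
  have ex: "\<exists>m v. filterlim m at_top sequentially \<and> (\<lambda>k. a ^ m k) \<longlonglongrightarrow> u \<and> (\<lambda>k. b ^ m k) \<longlonglongrightarrow> v"
    if u: "norm u = 1" for u
  proof -
    obtain m where m: "filterlim m at_top sequentially" "(\<lambda>k. a ^ m k) \<longlonglongrightarrow> u" using dense[OF u] by blast
    have "\<forall>k. b ^ m k \<in> sphere 0 1" using b by (simp add: norm_power)
    moreover have "compact (sphere (0::complex) 1)" by simp
    ultimately obtain v \<phi> where "strict_mono \<phi>" and v: "((\<lambda>k. b ^ m k) \<circ> \<phi>) \<longlonglongrightarrow> v"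
      unfolding compact_def by meson
    then have sub: "filterlim \<phi> at_top sequentially" by (intro filterlim_subseq)
    have "(\<lambda>k. a ^ m (\<phi> k)) \<longlonglongrightarrow> u" using filterlim_compose[OF m(2) sub] .
    moreover have "filterlim (\<lambda>k. m (\<phi> k)) at_top sequentially" using filterlim_compose[OF m(1) sub] .
    ultimately show ?thesis using v unfolding o_def by blast
  qed
  have "\<exists>v. corresponding u v" if "norm u = 1" for u
    using ex[OF that] corresponding_limit_iterates by blast
  then obtain F where F: "corresponding u (F u)" if "norm u = 1" for u by metis
  have nF: "norm (F u) = 1" if "norm u = 1" for u using F[OF that] by (simp add: corresponding_def)
  have Feq: "F u = v" if "corresponding u v" for u v
    using that F corresponding_unique_right by (metis corresponding_def)
  have mult: "F (u * u') = F u * F u'" if u: "norm u = 1" "norm u' = 1" for u u'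
  proof -
    obtain m v where m: "filterlim m at_top sequentially" "(\<lambda>k. a ^ m k) \<longlonglongrightarrow> u" "(\<lambda>k. b ^ m k) \<longlonglongrightarrow> v"
      using ex[OF u(1)] by blast
    obtain m' v' where m': "filterlim m' at_top sequentially" "(\<lambda>k. a ^ m' k) \<longlonglongrightarrow> u'" "(\<lambda>k. b ^ m' k) \<longlonglongrightarrow> v'"
      using ex[OF u(2)] by blast
    have "(\<lambda>k. a ^ (m k + m' k)) \<longlonglongrightarrow> u * u'" "(\<lambda>k. b ^ (m k + m' k)) \<longlonglongrightarrow> v * v'"
      unfolding power_add by (intro tendsto_mult m m')+
    moreover have "filterlim (\<lambda>k. m k + m' k) at_top sequentially"
      by (rule filterlim_at_top_mono[OF m(1)]) auto
    ultimately have "corresponding (u * u') (v * v')" by (intro corresponding_limit_iterates)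
    then show ?thesis
      using Feq corresponding_limit_iterates[OF m] corresponding_limit_iterates[OF m'] by simp
  qed
  have "inj_on F (sphere 0 1)"
  proof (rule inj_onI)
    fix u u' assume "u \<in> sphere 0 1" "u' \<in> sphere 0 1" "F u = F u'"
    then have "corresponding u (F u)" "corresponding u' (F u)" using F[of u] F[of u'] by simp_all
    then show "u = u'" by (rule corresponding_unique_left)
  qed
  moreover have "continuous_on (sphere 0 1) F"
  proof (rule continuous_from_closed_graph)
    show "compact (sphere (0::complex) 1)" by simp
    show "F \<in> sphere 0 1 \<rightarrow> sphere 0 1" using nF by auto
    show "closed ((\<lambda>x. (x, F x)) ` sphere 0 1)"
      unfolding closed_sequential_limits
    proof safe
      fix X :: "nat \<Rightarrow> complex \<times> complex" and u v
      assume X: "\<forall>n. X n \<in> (\<lambda>x. (x, F x)) ` sphere 0 1" and lim: "X \<longlonglongrightarrow> (u, v)"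
      have XF: "corresponding (fst (X n)) (snd (X n))" for n
        using spec[OF X, of n] F by auto
      have uv: "corresponding u v"
        using corresponding_closed[OF XF] tendsto_fst[OF lim] tendsto_snd[OF lim] by simp
      then have "u \<in> sphere 0 1" "v = F u" using Feq by (auto simp: corresponding_def)
      then show "(u, v) \<in> (\<lambda>x. (x, F x)) ` sphere 0 1" by auto
    qed
  qed
  ultimately have "(\<forall>u. norm u = 1 \<longrightarrow> F u = u) \<or> (\<forall>u. norm u = 1 \<longrightarrow> F u = cnj u)"
    using circle_automorphism_id_or_cnj[OF _ nF mult] by blast
  then show ?thesis using F by metis
qed

text \<open>
Multiplication by the multipliers carries the half-planes with normals \<open>1\<close>, \<open>1\<close> to those with normals
\<open>a\<close>, \<open>b\<close>.\<close>

lemma corresponding_rotation: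
  assumes one: "corresponding 1 1" and equiv: "\<And>z. h (r\<^sub>0 * a * z) = r\<^sub>1 * b * h z"
  shows "corresponding a b"
proof -
  have sq: "cnj a * a = 1" "cnj b * b = 1" using a b by (simp_all only: unit_mult_cnj)
  have "s\<^sub>0 * Re (cnj a * z) \<le> 0 \<longleftrightarrow> s\<^sub>1 * Re (cnj b * h z) \<le> 0" for z
  proof -
    define w where "w = cnj a * z / r\<^sub>0"
    have z: "z = r\<^sub>0 * a * w" using r sq by (simp add: w_def mult.assoc[symmetric] mult.commute[of a])
    have "cnj a * z = of_real r\<^sub>0 * w" using r by (simp add: w_def)
    moreover have "cnj b * h z = of_real r\<^sub>1 * h w"
      unfolding z equiv using sq by (metis mult.assoc mult.commute mult_1)
    ultimately have e: "Re (cnj a * z) = r\<^sub>0 * Re w" "Re (cnj b * h z) = r\<^sub>1 * Re (h w)" by simp_all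
    have pos: "s * (c * x) \<le> 0 \<longleftrightarrow> s * x \<le> 0" if "c > 1" for s c x :: real
    proof -
      have "s * (c * x) = c * (s * x)" by simp
      then show ?thesis using that by (simp only: mult_le_0_iff) auto
    qed
    have "s\<^sub>0 * Re w \<le> 0 \<longleftrightarrow> s\<^sub>1 * Re (h w) \<le> 0" using one by (simp add: corresponding_def)
    then show ?thesis unfolding e using pos r by blast
  qed
  then show ?thesis using a b by (simp add: corresponding_def)
qed

text \<open>
Since \<open>h\<close> preserves every line through \<open>0\<close>, \<open>h z\<close> is a real multiple of \<open>z\<close>; on the offset line
\<open>Re (cnj u z) = \<rho>\<close> the multiple is determined by the offset of the image line, so it is a
constant \<open>q\<close>. By equivariance the multiple is \<open>q r\<^sub>1 / r\<^sub>0\<close> on the image of the line, and the two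
lines meet because \<open>a\<close> is not real. Hence \<open>r\<^sub>0 = r\<^sub>1\<close>, the power relating the offsets is the first power,
and \<open>q = 1\<close>. The backward images of the line are fixed pointwise as well. They approach lines through
\<open>0\<close> of every direction, and therefore every point of the plane.\<close>

lemma rigid_if_identical_rotation:
  assumes ab: "b = a" and a_nonreal: "Im a \<noteq> 0"
    and dense: "\<And>u. norm u = 1 \<Longrightarrow> \<exists>m. filterlim m at_top sequentially \<and> (\<lambda>k. a ^ m k) \<longlonglongrightarrow> u"
    and equiv: "\<And>z. h (r\<^sub>0 * a * z) = r\<^sub>1 * b * h z"
  shows "r\<^sub>0 = r\<^sub>1 \<and> l\<^sub>0 = l\<^sub>1 \<and> (\<forall>z. h z = z)"
proof -
  have lines: "Re (cnj u * h z) = 0" if "norm u = 1" "Re (cnj u * z) = 0" for u z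
  proof -
    obtain m where m: "filterlim m at_top sequentially" "(\<lambda>k. a ^ m k) \<longlonglongrightarrow> u" using dense \<open>norm u = 1\<close> by blast
    show ?thesis using limit_halfplane_through_0(2)[OF m m(2)[folded ab]] that(2) by blast
  qed
  have real: "\<exists>c. h z = of_real c * z" for z
  proof (cases "z = 0")
    case False
    define u where "u = \<i> * sgn z"
    have nu: "norm u = 1" using False by (simp add: u_def norm_mult norm_sgn)
    have "cnj u * z = - \<i> * (cnj (sgn z) * z)" by (simp add: u_def)
    also have "cnj (sgn z) * z = of_real (norm z)" using False by (rule cnj_sgn_mult)
    finally have "Re (cnj u * z) = 0" by simp
    then have "Re (cnj u * h z) = 0" using lines nu by blast
    then have "Re (- \<i> * (cnj (sgn z) * h z)) = 0" by (simp add: u_def)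
    then have im: "Im (cnj (sgn z) * h z) = 0" by simp
    define c where "c = Re (cnj (sgn z) * h z)"
    have "cnj (sgn z) * h z = of_real c" using im by (simp add: complex_eq_iff c_def)
    moreover have "sgn z * cnj (sgn z) = 1" using False by (simp add: complex_norm_square[symmetric] norm_sgn)
    ultimately have "h z = sgn z * of_real c" by (metis mult.assoc mult_1)
    also have "\<dots> = of_real (c / norm z) * z" by (simp add: sgn_eq)
    finally show ?thesis by blast
  qed (use h0 in auto)
  obtain \<rho> u where \<rho>: "\<rho> \<ge> 1" and u: "norm u = 1"
    and line: "\<And>z. Re (cnj u * z) = \<rho> \<longleftrightarrow> Re (cnj u * h z) = \<rho> powr (ln r\<^sub>1 / ln r\<^sub>0)"
    by (rule offset_line[OF ab]) blast
  define q where "q = \<rho> powr (ln r\<^sub>1 / ln r\<^sub>0) / \<rho>"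
  have q: "h z = of_real q * z" if z: "Re (cnj u * z) = \<rho>" for z
  proof -
    obtain c where c: "h z = of_real c * z" using real by blast
    have "cnj u * h z = of_real c * (cnj u * z)" by (simp add: c)
    then have "Re (cnj u * h z) = c * Re (cnj u * z)" by (simp only: Re_of_real_mult)
    also have "Re (cnj u * h z) = \<rho> powr (ln r\<^sub>1 / ln r\<^sub>0)" using line z by blast
    finally have "c * \<rho> = \<rho> powr (ln r\<^sub>1 / ln r\<^sub>0)" unfolding z ..
    then have "c = q" using \<rho> by (simp add: q_def field_simps)
    then show ?thesis using c by simp
  qed
  \<comment> \<open>\<open>w\<close> lies on the line and is the image under \<open>r\<^sub>0 a\<close> of another point \<open>w'\<close> of it\<close>
  have q1: "q > 0" using \<rho> by (simp add: q_def)
  have uu: "cnj u * u = 1" and aa: "cnj a * a = 1"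
    using u a by (simp_all only: unit_mult_cnj)
  define t where "t = (\<rho> * r\<^sub>0 - \<rho> * Re a) / Im a"
  define w where "w = u * Complex \<rho> t"
  have w1: "cnj u * w = Complex \<rho> t" using uu by (simp add: w_def mult.assoc[symmetric])
  define w' where "w' = w * cnj a / r\<^sub>0"
  have "cnj u * w' = Complex \<rho> t * cnj a / r\<^sub>0" using w1 by (simp add: w'_def mult.assoc[symmetric])
  then have "Re (cnj u * w') = (\<rho> * Re a + t * Im a) / r\<^sub>0" by (simp add: Re_divide_of_real)
  also have "\<dots> = \<rho>" using a_nonreal r by (simp add: t_def)
  finally have hw': "h w' = of_real q * w'" by (rule q)
  have ww': "w = r\<^sub>0 * a * w'" using r aa by (simp add: w'_def mult_ac)
  have "h w = of_real q * w" using q[of w] w1 by simp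
  moreover have "h w = r\<^sub>1 * a * (of_real q * w')" unfolding ww' equiv hw' ab ..
  ultimately have "of_real q * (r\<^sub>0 * a * w') = r\<^sub>1 * a * (of_real q * w')" by (metis ww')
  then have "(of_real r\<^sub>0 - of_real r\<^sub>1) * (of_real q * a * w') = 0"
    by (simp only: left_diff_distrib) (simp only: mult_ac right_minus_eq)
  moreover have "w' \<noteq> 0" using w1 ww' \<rho> by (auto simp: complex_eq_iff)
  moreover have "a \<noteq> 0" using a by auto
  ultimately have "complex_of_real r\<^sub>0 = complex_of_real r\<^sub>1" using q1 by simp
  then have rr: "r\<^sub>0 = r\<^sub>1" by simp
  have q_eq: "q = 1" using rr r \<rho> by (simp add: q_def)
  have ll: "l\<^sub>0 = l\<^sub>1" using exponent_ratio_eq rr r l by (simp add: divide_simps)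
  have fix_down: "h (z * cnj a / r\<^sub>0) = z * cnj a / r\<^sub>0" if "h z = z" for z
  proof -
    have z: "z = r\<^sub>0 * a * (z * cnj a / r\<^sub>0)" using r aa by (simp add: mult_ac)
    then have "r\<^sub>1 * b * h (z * cnj a / r\<^sub>0) = r\<^sub>0 * a * (z * cnj a / r\<^sub>0)" using equiv that by metis
    then have "r\<^sub>0 * a * h (z * cnj a / r\<^sub>0) = r\<^sub>0 * a * (z * cnj a / r\<^sub>0)" by (simp only: rr[symmetric] ab)
    moreover have "r\<^sub>0 * a \<noteq> 0" using r \<open>a \<noteq> 0\<close> by simp
    ultimately show ?thesis by (metis mult_left_cancel)
  qed
  have fixed: "h z = z" if "Re (cnj u * a ^ n * z) = \<rho> / r\<^sub>0 ^ n" for n z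
    using that
  proof (induction n arbitrary: z)
    case 0
    then show ?case using q q_eq by simp
  next
    case (Suc n)
    define y where "y = r\<^sub>0 * a * z"
    have zy: "z = y * cnj a / r\<^sub>0" using r aa by (simp add: y_def mult_ac)
    have "cnj u * a ^ n * y = r\<^sub>0 * (cnj u * a ^ Suc n * z)" by (simp add: y_def mult_ac)
    then have "Re (cnj u * a ^ n * y) = r\<^sub>0 * Re (cnj u * a ^ Suc n * z)"
      by (simp only: Re_of_real_mult)
    then have "Re (cnj u * a ^ n * y) = \<rho> / r\<^sub>0 ^ n" using Suc.prems r by simp
    from fix_down[OF Suc.IH[OF this]] show ?case by (simp only: zy[symmetric])
  qed
  have "h z = z" for z
  proof (cases "z = 0")
    case False
    \<comment> \<open>\<open>v\<close> makes \<open>z\<close> parallel to the limiting line; \<open>y k\<close> is the foot of the perpendicular from \<open>z\<close>\<close>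
    define v where "v = u * \<i> * cnj (sgn z)"
    have "norm v = 1" using False u by (simp add: v_def norm_mult norm_sgn)
    then obtain m where m: "filterlim m at_top sequentially" "(\<lambda>k. a ^ m k) \<longlonglongrightarrow> v" using dense by blast
    define d where "d k = \<rho> / r\<^sub>0 ^ m k - Re (cnj u * a ^ m k * z)" for k
    define y where "y k = z + of_real (d k) * (u * cnj (a ^ m k))" for k
    have dir: "cnj u * a ^ m k * (u * cnj (a ^ m k)) = 1" for k
    proof -
      have "a ^ m k * cnj (a ^ m k) = 1" 
        by (rule unit_mult_cnj(2)) (simp add: a norm_power)
      then show ?thesis using uu by (metis mult.assoc mult.commute mult_1)
    qed
    have "cnj u * a ^ m k * y k = cnj u * a ^ m k * z + of_real (d k) * (cnj u * a ^ m k * (u * cnj (a ^ m k)))" for k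
      by (simp only: y_def distrib_left mult_ac)
    then have "Re (cnj u * a ^ m k * y k) = \<rho> / r\<^sub>0 ^ m k" for k
      unfolding dir by (simp only: plus_complex.sel d_def mult_1_right Re_complex_of_real)
    then have hy: "h (y k) = y k" for k by (rule fixed)
    have zz: "cnj (sgn z) * z = of_real (norm z)" using False by (rule cnj_sgn_mult)
    have "cnj u * v * z = (cnj u * u) * \<i> * (cnj (sgn z) * z)" by (simp add: v_def mult_ac)
    then have "Re (cnj u * v * z) = 0" unfolding uu zz by simp
    moreover have "(\<lambda>k. \<rho> / r\<^sub>0 ^ m k) \<longlonglongrightarrow> 0"
    proof -
      have "(\<lambda>k. \<rho> * (1 / r\<^sub>0) ^ k) \<longlonglongrightarrow> 0" using r by (intro tendsto_mult_right_zero LIMSEQ_power_zero) simp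
      from filterlim_compose[OF this m(1)] show ?thesis by (simp add: power_one_over)
    qed
    then have "d \<longlonglongrightarrow> 0 - Re (cnj u * v * z)" unfolding d_def by (intro tendsto_intros m)
    ultimately have d: "d \<longlonglongrightarrow> 0" by simp
    have "y \<longlonglongrightarrow> z + of_real 0 * (u * cnj v)" unfolding y_def by (intro tendsto_intros d m)
    then have y: "y \<longlonglongrightarrow> z" by simp
    have "isCont h z" using contin(1) by (simp add: continuous_on_eq_continuous_at)
    then have "(\<lambda>k. h (y k)) \<longlonglongrightarrow> h z" using y by (rule isCont_tendsto_compose)
    then show ?thesis using y hy LIMSEQ_unique by auto
  qed (use h0 in simp)
  then show ?thesis using rr ll by simp
qed

theorem planar_rigidity:
  assumes a_nonreal: "Im a \<noteq> 0"
    and dense: "\<And>u. norm u = 1 \<Longrightarrow> \<exists>m. filterlim m at_top sequentially \<and> (\<lambda>k. a ^ m k) \<longlonglongrightarrow> u"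
    and equiv: "\<And>z. h (r\<^sub>0 * a * z) = r\<^sub>1 * b * h z"
  shows "r\<^sub>0 = r\<^sub>1 \<and> l\<^sub>0 = l\<^sub>1 \<and> ((b = a \<and> (\<forall>z. h z = z)) \<or> (b = cnj a \<and> (\<forall>z. h z = cnj z)))"
  using corresponding_character[OF dense]
proof
  assume c: "\<forall>u. norm u = 1 \<longrightarrow> corresponding u u"
  then have "corresponding 1 1" by simp
  then have "corresponding a b" using equiv by (rule corresponding_rotation)
  then have "b = a" using corresponding_unique_right c a by blast
  then show ?thesis using rigid_if_identical_rotation[OF _ a_nonreal dense equiv] by blast
next
  assume c: "\<forall>u. norm u = 1 \<longrightarrow> corresponding u (cnj u)"
  then have "corresponding 1 1" by (metis complex_cnj_one norm_one)
  then have "corresponding a b" using equiv by (rule corresponding_rotation)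
  then have b: "b = cnj a" using corresponding_unique_right c a by blast
  interpret conj: halfplane_conjugacy "cnj \<circ> h" "k \<circ> cnj" r\<^sub>0 l\<^sub>0 s\<^sub>0 r\<^sub>1 l\<^sub>1 s\<^sub>1 a "cnj b"
    by (rule halfplane_conjugacy_cnj)
  have "r\<^sub>0 = r\<^sub>1 \<and> l\<^sub>0 = l\<^sub>1 \<and> (\<forall>z. (cnj \<circ> h) z = z)"
    by (rule conj.rigid_if_identical_rotation) (use b a_nonreal dense equiv in auto)
  then have "h z = cnj z" for z using complex_cnj_cnj[of "h z"] by simp
  then show ?thesis using b \<open>r\<^sub>0 = r\<^sub>1 \<and> _\<close> by blast
qed

end

section \<open>Strict differentiability in local coordinates\<close>

text \<open>
Strict (strong) differentiability at a single point. It follows from being \<open>C\<^sup>1\<close> nearby and composes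
without any estimate away from the point, so charts can be changed freely; and it controls the
difference of two values that both vary, which the plain derivative does not.\<close>

definition strict_deriv :: "('a::real_normed_vector \<Rightarrow> 'b::real_normed_vector) \<Rightarrow> ('a \<Rightarrow> 'b) \<Rightarrow> 'a \<Rightarrow> bool" where
  "strict_deriv F L x \<longleftrightarrow> bounded_linear L \<and>
     (\<forall>e>0. \<exists>d>0. \<forall>y z. dist y x < d \<longrightarrow> dist z x < d \<longrightarrow>
        norm (F y - F z - L (y - z)) \<le> e * norm (y - z))"

lemma strict_derivD:
  assumes "strict_deriv F L x" "e > 0"
  obtains d where "d > 0"
    "\<And>y z. dist y x < d \<Longrightarrow> dist z x < d \<Longrightarrow> norm (F y - F z - L (y - z)) \<le> e * norm (y - z)"
  using assms unfolding strict_deriv_def by blast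

lemma strict_deriv_has_derivative: "strict_deriv F L x \<Longrightarrow> (F has_derivative L) (at x)"
  unfolding strict_deriv_def has_derivative_at_alt by (metis dist_norm dist_self)

lemma strict_deriv_bounded_linear:
  assumes "bounded_linear L" shows "strict_deriv L L x"
proof -
  interpret bounded_linear L by fact
  show ?thesis unfolding strict_deriv_def using assms by (auto simp: diff intro: exI[of _ 1])
qed

lemma strict_deriv_cong:
  assumes F: "strict_deriv F L x" and S: "open S" "x \<in> S" and eq: "\<And>y. y \<in> S \<Longrightarrow> F y = G y"
  shows "strict_deriv G L x"
  unfolding strict_deriv_def
proof (intro conjI allI impI)
  show "bounded_linear L" using F by (simp add: strict_deriv_def)
  fix e :: real assume "e > 0"
  with F obtain d where d: "d > 0"
    "\<And>y z. dist y x < d \<Longrightarrow> dist z x < d \<Longrightarrow> norm (F y - F z - L (y - z)) \<le> e * norm (y - z)"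
    by (rule strict_derivD) blast
  obtain d' where d': "d' > 0" "\<And>y. dist y x < d' \<Longrightarrow> y \<in> S" using S by (meson open_dist)
  show "\<exists>d>0. \<forall>y z. dist y x < d \<longrightarrow> dist z x < d \<longrightarrow> norm (G y - G z - L (y - z)) \<le> e * norm (y - z)"
    using d d' eq by (intro exI[of _ "min d d'"]) (metis min_less_iff_conj)
qed

lemma strict_deriv_compose:
  assumes F: "strict_deriv F L x" and G: "strict_deriv G K (F x)"
  shows "strict_deriv (G \<circ> F) (K \<circ> L) x"
  unfolding strict_deriv_def
proof (intro conjI allI impI)
  have L: "bounded_linear L" and K: "bounded_linear K" using F G by (simp_all add: strict_deriv_def)
  show "bounded_linear (K \<circ> L)" unfolding o_def using K L by (rule bounded_linear_compose)
  interpret K: bounded_linear K by (rule K)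
  obtain B where B: "B > 0" "\<And>v. norm (L v) \<le> norm v * B" using bounded_linear.pos_bounded[OF L] by blast
  obtain C where C: "C > 0" "\<And>v. norm (K v) \<le> norm v * C" using K.pos_bounded by blast
  fix e :: real assume e: "e > 0"
  have "e / (2 * C) > 0" using e C by simp
  with F obtain d1 where d1: "d1 > 0"
    "\<And>y z. dist y x < d1 \<Longrightarrow> dist z x < d1 \<Longrightarrow> norm (F y - F z - L (y - z)) \<le> e / (2 * C) * norm (y - z)"
    by (rule strict_derivD) blast
  from F zero_less_one obtain d2 where d2: "d2 > 0"
    "\<And>y z. dist y x < d2 \<Longrightarrow> dist z x < d2 \<Longrightarrow> norm (F y - F z - L (y - z)) \<le> 1 * norm (y - z)"
    by (rule strict_derivD) blast
  have "e / (2 * (B + 1)) > 0" using e B by simp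
  with G obtain d3 where d3: "d3 > 0"
    "\<And>y z. dist y (F x) < d3 \<Longrightarrow> dist z (F x) < d3 \<Longrightarrow> norm (G y - G z - K (y - z)) \<le> e / (2 * (B + 1)) * norm (y - z)"
    by (rule strict_derivD) blast
  have "isCont F x" using strict_deriv_has_derivative[OF F] has_derivative_continuous by blast
  then obtain d4 where d4: "d4 > 0" "\<And>y. dist y x < d4 \<Longrightarrow> dist (F y) (F x) < d3"
    unfolding continuous_at_eps_delta using d3(1) by blast
  have "norm ((G \<circ> F) y - (G \<circ> F) z - (K \<circ> L) (y - z)) \<le> e * norm (y - z)"
    if y: "dist y x < Min {d1, d2, d4}" and z: "dist z x < Min {d1, d2, d4}" for y z
  proof -
    have "norm (F y - F z) \<le> norm (F y - F z - L (y - z)) + norm (L (y - z))"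
      by (metis add.commute diff_add_cancel norm_triangle_ineq)
    also have "\<dots> \<le> (B + 1) * norm (y - z)"
      using d2(2)[of y z] B(2)[of "y - z"] y z by (simp add: algebra_simps)
    finally have lip: "norm (F y - F z) \<le> (B + 1) * norm (y - z)" .
    have "norm (G (F y) - G (F z) - K (F y - F z)) \<le> e / (2 * (B + 1)) * norm (F y - F z)"
      using d3(2) d4(2) y z by simp
    also have "\<dots> \<le> e / (2 * (B + 1)) * ((B + 1) * norm (y - z))"
      using lip e B by (intro mult_left_mono) auto
    also have "\<dots> = e / 2 * norm (y - z)" using B by (simp add: field_simps)
    finally have 1: "norm (G (F y) - G (F z) - K (F y - F z)) \<le> e / 2 * norm (y - z)" .
    have "norm (K (F y - F z - L (y - z))) \<le> norm (F y - F z - L (y - z)) * C" by (rule C)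
    also have "\<dots> \<le> e / (2 * C) * norm (y - z) * C"
      using d1(2)[of y z] y z C by (intro mult_right_mono) auto
    also have "\<dots> = e / 2 * norm (y - z)" using C by simp
    finally have 2: "norm (K (F y - F z - L (y - z))) \<le> e / 2 * norm (y - z)" .
    have "(G \<circ> F) y - (G \<circ> F) z - (K \<circ> L) (y - z) =
        (G (F y) - G (F z) - K (F y - F z)) + K (F y - F z - L (y - z))"
      by (simp add: K.diff)
    then show ?thesis using norm_triangle_mono[OF 1 2] by (simp add: algebra_simps)
  qed
  then show "\<exists>d>0. \<forall>y z. dist y x < d \<longrightarrow> dist z x < d \<longrightarrow>
      norm ((G \<circ> F) y - (G \<circ> F) z - (K \<circ> L) (y - z)) \<le> e * norm (y - z)"
    using d1(1) d2(1) d4(1) by (intro exI[of _ "Min {d1, d2, d4}"]) simp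
qed

text \<open>
The mean value inequality for \<open>F - DF(x)\<close>, whose derivative is small near \<open>x\<close>. Continuity of the
derivative is available only vector by vector, and is made uniform by means of a basis.\<close>

lemma strict_deriv_if_Ck_on_1:
  fixes F :: "'a::euclidean_space \<Rightarrow> 'b::real_normed_vector"
  assumes F: "Ck_on 1 S F" and S: "open S" "x \<in> S"
  shows "strict_deriv F (frechet_derivative F (at x)) x"
  unfolding strict_deriv_def
proof (intro conjI allI impI)
  define D where "D y = frechet_derivative F (at y)" for y
  have D: "(F has_derivative D y) (at y)" if "y \<in> S" for y
    using F that unfolding D_def by (simp add: frechet_derivative_works)
  have cont: "continuous_on S (\<lambda>y. D y v)" for v using F by (simp add: D_def)
  have bl: "bounded_linear (D y)" if "y \<in> S" for y using D[OF that] by (rule has_derivative_bounded_linear)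
  then show "bounded_linear (frechet_derivative F (at x))" using S by (simp add: D_def)
  fix e :: real assume e: "e > 0"
  define e' where "e' = e / DIM('a)"
  have e': "e' > 0" using e by (simp add: e'_def)
  have "\<forall>\<^sub>F y in nhds x. \<forall>b\<in>Basis. norm (D y b - D x b) < e'"
  proof (intro eventually_ball_finite ballI)
    fix b :: 'a
    have "isCont (\<lambda>y. D y b) x" using cont S continuous_on_eq_continuous_at by blast
    then have "((\<lambda>y. D y b) \<longlongrightarrow> D x b) (nhds x)"
      using tendsto_at_iff_tendsto_nhds[of "\<lambda>y. D y b" x] by (simp add: isCont_def)
    then have "\<forall>\<^sub>F y in nhds x. dist (D y b) (D x b) < e'"
      using e' by (rule tendstoD)
    then show "\<forall>\<^sub>F y in nhds x. norm (D y b - D x b) < e'" by (simp add: dist_norm)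
  qed simp
  moreover have "\<forall>\<^sub>F y in nhds x. y \<in> S" using S by (rule eventually_nhds_in_open)
  ultimately have "\<forall>\<^sub>F y in nhds x. y \<in> S \<and> (\<forall>b\<in>Basis. norm (D y b - D x b) < e')"
    by eventually_elim simp
  then obtain d where d: "d > 0" "\<And>y. dist y x < d \<Longrightarrow> y \<in> S \<and> (\<forall>b\<in>Basis. norm (D y b - D x b) < e')"
    unfolding eventually_nhds_metric by blast
  have "norm (F y - F z - D x (y - z)) \<le> e * norm (y - z)" if yz: "dist y x < d" "dist z x < d" for y z
  proof -
    interpret Dx: bounded_linear "D x" using bl S by blast
    have "norm ((F y - D x y) - (F z - D x z)) \<le> e * norm (y - z)"
    proof (rule differentiable_bound[where S = "ball x d" and f' = "\<lambda>w v. D w v - D x v"])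
      show "convex (ball x d)" by simp
      show "y \<in> ball x d" "z \<in> ball x d" using yz by (simp_all add: dist_commute)
      fix w assume "w \<in> ball x d"
      then have w: "w \<in> S" "\<And>b. b \<in> Basis \<Longrightarrow> norm (D w b - D x b) \<le> e'"
        using d(2)[of w] by (auto simp: dist_commute less_imp_le)
      show "((\<lambda>w. F w - D x w) has_derivative (\<lambda>v. D w v - D x v)) (at w within ball x d)"
        using D[OF w(1)] has_derivative_at_withinI Dx.has_derivative[OF has_derivative_ident]
        by (intro has_derivative_diff) blast+
      have lin: "linear (\<lambda>v. D w v - D x v)"
        using bl[OF w(1)] Dx.bounded_linear by (intro linear_compose_sub bounded_linear.linear)
      have "norm (D w v - D x v) \<le> e * norm v" for v
      proof -
        define E where "E v = D w v - D x v" for v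
        have lin: "linear E" using lin by (simp add: E_def[abs_def])
        have "E v = E (\<Sum>b\<in>Basis. (v \<bullet> b) *\<^sub>R b)" by (simp only: euclidean_representation)
        also have "\<dots> = (\<Sum>b\<in>Basis. (v \<bullet> b) *\<^sub>R E b)"
          by (simp only: linear_sum[OF lin] linear_cmul[OF lin])
        finally have "D w v - D x v = (\<Sum>b\<in>Basis. (v \<bullet> b) *\<^sub>R (D w b - D x b))" by (simp only: E_def)
        then have "norm (D w v - D x v) \<le> (\<Sum>b\<in>Basis. norm ((v \<bullet> b) *\<^sub>R (D w b - D x b)))"
          by (simp only: norm_sum)
        also have "\<dots> \<le> (\<Sum>b\<in>(Basis::'a set). norm v * e')"
          using w(2) Basis_le_norm by (intro sum_mono) (auto intro!: mult_mono)
        also have "\<dots> = e * norm v" by (simp add: e'_def)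
        finally show ?thesis .
      qed
      then show "onorm (\<lambda>v. D w v - D x v) \<le> e" by (rule onorm_le)
    qed
    then show ?thesis by (simp add: Dx.diff algebra_simps)
  qed
  then show "\<exists>d>0. \<forall>y z. dist y x < d \<longrightarrow> dist z x < d \<longrightarrow>
      norm (F y - F z - frechet_derivative F (at x) (y - z)) \<le> e * norm (y - z)"
    using d(1) unfolding D_def by blast
qed

lemma Cr_on_imp_strict_deriv:
  fixes F :: "'a::euclidean_space \<Rightarrow> 'b::real_normed_vector"
  assumes "Cr_on r S F" "1 \<le> r" "open S" "x \<in> S"
  shows "\<exists>L. strict_deriv F L x"
proof -
  have "Ck_on 1 S F" using assms(1,2) unfolding Cr_on_def one_enat_def by blast
  then show ?thesis using strict_deriv_if_Ck_on_1 assms(3,4) by blast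
qed

lemma chart_inverse: "chart U \<phi> \<Longrightarrow> x \<in> U \<Longrightarrow> inv_into U \<phi> (\<phi> x) = x"
  and chart_inverse': "chart U \<phi> \<Longrightarrow> y \<in> \<phi> ` U \<Longrightarrow> inv_into U \<phi> y \<in> U \<and> \<phi> (inv_into U \<phi> y) = y"
  by (auto simp: chart_def homeomorphism_def)

lemma chart_continuous: "chart U \<phi> \<Longrightarrow> continuous_on U \<phi>"
  and chart_inverse_continuous: "chart U \<phi> \<Longrightarrow> continuous_on (\<phi> ` U) (inv_into U \<phi>)"
  and chart_open: "chart U \<phi> \<Longrightarrow> open U"
  by (auto simp: chart_def homeomorphism_def)

lemma chart_open_image:
  assumes c: "chart U \<phi>" and W: "open W" "W \<subseteq> U"
  shows "open (\<phi> ` W)"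
proof -
  have "\<phi> ` W = \<phi> ` U \<inter> inv_into U \<phi> -` W"
    using chart_inverse[OF c] chart_inverse'[OF c] W by (auto simp: image_iff)
  moreover have "open (\<phi> ` U \<inter> inv_into U \<phi> -` W)"
    using chart_inverse_continuous[OF c] c W unfolding chart_def by (intro continuous_open_preimage) auto
  ultimately show ?thesis by simp
qed

lemma atlas_chart_local_coord: "Cr_atlas r A \<Longrightarrow> (U, \<phi>) \<in> A \<Longrightarrow> local_coord r A U \<phi>"
  unfolding Cr_atlas_def local_coord_def by auto

lemma atlas_cover:
  assumes "Cr_atlas r A" obtains U \<phi> where "(U, \<phi>) \<in> A" "x \<in> U"
proof -
  have "x \<in> \<Union> (fst ` A)" using assms by (simp add: Cr_atlas_def)
  then show thesis using that by auto
qed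

lemma transition_strict_deriv:
  assumes lc: "local_coord r A U \<phi>" and V: "(V, \<psi>) \<in> A" "Cr_atlas r A" and r: "1 \<le> r" and x: "x \<in> U" "x \<in> V"
  shows "\<exists>L. strict_deriv (\<psi> \<circ> inv_into U \<phi>) L (\<phi> x)" "\<exists>L. strict_deriv (\<phi> \<circ> inv_into V \<psi>) L (\<psi> x)"
proof -
  have U: "chart U \<phi>" and comp: "Cr_compatible r (U, \<phi>) (V, \<psi>)" using lc V unfolding local_coord_def by auto
  have V': "chart V \<psi>" using atlas_chart_local_coord[OF V(2,1)] by (simp add: local_coord_def)
  have "open (U \<inter> V)" using U V' chart_open by blast
  then have "open (\<phi> ` (U \<inter> V))" "open (\<psi> ` (U \<inter> V))"
    using chart_open_image U V' by (metis Int_lower1, metis Int_lower2)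
  moreover have "Cr_on r (\<phi> ` (U \<inter> V)) (\<psi> \<circ> inv_into U \<phi>)" "Cr_on r (\<psi> ` (U \<inter> V)) (\<phi> \<circ> inv_into V \<psi>)"
    using comp by (simp_all add: Cr_compatible_def)
  ultimately show "\<exists>L. strict_deriv (\<psi> \<circ> inv_into U \<phi>) L (\<phi> x)" "\<exists>L. strict_deriv (\<phi> \<circ> inv_into V \<psi>) L (\<psi> x)"
    using Cr_on_imp_strict_deriv r x by blast+
qed

text \<open>
Quantifying over all local coordinates at both ends makes the property independent of charts, so that
it passes to iterates by composition.\<close>

definition strictly_smooth_at :: "enat \<Rightarrow> 'm::topological_space chart3 set \<Rightarrow> ('m \<Rightarrow> 'm) \<Rightarrow> 'm \<Rightarrow> bool" where
  "strictly_smooth_at r A g x \<longleftrightarrow> (\<forall>U \<phi> V \<psi>. local_coord r A U \<phi> \<longrightarrow> local_coord r A V \<psi> \<longrightarrow>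
     x \<in> U \<longrightarrow> g x \<in> V \<longrightarrow> (\<exists>L. strict_deriv (\<psi> \<circ> g \<circ> inv_into U \<phi>) L (\<phi> x)))"

lemma strict_deriv_through_chart:
  assumes U: "chart U \<phi>" and V: "chart V \<psi>" and x: "x \<in> U" "g x \<in> V"
    and cont: "continuous_on UNIV g"
    and G: "strict_deriv (\<psi> \<circ> g \<circ> inv_into U \<phi>) L (\<phi> x)"
    and K: "strict_deriv (k \<circ> inv_into V \<psi>) L' (\<psi> (g x))"
  shows "strict_deriv (k \<circ> g \<circ> inv_into U \<phi>) (L' \<circ> L) (\<phi> x)"
proof (rule strict_deriv_cong)
  show "strict_deriv ((k \<circ> inv_into V \<psi>) \<circ> (\<psi> \<circ> g \<circ> inv_into U \<phi>)) (L' \<circ> L) (\<phi> x)"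
    by (rule strict_deriv_compose[OF G]) (use K x chart_inverse[OF U] in simp)
  have "open (U \<inter> g -` V)" using cont chart_open[OF U] chart_open[OF V]
    by (metis continuous_on_open_vimage open_Int open_UNIV inf_top.right_neutral)
  then show "open (\<phi> ` (U \<inter> g -` V))" by (intro chart_open_image[OF U]) auto
  show "\<phi> x \<in> \<phi> ` (U \<inter> g -` V)" using x by auto
  show "((k \<circ> inv_into V \<psi>) \<circ> (\<psi> \<circ> g \<circ> inv_into U \<phi>)) y = (k \<circ> g \<circ> inv_into U \<phi>) y"
    if "y \<in> \<phi> ` (U \<inter> g -` V)" for y
    using that chart_inverse[OF U] chart_inverse[OF V] by auto
qed

lemma strictly_smooth_at_comp:
  assumes g: "strictly_smooth_at r A g x" and k: "strictly_smooth_at r A k (g x)"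
    and cont: "continuous_on UNIV g" and A: "Cr_atlas r A"
  shows "strictly_smooth_at r A (k \<circ> g) x"
  unfolding strictly_smooth_at_def
proof (intro allI impI)
  fix U \<phi> V \<psi>
  assume *: "local_coord r A U \<phi>" "local_coord r A V \<psi>" "x \<in> U" "(k \<circ> g) x \<in> V"
  obtain W \<xi> where W: "(W, \<xi>) \<in> A" "g x \<in> W" using atlas_cover[OF A] .
  have W': "local_coord r A W \<xi>" using atlas_chart_local_coord A W by blast
  obtain L where L: "strict_deriv (\<xi> \<circ> g \<circ> inv_into U \<phi>) L (\<phi> x)"
    using g * W' W unfolding strictly_smooth_at_def by blast
  obtain L' where L': "strict_deriv (\<psi> \<circ> k \<circ> inv_into W \<xi>) L' (\<xi> (g x))"
    using k * W' W unfolding strictly_smooth_at_def by (metis o_apply)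
  have "strict_deriv ((\<psi> \<circ> k) \<circ> g \<circ> inv_into U \<phi>) (L' \<circ> L) (\<phi> x)"
    by (rule strict_deriv_through_chart[OF _ _ _ _ cont L L']) (use * W W' in \<open>auto simp: local_coord_def\<close>)
  then show "\<exists>L. strict_deriv (\<psi> \<circ> (k \<circ> g) \<circ> inv_into U \<phi>) L (\<phi> x)" unfolding o_assoc by blast
qed

lemma strictly_smooth_if_Cr_map:
  assumes g: "Cr_map r A g" and A: "Cr_atlas r A" and r: "1 \<le> r"
  shows "strictly_smooth_at r A g x"
  unfolding strictly_smooth_at_def
proof (intro allI impI)
  fix U \<phi> V \<psi>
  assume *: "local_coord r A U \<phi>" "local_coord r A V \<psi>" "x \<in> U" "g x \<in> V"
  have cont: "continuous_on UNIV g" using g by (simp add: Cr_map_def)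
  obtain C c where C: "(C, c) \<in> A" "x \<in> C" using atlas_cover[OF A] .
  obtain D d where D: "(D, d) \<in> A" "g x \<in> D" using atlas_cover[OF A] .
  have C': "chart C c" and D': "chart D d"
    using atlas_chart_local_coord[OF A C(1)] atlas_chart_local_coord[OF A D(1)] by (simp_all add: local_coord_def)
  have U: "chart U \<phi>" and V: "chart V \<psi>" using * by (simp_all add: local_coord_def)
  obtain L1 where L1: "strict_deriv (c \<circ> inv_into U \<phi>) L1 (\<phi> x)" using transition_strict_deriv(1)[OF *(1) C(1) A r] * C by blast
  obtain L3 where L3: "strict_deriv (\<psi> \<circ> inv_into D d) L3 (d (g x))" using transition_strict_deriv(2)[OF *(2) D(1) A r] * D by blast
  have "open (C \<inter> g -` D)" using cont chart_open[OF C'] chart_open[OF D']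
    by (metis continuous_on_open_vimage open_Int open_UNIV inf_top.right_neutral)
  then have "open (c ` (C \<inter> g -` D))" by (intro chart_open_image[OF C']) auto
  moreover have "Cr_on r (c ` (C \<inter> g -` D)) (d \<circ> g \<circ> inv_into C c)" using g C D by (auto simp: Cr_map_def)
  ultimately obtain L2 where L2: "strict_deriv (d \<circ> g \<circ> inv_into C c) L2 (c x)"
    using Cr_on_imp_strict_deriv r C D by blast
  have "strict_deriv (\<psi> \<circ> g \<circ> inv_into C c) (L3 \<circ> L2) (c x)"
    by (rule strict_deriv_through_chart[OF C' D' C(2) D(2) cont L2 L3])
  moreover have "strict_deriv (c \<circ> id \<circ> inv_into U \<phi>) L1 (\<phi> x)" using L1 by simp
  ultimately have "strict_deriv ((\<psi> \<circ> g) \<circ> id \<circ> inv_into U \<phi>) (L3 \<circ> L2 \<circ> L1) (\<phi> x)"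
    using strict_deriv_through_chart[OF U C', of x id L1 "\<psi> \<circ> g" "L3 \<circ> L2"] * C by (simp add: continuous_on_id)
  then show "\<exists>L. strict_deriv (\<psi> \<circ> g \<circ> inv_into U \<phi>) L (\<phi> x)" by auto
qed

lemma continuous_on_funpow:
  fixes f :: "'a::topological_space \<Rightarrow> 'a"
  shows "continuous_on UNIV f \<Longrightarrow> continuous_on UNIV (f ^^ n)"
proof (induction n)
  case (Suc n)
  then have "continuous_on UNIV (f \<circ> f ^^ n)" by (intro continuous_on_compose) (auto intro: continuous_on_subset)
  then show ?case by (simp only: funpow.simps)
qed (simp add: id_def)

lemma strictly_smooth_funpow:
  assumes "Cr_map r A g" "Cr_atlas r A" "1 \<le> r"
  shows "strictly_smooth_at r A (g ^^ n) x"
proof (induction n arbitrary: x)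
  case 0
  show ?case unfolding strictly_smooth_at_def
  proof (intro allI impI)
    fix U \<phi> V \<psi>
    assume *: "local_coord r A U \<phi>" "local_coord r A V \<psi>" "x \<in> U" "(g ^^ 0) x \<in> V"
    obtain C c where C: "(C, c) \<in> A" "x \<in> C" using atlas_cover[OF assms(2)] .
    obtain L1 where L1: "strict_deriv (c \<circ> inv_into U \<phi>) L1 (\<phi> x)"
      using transition_strict_deriv(1)[OF *(1) C(1) assms(2,3)] * C by blast
    obtain L2 where L2: "strict_deriv (\<psi> \<circ> inv_into C c) L2 (c x)"
      using transition_strict_deriv(2)[OF *(2) C(1) assms(2,3), of x] * C by auto
    have "strict_deriv (\<psi> \<circ> id \<circ> inv_into U \<phi>) (L2 \<circ> L1) (\<phi> x)"
      using strict_deriv_through_chart[of U \<phi> C c x id L1 \<psi> L2] * C L1 L2 atlas_chart_local_coord[OF assms(2) C(1)]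
      by (simp add: continuous_on_id local_coord_def)
    then show "\<exists>L. strict_deriv (\<psi> \<circ> (g ^^ 0) \<circ> inv_into U \<phi>) L (\<phi> x)" by auto
  qed
next
  case (Suc n)
  have "continuous_on UNIV (g ^^ n)" using assms(1) by (intro continuous_on_funpow) (simp add: Cr_map_def)
  then show ?case
    using strictly_smooth_at_comp[OF Suc strictly_smooth_if_Cr_map[OF assms] _ assms(2)]
    by (simp only: funpow.simps)
qed

section \<open>Linear saddle-foci\<close>

text \<open>
Real and imaginary parts of the eigenvector equation of the real matrix.\<close>

lemma complex_eigenvector_parts:
  fixes L :: "real ^ 3 \<Rightarrow> real ^ 3" and v :: "complex ^ 3"
  assumes lin: "linear L" and ev: "(\<chi> i j. complex_of_real (matrix L $ i $ j)) *v v = \<mu> *s v"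
  defines "a \<equiv> \<chi> i. Re (v $ i)" and "b \<equiv> \<chi> i. Im (v $ i)"
  shows "L a = Re \<mu> *\<^sub>R a - Im \<mu> *\<^sub>R b" "L b = Im \<mu> *\<^sub>R a + Re \<mu> *\<^sub>R b"
proof -
  have comp: "(\<Sum>j\<in>UNIV. complex_of_real (matrix L $ i $ j) * v $ j) = \<mu> * v $ i" for i
    using arg_cong[OF ev, of "\<lambda>w. w $ i"] by (simp add: matrix_vector_mult_def)
  have "L a = matrix L *v a" "L b = matrix L *v b" using lin by (simp_all add: matrix_works)
  then have La: "L a $ i = (\<Sum>j\<in>UNIV. matrix L $ i $ j * Re (v $ j))"
    and Lb: "L b $ i = (\<Sum>j\<in>UNIV. matrix L $ i $ j * Im (v $ j))" for i
    by (simp_all add: matrix_vector_mult_def a_def b_def)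
  have "L a $ i = Re (\<mu> * v $ i)" "L b $ i = Im (\<mu> * v $ i)" for i
    unfolding La Lb comp[symmetric] by simp_all
  then show "L a = Re \<mu> *\<^sub>R a - Im \<mu> *\<^sub>R b" "L b = Im \<mu> *\<^sub>R a + Re \<mu> *\<^sub>R b"
    by (simp_all add: vec_eq_iff a_def b_def)
qed

text \<open>
The real and imaginary parts \<open>a\<close>, \<open>b\<close> of an eigenvector for \<open>cnj \<mu>\<close> span a plane on which \<open>L\<close> is
multiplication by \<open>\<mu>\<close> with respect to the identification \<open>x + \<i> y \<mapsto> x a + y b\<close> (with an
eigenvector for \<open>\<mu>\<close> it would be \<open>cnj \<mu>\<close>). A real eigenvector \<open>c\<close> for \<open>lam\<close> spans the third direction.
Independence holds because a relation between \<open>a\<close>, \<open>b\<close>, \<open>c\<close> is carried to another one by \<open>L\<close>, and two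
such relations eliminate \<open>c\<close>.\<close>

lemma saddle_focus_normal_form:
  fixes L :: "real ^ 3 \<Rightarrow> real ^ 3"
  assumes lin: "linear L" and \<mu>: "cnj \<mu> \<in> complex_eigenvalues L" "Im \<mu> \<noteq> 0"
    and lam: "complex_of_real lam \<in> complex_eigenvalues L"
  obtains S :: "complex \<times> real \<Rightarrow> real ^ 3" and S' :: "real ^ 3 \<Rightarrow> complex \<times> real"
  where "linear S" "linear S'" "\<And>x. S' (S x) = x" "\<And>v. S (S' v) = v"
    "\<And>z t. L (S (z, t)) = S (\<mu> * z, lam * t)"
proof -
  obtain v :: "complex ^ 3" where v: "v \<noteq> 0" "(\<chi> i j. complex_of_real (matrix L $ i $ j)) *v v = cnj \<mu> *s v"
    using \<mu> unfolding complex_eigenvalues_def by blast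
  obtain w :: "complex ^ 3" where w: "w \<noteq> 0" "(\<chi> i j. complex_of_real (matrix L $ i $ j)) *v w = of_real lam *s w"
    using lam unfolding complex_eigenvalues_def by blast
  define a :: "real ^ 3" where "a = (\<chi> i. Re (v $ i))"
  define b :: "real ^ 3" where "b = (\<chi> i. Im (v $ i))"
  have La: "L a = Re \<mu> *\<^sub>R a + Im \<mu> *\<^sub>R b" and Lb: "L b = Re \<mu> *\<^sub>R b - Im \<mu> *\<^sub>R a"
    using complex_eigenvector_parts[OF lin v(2)] by (simp_all add: a_def b_def)
  have ab: "a \<noteq> 0 \<or> b \<noteq> 0" using v(1) by (auto simp: a_def b_def vec_eq_iff complex_eq_iff)
  obtain c :: "real ^ 3" where c: "c \<noteq> 0" "L c = lam *\<^sub>R c"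
  proof (cases "(\<chi> i. Re (w $ i)) = (0 :: real ^ 3)")
    case False
    then show thesis using that[of "\<chi> i. Re (w $ i)"] complex_eigenvector_parts(1)[OF lin w(2)] by simp
  next
    case True
    then have "(\<chi> i. Im (w $ i)) \<noteq> (0 :: real ^ 3)" using w(1) by (auto simp: vec_eq_iff complex_eq_iff)
    then show thesis using that[of "\<chi> i. Im (w $ i)"] complex_eigenvector_parts(2)[OF lin w(2)] by simp
  qed
  define S where "S = (\<lambda>x :: complex \<times> real. Re (fst x) *\<^sub>R a + Im (fst x) *\<^sub>R b + snd x *\<^sub>R c)"
  have linS: "linear S" by (rule linearI) (simp_all add: S_def algebra_simps)
  have LS: "L (S (z, t)) = S (\<mu> * z, lam * t)" for z t
  proof -
    have "L (S (z, t)) = Re z *\<^sub>R L a + Im z *\<^sub>R L b + t *\<^sub>R L c"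
      by (simp add: S_def linear_add[OF lin] linear_cmul[OF lin])
    then show ?thesis unfolding La Lb c(2) by (simp add: S_def algebra_simps)
  qed
  have "inj S"
    unfolding linear_injective_0[OF linS]
  proof safe
    fix z t assume S0: "S (z, t) = 0"
    have "z = 0"
    proof (rule ccontr)
      assume "z \<noteq> 0"
      define w where "w = (\<mu> - of_real lam) * z"
      have "\<mu> - of_real lam \<noteq> 0" using \<mu>(2) by (auto simp: complex_eq_iff)
      then have w0: "w \<noteq> 0" using \<open>z \<noteq> 0\<close> by (simp add: w_def)
      have "S (\<mu> * z, lam * t) = 0" using LS[of z t] S0 linear_0[OF lin] by simp
      moreover have "(w, 0) = (\<mu> * z, lam * t) - lam *\<^sub>R (z, t)"
        by (simp add: w_def scaleR_conv_of_real algebra_simps)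
      ultimately have Sw: "S (w, 0) = 0" using S0 by (simp only: linear_diff[OF linS] linear_cmul[OF linS]) simp
      then have Smw: "S (\<mu> * w, 0) = 0" using LS[of w 0] linear_0[OF lin] by simp
      have all: "S (\<zeta>, 0) = 0" for \<zeta>
      proof -
        define \<beta> where "\<beta> = Im (\<zeta> / w) / Im \<mu>"
        define \<alpha> where "\<alpha> = Re (\<zeta> / w) - \<beta> * Re \<mu>"
        have "\<zeta> / w = of_real \<alpha> + of_real \<beta> * \<mu>" using \<mu>(2) by (simp add: complex_eq_iff \<alpha>_def \<beta>_def)
        then have "\<zeta> = of_real \<alpha> * w + of_real \<beta> * (\<mu> * w)" using w0 by (simp add: divide_simps algebra_simps)
        then have "(\<zeta>, 0 :: real) = \<alpha> *\<^sub>R (w, 0) + \<beta> *\<^sub>R (\<mu> * w, 0)" by (simp add: scaleR_conv_of_real)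
        then show ?thesis using Sw Smw by (simp only: linear_add[OF linS] linear_cmul[OF linS]) simp
      qed
      have "a = 0" "b = 0" using all[of 1] all[of \<i>] by (simp_all add: S_def)
      then show False using ab by simp
    qed
    then show "(z, t) = 0" using S0 c(1) by (simp add: S_def zero_prod_def)
  qed
  then obtain S' where S': "linear S'" "S' \<circ> S = id" using linear_injective_left_inverse[OF linS] by blast
  have "dim (range S) = DIM(complex \<times> real)"
    using dim_image_eq[OF linS, of UNIV] \<open>inj S\<close> by (simp add: dim_UNIV)
  then have "span (range S) = UNIV" using dim_eq_full[of "range S"] by simp
  then have "range S = UNIV" using linear_subspace_image[OF linS subspace_UNIV] by (metis span_eq_iff)
  then have "S (S' v) = v" for v using S'(2) by (metis comp_apply id_apply rangeE UNIV_I)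
  then show thesis using that[OF linS S'(1)] S'(2) LS by (metis comp_apply id_apply)
qed

lemma linear_unstable_mfd:
  fixes L :: "real ^ 3 \<Rightarrow> real ^ 3" and S :: "complex \<times> real \<Rightarrow> real ^ 3"
  assumes S: "linear S" "linear S'" "\<And>x. S' (S x) = x" "\<And>v. S (S' v) = v"
    and LS: "\<And>z t. L (S (z, t)) = S (\<mu> * z, lam * t)"
    and \<mu>: "norm \<mu> > 1" and lam: "0 < lam" "lam < 1"
  shows "unstable_mfd L 0 = range (\<lambda>z. S (z, 0))"
proof -
  have nz: "\<mu> \<noteq> 0" using \<mu> by auto
  have L_eq: "L v = S (\<mu> * fst (S' v), lam * snd (S' v))" for v
    using LS[of "fst (S' v)" "snd (S' v)"] S(4) by simp
  have "inj L"
    by (rule injI) (metis L_eq S(3,4) Pair_inject mult_left_cancel nz less_irrefl lam(1) prod.collapse)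
  then have inv1: "inv L (S (z, t)) = S (z / \<mu>, t / lam)" for z t
    using LS[of "z / \<mu>" "t / lam"] nz lam by (intro inv_f_eq) auto
  have inv: "(inv L ^^ n) (S (z, t)) = S (z / \<mu> ^ n, t / lam ^ n)" for n z t
    by (induction n) (simp_all add: inv1 field_simps)
  show ?thesis
  proof (rule set_eqI, rule iffI)
    fix v assume "v \<in> unstable_mfd L 0"
    then have "(\<lambda>n. (inv L ^^ n) v) \<longlonglongrightarrow> 0" by (simp add: unstable_mfd_def stable_mfd_def)
    then have "(\<lambda>n. S' ((inv L ^^ n) v)) \<longlonglongrightarrow> S' 0"
      using linear_continuous_at[OF S(2)[THEN linear_conv_bounded_linear[THEN iffD1]]] isCont_tendsto_compose by blast
    then have lim: "(\<lambda>n. snd (S' ((inv L ^^ n) v))) \<longlonglongrightarrow> snd (S' 0)" by (rule tendsto_snd)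
    define t where "t = snd (S' v)"
    define z where "z = fst (S' v)"
    have vS: "v = S (z, t)" using S(4) by (simp add: z_def t_def)
    have "(\<lambda>n. t / lam ^ n) \<longlonglongrightarrow> 0" using lim unfolding vS inv S(3) linear_0[OF S(2)] by simp
    then have "(\<lambda>n. t / lam ^ n * lam ^ n) \<longlonglongrightarrow> 0 * 0"
      using lam by (intro tendsto_mult LIMSEQ_power_zero) auto
    then have "t = 0" using lam by (simp add: LIMSEQ_const_iff)
    then show "v \<in> range (\<lambda>z. S (z, 0))" using vS by blast
  next
    fix v assume "v \<in> range (\<lambda>z. S (z, 0))"
    then obtain z where v: "v = S (z, 0)" by blast
    have "(\<lambda>n. z * (1 / \<mu>) ^ n) \<longlonglongrightarrow> 0"
      using \<mu> by (intro tendsto_mult_right_zero LIMSEQ_power_zero) (simp add: norm_divide divide_less_eq)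
    then have "(\<lambda>n. (z / \<mu> ^ n, 0 :: real)) \<longlonglongrightarrow> (0, 0)"
      by (intro tendsto_Pair) (simp_all add: power_one_over field_simps)
    then have "(\<lambda>n. S (z / \<mu> ^ n, 0)) \<longlonglongrightarrow> S (0, 0)"
      using linear_continuous_at[OF S(1)[THEN linear_conv_bounded_linear[THEN iffD1]]] isCont_tendsto_compose by blast
    then show "v \<in> unstable_mfd L 0"
      using linear_0[OF S(1)] by (simp add: unstable_mfd_def stable_mfd_def v inv zero_prod_def)
  qed
qed

section \<open>Passages near a saddle-focus\<close>

lemma inv_funpow_funpow: "bij f \<Longrightarrow> (inv f ^^ n) ((f ^^ n) x) = x" for f :: "'a \<Rightarrow> 'a"
proof (induction n)
  case (Suc n)
  have "(inv f ^^ Suc n) ((f ^^ Suc n) x) = (inv f ^^ n) (inv f (f ((f ^^ n) x)))"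
    by (simp only: funpow_Suc_right[of n "inv f"] funpow.simps(2)[of n f] o_apply)
  also have "\<dots> = x" using Suc by (simp add: bij_is_inj)
  finally show ?case .
qed simp

lemma funpow_inv_funpow: "bij f \<Longrightarrow> (f ^^ n) ((inv f ^^ n) x) = x" for f :: "'a \<Rightarrow> 'a"
proof (induction n)
  case (Suc n)
  have "(f ^^ Suc n) ((inv f ^^ Suc n) x) = (f ^^ n) (f (inv f ((inv f ^^ n) x)))"
    by (simp only: funpow_Suc_right[of n f] funpow.simps(2)[of n "inv f"] o_apply)
  also have "\<dots> = x" using Suc by (simp add: bij_is_surj surj_f_inv_f)
  finally show ?case .
qed simp

lemma inv_funpow_funpow_le: "bij f \<Longrightarrow> i \<le> n \<Longrightarrow> (inv f ^^ i) ((f ^^ n) x) = (f ^^ (n - i)) x" for f :: "'a \<Rightarrow> 'a"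
  using inv_funpow_funpow[of f i "(f ^^ (n - i)) x"] funpow_add[of i "n - i" f] by simp

lemma funpow_inv_funpow_le: "bij f \<Longrightarrow> i \<le> n \<Longrightarrow> (f ^^ i) ((inv f ^^ n) x) = (inv f ^^ (n - i)) x" for f :: "'a \<Rightarrow> 'a"
  using funpow_inv_funpow[of f i "(inv f ^^ (n - i)) x"] funpow_add[of i "n - i" "inv f"] by simp

lemma stable_mfd_image: "x \<in> stable_mfd f p \<Longrightarrow> f x \<in> stable_mfd f p"
proof -
  assume "x \<in> stable_mfd f p"
  then have "(\<lambda>n. (f ^^ n) x) \<longlonglongrightarrow> p" by (simp add: stable_mfd_def)
  then have "(\<lambda>n. (f ^^ Suc n) x) \<longlonglongrightarrow> p" by (rule LIMSEQ_Suc)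
  then show ?thesis unfolding stable_mfd_def by (simp only: funpow_Suc_right o_apply mem_Collect_eq)
qed

lemma stable_mfd_preimage: "f x \<in> stable_mfd f p \<Longrightarrow> x \<in> stable_mfd f p"
proof -
  assume "f x \<in> stable_mfd f p"
  then have "(\<lambda>n. (f ^^ Suc n) x) \<longlonglongrightarrow> p"
    unfolding stable_mfd_def by (simp only: funpow_Suc_right o_apply mem_Collect_eq)
  then show ?thesis unfolding stable_mfd_def mem_Collect_eq by (rule LIMSEQ_imp_Suc)
qed

text \<open>
Orbit segments of lengths \<open>l k\<close> from near \<open>a\<close> to near \<open>b\<close> that stay close to \<open>p\<close> except for a bounded
number of steps at either end. The last condition excludes segments that leave \<open>p\<close>, follow a
homoclinic orbit and return. It is expressed by neighbourhoods alone, so that conjugacies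
preserve it.\<close>

definition passage :: "('m::topological_space \<Rightarrow> 'm) \<Rightarrow> 'm \<Rightarrow> 'm \<Rightarrow> 'm \<Rightarrow> (nat \<Rightarrow> nat) \<Rightarrow> (nat \<Rightarrow> 'm) \<Rightarrow> bool" where
  "passage f p a b l y \<longleftrightarrow> y \<longlonglongrightarrow> a \<and> (\<lambda>k. (f ^^ l k) (y k)) \<longlonglongrightarrow> b \<and>
     (\<forall>\<Omega>. open \<Omega> \<and> p \<in> \<Omega> \<longrightarrow>
        (\<exists>N. \<forall>\<^sub>F k in sequentially. \<forall>i. N \<le> i \<and> i + N \<le> l k \<longrightarrow> (f ^^ i) (y k) \<in> \<Omega>))"

lemma passage_cong:
  assumes "passage f p a b l y" and eq: "\<forall>\<^sub>F k in sequentially. l k = l' k \<and> y k = y' k"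
  shows "passage f p a b l' y'"
  unfolding passage_def
proof (intro conjI allI impI)
  have P: "y \<longlonglongrightarrow> a" "(\<lambda>k. (f ^^ l k) (y k)) \<longlonglongrightarrow> b"
    and Q: "\<And>\<Omega>. open \<Omega> \<and> p \<in> \<Omega> \<Longrightarrow>
        (\<exists>N. \<forall>\<^sub>F k in sequentially. \<forall>i. N \<le> i \<and> i + N \<le> l k \<longrightarrow> (f ^^ i) (y k) \<in> \<Omega>)"
    using assms(1) by (simp_all add: passage_def)
  show "y' \<longlonglongrightarrow> a" by (rule Lim_transform_eventually[OF P(1)]) (use eq in eventually_elim, simp)
  show "(\<lambda>k. (f ^^ l' k) (y' k)) \<longlonglongrightarrow> b"
    by (rule Lim_transform_eventually[OF P(2)]) (use eq in eventually_elim, simp)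
  fix \<Omega> assume "open \<Omega> \<and> p \<in> \<Omega>"
  from Q[OF this] obtain N where "\<forall>\<^sub>F k in sequentially. \<forall>i. N \<le> i \<and> i + N \<le> l k \<longrightarrow> (f ^^ i) (y k) \<in> \<Omega>" by blast
  with eq have "\<forall>\<^sub>F k in sequentially. \<forall>i. N \<le> i \<and> i + N \<le> l' k \<longrightarrow> (f ^^ i) (y' k) \<in> \<Omega>"
    by eventually_elim auto
  then show "\<exists>N. \<forall>\<^sub>F k in sequentially. \<forall>i. N \<le> i \<and> i + N \<le> l' k \<longrightarrow> (f ^^ i) (y' k) \<in> \<Omega>" by blast
qed

lemma continuous_UNIV_tendsto: "continuous_on UNIV g \<Longrightarrow> x \<longlonglongrightarrow> a \<Longrightarrow> (\<lambda>k. g (x k)) \<longlonglongrightarrow> g a"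
  by (rule continuous_on_tendsto_compose) auto

lemma conjugacy_funpow:
  assumes "conjugacy f g h" shows "h ((f ^^ n) x) = (g ^^ n) (h x)"
proof -
  have "inv h (h x) = x" for x using assms by (simp add: conjugacy_def homeomorphism_def)
  then have "h (f x) = g (h x)" for x using assms by (simp add: conjugacy_def)
  then show ?thesis by (induction n) simp_all
qed

lemma conjugacy_sym:
  assumes "conjugacy f g h" shows "conjugacy g f (inv h)"
proof -
  have hom: "homeomorphism UNIV UNIV h (inv h)" and g: "g = h \<circ> f \<circ> inv h" using assms by (simp_all add: conjugacy_def)
  have i: "inv h (h x) = x" "h (inv h x) = x" for x using hom by (simp_all add: homeomorphism_def)
  then have "bij h" by (metis bij_betw_def injI surjI)
  then have ii: "inv (inv h) = h" by (rule inv_inv_eq)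
  have "f = inv h \<circ> g \<circ> h" by (rule ext) (simp add: g i)
  then show ?thesis unfolding conjugacy_def ii using homeomorphism_symD[OF hom] by blast
qed

lemma passage_conjugacy:
  assumes h: "conjugacy f g h" and P: "passage f p a b l y"
  shows "passage g (h p) (h a) (h b) l (\<lambda>k. h (y k))"
  unfolding passage_def
proof (intro conjI allI impI)
  have cont: "continuous_on UNIV h" using h by (simp add: conjugacy_def homeomorphism_def)
  show "(\<lambda>k. h (y k)) \<longlonglongrightarrow> h a" "(\<lambda>k. (g ^^ l k) (h (y k))) \<longlonglongrightarrow> h b"
    using P cont unfolding passage_def conjugacy_funpow[OF h, symmetric] by (auto intro: continuous_UNIV_tendsto)
  fix \<Omega> assume \<Omega>: "open \<Omega> \<and> h p \<in> \<Omega>"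
  then have "open (h -` \<Omega>) \<and> p \<in> h -` \<Omega>" using cont by (auto simp: continuous_on_open_vimage)
  then obtain N where "\<forall>\<^sub>F k in sequentially. \<forall>i. N \<le> i \<and> i + N \<le> l k \<longrightarrow> (f ^^ i) (y k) \<in> h -` \<Omega>"
    using P unfolding passage_def by blast
  then show "\<exists>N. \<forall>\<^sub>F k in sequentially. \<forall>i. N \<le> i \<and> i + N \<le> l k \<longrightarrow> (g ^^ i) (h (y k)) \<in> \<Omega>"
    unfolding conjugacy_funpow[OF h, symmetric] by auto
qed

lemma passage_shift:
  assumes f: "bij f" "continuous_on UNIV f" "continuous_on UNIV (inv f)" and P: "passage f p a b l w"
  shows "passage f p ((inv f ^^ i) a) ((f ^^ j) b) (\<lambda>k. i + l k + j) (\<lambda>k. (inv f ^^ i) (w k))"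
  unfolding passage_def
proof (intro conjI allI impI)
  have eq: "(f ^^ (i + l k + j)) ((inv f ^^ i) (w k)) = (f ^^ j) ((f ^^ l k) (w k))" for k
  proof -
    have "i + l k + j = j + (l k + i)" by simp
    then show ?thesis by (simp only: funpow_add o_apply funpow_inv_funpow[OF f(1)])
  qed
  show "(\<lambda>k. (inv f ^^ i) (w k)) \<longlonglongrightarrow> (inv f ^^ i) a"
    using P continuous_UNIV_tendsto[OF continuous_on_funpow[OF f(3)]] by (simp add: passage_def)
  show "(\<lambda>k. (f ^^ (i + l k + j)) ((inv f ^^ i) (w k))) \<longlonglongrightarrow> (f ^^ j) b"
    unfolding eq using P continuous_UNIV_tendsto[OF continuous_on_funpow[OF f(2)]] by (simp add: passage_def)
  fix \<Omega> assume "open \<Omega> \<and> p \<in> \<Omega>"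
  then obtain N where N: "\<forall>\<^sub>F k in sequentially. \<forall>i. N \<le> i \<and> i + N \<le> l k \<longrightarrow> (f ^^ i) (w k) \<in> \<Omega>"
    using P unfolding passage_def by blast
  have "\<forall>\<^sub>F k in sequentially. \<forall>s. N + i + j \<le> s \<and> s + (N + i + j) \<le> i + l k + j \<longrightarrow> (f ^^ s) ((inv f ^^ i) (w k)) \<in> \<Omega>"
    using N
  proof eventually_elim
    case (elim k)
    show ?case
    proof (intro allI impI)
      fix s assume s: "N + i + j \<le> s \<and> s + (N + i + j) \<le> i + l k + j"
      have "(f ^^ s) ((inv f ^^ i) (w k)) = (f ^^ (s - i)) (w k)"
        using s funpow_add[of "s - i" i f] funpow_inv_funpow[OF f(1)] by simp
      moreover have "N \<le> s - i \<and> s - i + N \<le> l k" using s by linarith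
      ultimately show "(f ^^ s) ((inv f ^^ i) (w k)) \<in> \<Omega>" using elim by simp
    qed
  qed
  then show "\<exists>N. \<forall>\<^sub>F k in sequentially. \<forall>s. N \<le> s \<and> s + N \<le> i + l k + j \<longrightarrow> (f ^^ s) ((inv f ^^ i) (w k)) \<in> \<Omega>" by blast
qed

text \<open>
A chart \<open>P\<close> with inverse \<open>E\<close> in which \<open>f\<close> is \<open>(z, t) \<mapsto> (\<mu> z, lam t)\<close> on a product of balls of the
same radius. The last assumption concerns points that stay in the chart although \<open>\<mu> z\<close> is not
known to be small in advance.\<close>

locale saddle_chart =
  fixes f :: "'m::{t2_space, first_countable_topology} \<Rightarrow> 'm" and p :: 'm and \<mu> :: complex and lam \<delta> :: real
    and E :: "complex \<times> real \<Rightarrow> 'm" and P :: "'m \<Rightarrow> complex \<times> real"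
  assumes bij_f: "bij f" and cont_f: "continuous_on UNIV f" and cont_inv: "continuous_on UNIV (inv f)"
    and fp: "f p = p" and \<mu>: "norm \<mu> > 1" and lam: "0 < lam" "lam < 1" and \<delta>: "\<delta> > 0"
    and E0: "E (0, 0) = p"
    and PE: "norm z < \<delta> \<Longrightarrow> \<bar>t\<bar> < \<delta> \<Longrightarrow> P (E (z, t)) = (z, t)"
    and contE: "continuous_on (ball 0 \<delta> \<times> ball 0 \<delta>) E"
    and contP: "continuous_on (E ` (ball 0 \<delta> \<times> ball 0 \<delta>)) P"
    and openE: "open (E ` (ball 0 \<delta> \<times> ball 0 \<delta>))"
    and step: "norm z < \<delta> \<Longrightarrow> \<bar>t\<bar> < \<delta> \<Longrightarrow> norm (\<mu> * z) < \<delta> \<Longrightarrow> f (E (z, t)) = E (\<mu> * z, lam * t)"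
    and step_mem: "norm z < \<delta> \<Longrightarrow> \<bar>t\<bar> < \<delta> \<Longrightarrow> f (E (z, t)) \<in> E ` (ball 0 \<delta> \<times> ball 0 \<delta>) \<Longrightarrow> P (f (E (z, t))) = (\<mu> * z, lam * t)"
begin

definition V :: "'m set" where "V = E ` (ball 0 \<delta> \<times> ball 0 \<delta>)"

lemma V_iff: "x \<in> V \<longleftrightarrow> (\<exists>z t. norm z < \<delta> \<and> \<bar>t\<bar> < \<delta> \<and> x = E (z, t))"
  by (simp add: V_def image_iff Bex_def split_paired_Ex mem_Times_iff conj_assoc)

lemma V_E: "norm z < \<delta> \<Longrightarrow> \<bar>t\<bar> < \<delta> \<Longrightarrow> E (z, t) \<in> V"
  by (auto simp: V_iff)

lemma V_P: "x \<in> V \<Longrightarrow> norm (fst (P x)) < \<delta> \<and> \<bar>snd (P x)\<bar> < \<delta> \<and> E (P x) = x"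
  by (auto simp: V_iff PE)

lemma open_V: "open V" and p_V: "p \<in> V"
  using openE V_E[of 0 0] \<delta> by (simp_all add: V_def E0)

lemma P_tendsto: "x \<longlonglongrightarrow> a \<Longrightarrow> a \<in> V \<Longrightarrow> (\<lambda>k. P (x k)) \<longlonglongrightarrow> P a"
  using contP open_V unfolding V_def[symmetric]
  by (metis continuous_on_eq_continuous_at isCont_tendsto_compose)

lemma E_tendsto:
  assumes "z \<longlonglongrightarrow> z'" "t \<longlonglongrightarrow> t'" "norm z' < \<delta>" "\<bar>t'\<bar> < \<delta>"
  shows "(\<lambda>k. E (z k, t k)) \<longlonglongrightarrow> E (z', t')"
proof -
  have "isCont E (z', t')"
    using contE assms(3,4) by (subst (asm) continuous_on_eq_continuous_at) (auto intro: open_Times)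
  then show ?thesis using tendsto_Pair[OF assms(1,2)] by (rule isCont_tendsto_compose)
qed

lemma fixed_point_funpow: "(f ^^ n) p = p" "(inv f ^^ n) p = p"
proof -
  show "(f ^^ n) p = p" by (induction n) (simp_all add: fp)
  have "inv f p = p" using bij_f fp by (metis bij_is_inj inv_f_f)
  then show "(inv f ^^ n) p = p" by (induction n) simp_all
qed

lemma inv_funpow_double: "(inv f ^^ (n + n)) ((f ^^ n) x) = (inv f ^^ n) x"
  and funpow_double: "(f ^^ (n + n)) ((inv f ^^ n) x) = (f ^^ n) x"
  by (simp_all add: funpow_add inv_funpow_funpow[OF bij_f] funpow_inv_funpow[OF bij_f])

text \<open>
It suffices that the last point is still in the range of the chart: \<open>z\<close> grows and \<open>t\<close> shrinks
along the orbit.\<close>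

lemma funpow_E:
  "norm (\<mu> ^ n * z) < \<delta> \<Longrightarrow> \<bar>t\<bar> < \<delta> \<Longrightarrow> (f ^^ n) (E (z, t)) = E (\<mu> ^ n * z, lam ^ n * t)"
proof (induction n)
  case (Suc n)
  have "1 * norm (\<mu> ^ n * z) \<le> norm \<mu> * norm (\<mu> ^ n * z)" using \<mu> by (intro mult_right_mono) auto
  then have le: "norm (\<mu> ^ n * z) < \<delta>" using Suc.prems(1) by (simp add: norm_mult mult.assoc)
  have "\<bar>lam ^ n * t\<bar> \<le> \<bar>t\<bar>" using lam by (simp add: abs_mult mult_left_le_one_le power_le_one)
  then have "\<bar>lam ^ n * t\<bar> < \<delta>" using Suc.prems by linarith
  then have "f (E (\<mu> ^ n * z, lam ^ n * t)) = E (\<mu> * (\<mu> ^ n * z), lam * (lam ^ n * t))"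
    using Suc.prems(1) le by (intro step) (simp_all add: mult.assoc)
  then show ?case using Suc.IH[OF le Suc.prems(2)] by (simp add: mult.assoc)
qed simp

lemma orbit_in_V:
  assumes "\<And>i. i \<le> n \<Longrightarrow> (f ^^ i) x \<in> V"
  shows "P ((f ^^ n) x) = (\<mu> ^ n * fst (P x), lam ^ n * snd (P x))"
  using assms
proof (induction n)
  case (Suc n)
  let ?y = "(f ^^ n) x"
  have y: "?y \<in> V" "f ?y \<in> V" using Suc.prems[of n] Suc.prems[of "Suc n"] by simp_all
  have "P (f (E (fst (P ?y), snd (P ?y)))) = (\<mu> * fst (P ?y), lam * snd (P ?y))"
    using V_P[OF y(1)] y(2) by (intro step_mem) (auto simp: V_def)
  then show ?case using V_P[OF y(1)] Suc.IH Suc.prems by (simp add: mult.assoc)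
qed simp

lemma norm_over_power: "norm (z / \<mu> ^ n) \<le> norm z"
proof -
  have "1 \<le> norm \<mu> ^ n" using \<mu> by (intro one_le_power) simp
  then show ?thesis by (simp add: norm_divide norm_power divide_le_eq mult_le_cancel_left1)
qed

lemma \<mu>_nz: "\<mu> \<noteq> 0" using \<mu> by auto

lemma over_power_tendsto: "(\<lambda>n. z / \<mu> ^ n) \<longlonglongrightarrow> 0"
proof -
  have "(\<lambda>n. z * (1 / \<mu>) ^ n) \<longlonglongrightarrow> 0"
    using \<mu> by (intro tendsto_mult_right_zero LIMSEQ_power_zero) (simp add: norm_divide divide_less_eq)
  then show ?thesis by (simp add: power_one_over)
qed

lemma inv_funpow_E0: "norm z < \<delta> \<Longrightarrow> (inv f ^^ n) (E (z, 0)) = E (z / \<mu> ^ n, 0)"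
proof -
  assume z: "norm z < \<delta>"
  have "(f ^^ n) (E (z / \<mu> ^ n, 0)) = E (z, 0)"
    using funpow_E[of n "z / \<mu> ^ n" 0] z \<delta> \<mu>_nz by simp
  then show ?thesis using inv_funpow_funpow[OF bij_f] by metis
qed

lemma E0_unstable: "norm z < \<delta> \<Longrightarrow> E (z, 0) \<in> unstable_mfd f p"
  unfolding unstable_mfd_def stable_mfd_def
  using E_tendsto[OF over_power_tendsto tendsto_const[of 0], of z] \<delta> E0 by (simp add: inv_funpow_E0)

lemma unstable_funpow: "x \<in> unstable_mfd f p \<Longrightarrow> (f ^^ n) x \<in> unstable_mfd f p"
proof (induction n)
  case (Suc n)
  have "inv f (f ((f ^^ n) x)) \<in> stable_mfd (inv f) p"
    using Suc bij_f by (simp add: unstable_mfd_def bij_is_inj)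
  then show ?case unfolding unstable_mfd_def using stable_mfd_preimage by (metis comp_apply funpow.simps(2))
qed simp

text \<open>
Backward iteration expands \<open>t\<close>, so an orbit that never leaves the chart has \<open>t = 0\<close>.\<close>

lemma backward_orbit_in_V:
  assumes V: "\<And>n. (inv f ^^ n) x \<in> V"
  shows "x = E (fst (P x), 0) \<and> norm (fst (P x)) < \<delta>"
proof -
  have "\<bar>snd (P x)\<bar> \<le> lam ^ n * \<delta>" for n
  proof -
    have "P ((f ^^ n) ((inv f ^^ n) x)) = (\<mu> ^ n * fst (P ((inv f ^^ n) x)), lam ^ n * snd (P ((inv f ^^ n) x)))"
      using V funpow_inv_funpow_le[OF bij_f] by (intro orbit_in_V) simp
    then have "snd (P x) = lam ^ n * snd (P ((inv f ^^ n) x))" by (simp add: funpow_inv_funpow[OF bij_f])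
    moreover have "\<bar>snd (P ((inv f ^^ n) x))\<bar> \<le> \<delta>" using V_P[OF V[of n]] by simp
    ultimately show ?thesis using lam by (simp add: abs_mult)
  qed
  moreover have "(\<lambda>n. lam ^ n * \<delta>) \<longlonglongrightarrow> 0" using lam by (intro tendsto_mult_left_zero LIMSEQ_power_zero) simp
  ultimately have "\<bar>snd (P x)\<bar> \<le> 0" by (intro LIMSEQ_le_const) auto
  then show ?thesis using V_P[OF V[of 0]] by (metis abs_le_zero_iff funpow_0 prod.collapse)
qed

lemma forward_orbit_in_V:
  assumes V: "\<And>n. (f ^^ n) x \<in> V"
  shows "x = E (0, snd (P x)) \<and> \<bar>snd (P x)\<bar> < \<delta>"
proof -
  have "norm (fst (P x)) \<le> norm (\<delta> / \<mu> ^ n)" for n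
  proof -
    have "P ((f ^^ n) x) = (\<mu> ^ n * fst (P x), lam ^ n * snd (P x))" using V by (intro orbit_in_V)
    then have "norm (\<mu> ^ n * fst (P x)) < \<delta>" using V_P[OF V[of n]] by simp
    then show ?thesis using \<mu>_nz \<delta> by (simp add: norm_mult norm_divide field_simps)
  qed
  moreover have "(\<lambda>n. norm (\<delta> / \<mu> ^ n)) \<longlonglongrightarrow> norm (0 :: complex)" by (intro tendsto_norm over_power_tendsto)
  ultimately have "norm (fst (P x)) \<le> norm (0 :: complex)" by (intro LIMSEQ_le_const) auto
  then show ?thesis using V_P[OF V[of 0]] by (metis norm_le_zero_iff norm_zero funpow_0 prod.collapse)
qed

lemma unstable_eventually:
  assumes "x \<in> unstable_mfd f p"
  obtains N where "\<And>n. n \<ge> N \<Longrightarrow> (inv f ^^ n) x \<in> V"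
    "\<And>n. n \<ge> N \<Longrightarrow> \<exists>z. norm z < \<delta> \<and> (inv f ^^ n) x = E (z, 0)"
proof -
  have "(\<lambda>n. (inv f ^^ n) x) \<longlonglongrightarrow> p" using assms by (simp add: unstable_mfd_def stable_mfd_def)
  then have "\<forall>\<^sub>F n in sequentially. (inv f ^^ n) x \<in> V" using open_V p_V by (rule topological_tendstoD)
  then obtain N where N: "\<And>n. n \<ge> N \<Longrightarrow> (inv f ^^ n) x \<in> V" unfolding eventually_sequentially by blast
  have "\<exists>z. norm z < \<delta> \<and> (inv f ^^ n) x = E (z, 0)" if "n \<ge> N" for n
  proof -
    have "(inv f ^^ m) ((inv f ^^ n) x) \<in> V" for m using N[of "m + n"] that by (simp add: funpow_add)
    then show ?thesis using backward_orbit_in_V by blast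
  qed
  then show thesis using that N by blast
qed

lemma stable_eventually:
  assumes "x \<in> stable_mfd f p"
  obtains N where "\<And>n. n \<ge> N \<Longrightarrow> (f ^^ n) x \<in> V"
    "\<And>n. n \<ge> N \<Longrightarrow> \<exists>t. \<bar>t\<bar> < \<delta> \<and> (f ^^ n) x = E (0, t)"
proof -
  have "(\<lambda>n. (f ^^ n) x) \<longlonglongrightarrow> p" using assms by (simp add: stable_mfd_def)
  then have "\<forall>\<^sub>F n in sequentially. (f ^^ n) x \<in> V" using open_V p_V by (rule topological_tendstoD)
  then obtain N where N: "\<And>n. n \<ge> N \<Longrightarrow> (f ^^ n) x \<in> V" unfolding eventually_sequentially by blast
  have "\<exists>t. \<bar>t\<bar> < \<delta> \<and> (f ^^ n) x = E (0, t)" if "n \<ge> N" for n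
  proof -
    have "(f ^^ m) ((f ^^ n) x) \<in> V" for m using N[of "m + n"] that by (simp add: funpow_add)
    then show ?thesis using forward_orbit_in_V by blast
  qed
  then show thesis using that N by blast
qed

text \<open>
The linearizing coordinate of the unstable manifold, extended to all of it by equivariance: follow
the orbit backwards into the chart, and undo the contraction. The number of steps does not matter,
by \<open>ucoord_eq\<close> below.\<close>

definition ucoord :: "'m \<Rightarrow> complex" where
  "ucoord x = (let N = (SOME N. \<exists>z. norm z < \<delta> \<and> (inv f ^^ N) x = E (z, 0)) in \<mu> ^ N * fst (P ((inv f ^^ N) x)))"

lemma ucoord_eq:
  assumes z: "norm z < \<delta>" and x: "(inv f ^^ N) x = E (z, 0)"
  shows "ucoord x = \<mu> ^ N * z"
proof -
  define M where "M = (SOME N. \<exists>z. norm z < \<delta> \<and> (inv f ^^ N) x = E (z, 0))"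
  have "\<exists>z. norm z < \<delta> \<and> (inv f ^^ M) x = E (z, 0)" unfolding M_def by (rule someI_ex) (use assms in blast)
  then obtain w where w: "norm w < \<delta>" "(inv f ^^ M) x = E (w, 0)" by blast
  have u: "ucoord x = \<mu> ^ M * w" using PE[of w 0] w \<delta> by (simp add: ucoord_def M_def[symmetric])
  have aux: "\<mu> ^ M * w = \<mu> ^ N * z" if "M \<le> N" "norm w < \<delta>" "(inv f ^^ M) x = E (w, 0)"
    "norm z < \<delta>" "(inv f ^^ N) x = E (z, 0)" for M N w z
  proof -
    have "(inv f ^^ N) x = (inv f ^^ (N - M)) ((inv f ^^ M) x)"
      using funpow_add[of "N - M" M "inv f"] that(1) by simp
    also have "\<dots> = E (w / \<mu> ^ (N - M), 0)" using that by (simp add: inv_funpow_E0)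
    finally have eq: "E (z, 0) = E (w / \<mu> ^ (N - M), 0)" using that(5) by simp
    have small: "norm (w / \<mu> ^ (N - M)) < \<delta>" using norm_over_power[of w "N - M"] that(2) by linarith
    have "\<bar>0 :: real\<bar> < \<delta>" using \<delta> by simp
    from PE[OF that(4) this] PE[OF small this] have "z = w / \<mu> ^ (N - M)" unfolding eq by simp
    moreover have "\<mu> ^ N = \<mu> ^ M * \<mu> ^ (N - M)" using that(1) by (simp add: power_add[symmetric])
    ultimately show ?thesis using \<mu>_nz by simp
  qed
  show ?thesis
  proof (cases "M \<le> N")
    case True
    show ?thesis unfolding u by (rule aux[OF True w z x])
  next
    case False
    then have "N \<le> M" by simp
    from aux[OF this z x w] show ?thesis unfolding u by simp
  qed
qed

text \<open>
The inverse of \<open>ucoord\<close>. It is continuous, whereas \<open>ucoord\<close> need be continuous only in the intrinsic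
topology of the unstable manifold, which is merely injectively immersed.\<close>

definition upoint :: "complex \<Rightarrow> 'm" where
  "upoint z = (let N = (SOME N. norm (z / \<mu> ^ N) < \<delta>) in (f ^^ N) (E (z / \<mu> ^ N, 0)))"

lemma ex_small: "\<exists>N. norm (z / \<mu> ^ N) < \<delta>"
proof -
  have "\<forall>\<^sub>F n in sequentially. dist (z / \<mu> ^ n) 0 < \<delta>" using over_power_tendsto \<delta> by (rule tendstoD)
  then show ?thesis by (auto simp: eventually_sequentially)
qed

lemma upoint_eq:
  assumes "norm (z / \<mu> ^ N) < \<delta>" shows "upoint z = (f ^^ N) (E (z / \<mu> ^ N, 0))"
proof -
  define M where "M = (SOME N. norm (z / \<mu> ^ N) < \<delta>)"
  have M: "norm (z / \<mu> ^ M) < \<delta>" unfolding M_def by (rule someI_ex[OF ex_small])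
  have aux: "(f ^^ M) (E (z / \<mu> ^ M, 0)) = (f ^^ N) (E (z / \<mu> ^ N, 0))"
    if "M \<le> N" "norm (z / \<mu> ^ M) < \<delta>" for M N
  proof -
    have p: "\<mu> ^ N = \<mu> ^ (N - M) * \<mu> ^ M" using that(1) by (simp add: power_add[symmetric])
    have "(f ^^ (N - M)) (E (z / \<mu> ^ N, 0)) = E (\<mu> ^ (N - M) * (z / \<mu> ^ N), lam ^ (N - M) * 0)"
      using that \<delta> \<mu>_nz by (intro funpow_E) (simp_all add: p)
    also have "\<mu> ^ (N - M) * (z / \<mu> ^ N) = z / \<mu> ^ M" using \<mu>_nz by (simp add: p)
    finally have "(f ^^ M) ((f ^^ (N - M)) (E (z / \<mu> ^ N, 0))) = (f ^^ M) (E (z / \<mu> ^ M, 0))" by simp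
    then show ?thesis using funpow_add[of M "N - M" f] that(1) by simp
  qed
  have "upoint z = (f ^^ M) (E (z / \<mu> ^ M, 0))" by (simp add: upoint_def M_def Let_def)
  moreover have "(f ^^ M) (E (z / \<mu> ^ M, 0)) = (f ^^ N) (E (z / \<mu> ^ N, 0))"
  proof (cases "M \<le> N")
    case True
    then show ?thesis using M by (rule aux)
  next
    case False
    then have "N \<le> M" by simp
    from aux[OF this assms] show ?thesis by (rule sym)
  qed
  ultimately show ?thesis by (rule trans)
qed

lemma upoint_unstable: "upoint z \<in> unstable_mfd f p"
proof -
  obtain N where "norm (z / \<mu> ^ N) < \<delta>" using ex_small by blast
  then show ?thesis using upoint_eq E0_unstable unstable_funpow by simp
qed

lemma ucoord_upoint [simp]: "ucoord (upoint z) = z"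
proof -
  obtain N where N: "norm (z / \<mu> ^ N) < \<delta>" using ex_small by blast
  have "(inv f ^^ N) (upoint z) = E (z / \<mu> ^ N, 0)" using upoint_eq[OF N] inv_funpow_funpow[OF bij_f] by simp
  from ucoord_eq[OF N this] show ?thesis using \<mu>_nz by simp
qed

lemma upoint_ucoord: "x \<in> unstable_mfd f p \<Longrightarrow> upoint (ucoord x) = x"
proof -
  assume "x \<in> unstable_mfd f p"
  then obtain N z where N: "norm z < \<delta>" "(inv f ^^ N) x = E (z, 0)" using unstable_eventually by (metis order_refl)
  have z: "ucoord x / \<mu> ^ N = z" unfolding ucoord_eq[OF N] using \<mu>_nz by simp
  have "upoint (ucoord x) = (f ^^ N) (E (z, 0))" using upoint_eq[of "ucoord x" N] N(1) unfolding z .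
  then show ?thesis using N(2) funpow_inv_funpow[OF bij_f] by metis
qed

lemma f_upoint: "f (upoint z) = upoint (\<mu> * z)"
proof -
  obtain N where N: "norm (z / \<mu> ^ N) < \<delta>" using ex_small by blast
  then have "upoint (\<mu> * z) = (f ^^ Suc N) (E (z / \<mu> ^ N, 0))" using upoint_eq[of "\<mu> * z" "Suc N"] \<mu>_nz by simp
  then show ?thesis using upoint_eq[OF N] by simp
qed

lemma upoint_0: "upoint 0 = p"
  using upoint_eq[of 0 0] \<delta> E0 by simp

lemma ucoord_f: "x \<in> unstable_mfd f p \<Longrightarrow> ucoord (f x) = \<mu> * ucoord x"
  using f_upoint upoint_ucoord ucoord_upoint by metis

lemma continuous_upoint: "continuous_on UNIV upoint"
proof -
  have "isCont upoint z" for z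
  proof -
    obtain N where N: "norm (z / \<mu> ^ N) < \<delta>" using ex_small by blast
    define S where "S = {w. norm (w / \<mu> ^ N) < \<delta>}"
    have "open S" unfolding S_def using \<mu>_nz by (intro open_Collect_less continuous_intros) auto
    have "continuous_on S ((f ^^ N) \<circ> (E \<circ> (\<lambda>w. (w / \<mu> ^ N, 0))))"
      using \<mu>_nz \<delta> by (intro continuous_on_compose continuous_on_subset[OF contE]
          continuous_on_subset[OF continuous_on_funpow[OF cont_f]] continuous_intros) (auto simp: S_def)
    then have "continuous_on S upoint"
      by (rule continuous_on_eq) (simp add: S_def upoint_eq)
    then show ?thesis using \<open>open S\<close> N by (simp add: continuous_on_eq_continuous_at S_def)
  qed
  then show ?thesis by (simp add: continuous_on_eq_continuous_at)
qed

text \<open>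
Among the points whose backward orbits stay in the chart, \<open>ucoord\<close> is a restriction of the chart,
hence continuous.\<close>

lemma ucoord_eq_P: "(\<And>n. (inv f ^^ n) x \<in> V) \<Longrightarrow> ucoord x = fst (P x)"
  using ucoord_eq[of "fst (P x)" 0 x] backward_orbit_in_V by simp

end

text \<open>
Choosing for each \<open>k\<close> a solution that is almost as close to \<open>t0\<close> as possible yields a convergent
choice.\<close>

lemma tendsto_select:
  fixes t0 :: real
  assumes ex: "\<And>e. e > 0 \<Longrightarrow> \<forall>\<^sub>F k in sequentially. \<exists>t. \<bar>t - t0\<bar> \<le> e \<and> Q k t"
  shows "\<exists>t. t \<longlonglongrightarrow> t0 \<and> (\<forall>\<^sub>F k in sequentially. Q k (t k))"
proof -
  define d where "d k = Inf ((\<lambda>t. \<bar>t - t0\<bar>) ` {t. Q k t})" for k :: nat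
  define t where "t k = (SOME t. Q k t \<and> \<bar>t - t0\<bar> < d k + inverse (real (Suc k)))" for k
  have bdd: "bdd_below ((\<lambda>t. \<bar>t - t0\<bar>) ` {t. Q k t})" for k by (rule bdd_belowI[of _ 0]) auto
  have t: "Q k (t k) \<and> \<bar>t k - t0\<bar> < d k + inverse (real (Suc k))" if "\<exists>t. Q k t" for k
  proof -
    have "d k < d k + inverse (real (Suc k))" by simp
    then have "\<exists>t. Q k t \<and> \<bar>t - t0\<bar> < d k + inverse (real (Suc k))"
      using that cInf_less_iff[OF _ bdd[of k], of "d k + inverse (real (Suc k))"] unfolding d_def by auto
    then show ?thesis unfolding t_def by (rule someI_ex)
  qed
  have "\<forall>\<^sub>F k in sequentially. \<exists>t. \<bar>t - t0\<bar> \<le> 1 \<and> Q k t" by (rule ex) simp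
  then have 1: "\<forall>\<^sub>F k in sequentially. Q k (t k)" by eventually_elim (use t in blast)
  have "t \<longlonglongrightarrow> t0"
  proof (rule tendstoI)
    fix e :: real assume e: "e > 0"
    have "\<forall>\<^sub>F k in sequentially. \<exists>t. \<bar>t - t0\<bar> \<le> e / 2 \<and> Q k t" using e by (intro ex) simp
    moreover have "\<forall>\<^sub>F k in sequentially. inverse (real (Suc k)) < e / 2"
      using e by (intro order_tendstoD(2)[OF LIMSEQ_inverse_real_of_nat]) simp
    ultimately show "\<forall>\<^sub>F k in sequentially. dist (t k) t0 < e"
    proof eventually_elim
      case (elim k)
      then obtain s where s: "\<bar>s - t0\<bar> \<le> e / 2" "Q k s" by blast
      have "d k \<le> \<bar>s - t0\<bar>" unfolding d_def by (rule cInf_lower) (use s bdd in auto)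
      moreover have "\<bar>t k - t0\<bar> < d k + inverse (real (Suc k))" using t[of k] s by blast
      ultimately show ?case using elim(2) s(1) unfolding dist_real_def by linarith
    qed
  qed
  then show ?thesis using 1 by blast
qed

context saddle_chart
begin

text \<open>
The orbit stays in the chart in the middle part of the passage by definition, and in the remaining
finitely many positions after \<open>M\<close> and before \<open>M'\<close> by convergence to the orbits of \<open>a\<close> and \<open>b\<close>. So the
linear normal form holds for the whole segment between these positions.\<close>

lemma passage_coords:
  assumes pass: "passage f p a b l y" and l: "filterlim l at_top sequentially"
    and a: "\<forall>i\<ge>M. (f ^^ i) a \<in> V" and aE: "(f ^^ M) a = E (0, ta)" "\<bar>ta\<bar> < \<delta>"
    and b: "\<forall>i\<ge>M'. (inv f ^^ i) b \<in> V" and bE: "(inv f ^^ M') b = E (zb, 0)" "norm zb < \<delta>"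
  defines "\<zeta> \<equiv> \<lambda>k. fst (P ((f ^^ M) (y k)))" and "t \<equiv> \<lambda>k. snd (P ((f ^^ M) (y k)))"
  shows "\<forall>\<^sub>F k in sequentially. M + M' \<le> l k \<and> norm (\<zeta> k) < \<delta> \<and> \<bar>t k\<bar> < \<delta> \<and> (f ^^ M) (y k) = E (\<zeta> k, t k) \<and>
      P ((f ^^ (l k - M')) (y k)) = (\<mu> ^ (l k - M - M') * \<zeta> k, lam ^ (l k - M - M') * t k)"
    and "\<zeta> \<longlonglongrightarrow> 0" and "t \<longlonglongrightarrow> ta" and "(\<lambda>k. \<mu> ^ (l k - M - M') * \<zeta> k) \<longlonglongrightarrow> zb"
proof -
  have lims: "y \<longlonglongrightarrow> a" "(\<lambda>k. (f ^^ l k) (y k)) \<longlonglongrightarrow> b" using pass by (simp_all add: passage_def)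
  obtain N where N: "\<forall>\<^sub>F k in sequentially. \<forall>i. N \<le> i \<and> i + N \<le> l k \<longrightarrow> (f ^^ i) (y k) \<in> V"
    using pass open_V p_V unfolding passage_def by blast
  define K where "K = N + M + M'"
  have start: "\<forall>\<^sub>F k in sequentially. \<forall>i\<in>{M..K}. (f ^^ i) (y k) \<in> V"
  proof (intro eventually_ball_finite ballI)
    fix i assume "i \<in> {M..K}"
    then have "(f ^^ i) a \<in> V" using a by simp
    moreover have "(\<lambda>k. (f ^^ i) (y k)) \<longlonglongrightarrow> (f ^^ i) a"
      by (rule continuous_UNIV_tendsto[OF continuous_on_funpow[OF cont_f] lims(1)])
    ultimately show "\<forall>\<^sub>F k in sequentially. (f ^^ i) (y k) \<in> V" using open_V by (intro topological_tendstoD)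
  qed simp
  have "\<forall>\<^sub>F k in sequentially. \<forall>i\<in>{M'..K}. (inv f ^^ i) ((f ^^ l k) (y k)) \<in> V"
  proof (intro eventually_ball_finite ballI)
    fix i assume "i \<in> {M'..K}"
    then have "(inv f ^^ i) b \<in> V" using b by simp
    moreover have "(\<lambda>k. (inv f ^^ i) ((f ^^ l k) (y k))) \<longlonglongrightarrow> (inv f ^^ i) b"
      by (rule continuous_UNIV_tendsto[OF continuous_on_funpow[OF cont_inv] lims(2)])
    ultimately show "\<forall>\<^sub>F k in sequentially. (inv f ^^ i) ((f ^^ l k) (y k)) \<in> V" using open_V by (intro topological_tendstoD)
  qed simp
  moreover have large: "\<forall>\<^sub>F k in sequentially. 2 * K \<le> l k" using l by (simp add: filterlim_at_top)
  ultimately have orbit: "\<forall>\<^sub>F k in sequentially. 2 * K \<le> l k \<and> (\<forall>i. M \<le> i \<and> i + M' \<le> l k \<longrightarrow> (f ^^ i) (y k) \<in> V)"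
    using start N
  proof eventually_elim
    case (elim k)
    have "(f ^^ i) (y k) \<in> V" if i: "M \<le> i" "i + M' \<le> l k" for i
    proof (cases "i \<le> K")
      case True then show ?thesis using elim(3) i by simp
    next
      case False
      show ?thesis
      proof (cases "i + K \<le> l k")
        case True
        then have "N \<le> i \<and> i + N \<le> l k" using False by (simp add: K_def)
        then show ?thesis using elim(4) by blast
      next
        case f: False
        have "l k - i \<in> {M'..K}" using i f by auto
        then have "(inv f ^^ (l k - i)) ((f ^^ l k) (y k)) \<in> V" using elim(1) by blast
        moreover have "(inv f ^^ (l k - i)) ((f ^^ l k) (y k)) = (f ^^ i) (y k)"
          using inv_funpow_funpow_le[OF bij_f, of "l k - i" "l k" "y k"] i by simp
        ultimately show ?thesis by simp
      qed
    qed
    then show ?case using elim(2) by blast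
  qed
  show ev: "\<forall>\<^sub>F k in sequentially. M + M' \<le> l k \<and> norm (\<zeta> k) < \<delta> \<and> \<bar>t k\<bar> < \<delta> \<and> (f ^^ M) (y k) = E (\<zeta> k, t k) \<and>
      P ((f ^^ (l k - M')) (y k)) = (\<mu> ^ (l k - M - M') * \<zeta> k, lam ^ (l k - M - M') * t k)"
    using orbit
  proof eventually_elim
    case (elim k)
    have ll: "M + M' \<le> l k" using elim by (simp add: K_def)
    have it: "(f ^^ i) ((f ^^ M) (y k)) = (f ^^ (i + M)) (y k)" for i by (simp add: funpow_add)
    have "P ((f ^^ (l k - M - M')) ((f ^^ M) (y k))) = (\<mu> ^ (l k - M - M') * fst (P ((f ^^ M) (y k))), lam ^ (l k - M - M') * snd (P ((f ^^ M) (y k))))"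
      by (rule orbit_in_V, unfold it) (use elim ll in auto)
    moreover have "l k - M - M' + M = l k - M'" using ll by simp
    moreover have "(f ^^ M) (y k) \<in> V" using elim ll by simp
    ultimately show ?case using V_P[of "(f ^^ M) (y k)"] ll unfolding it by (simp add: \<zeta>_def t_def)
  qed
  have "E (0, ta) \<in> V" "E (zb, 0) \<in> V" using V_E aE bE \<delta> by simp_all
  have "(\<lambda>k. (f ^^ M) (y k)) \<longlonglongrightarrow> E (0, ta)"
    unfolding aE(1)[symmetric] by (rule continuous_UNIV_tendsto[OF continuous_on_funpow[OF cont_f] lims(1)])
  from P_tendsto[OF this \<open>E (0, ta) \<in> V\<close>] have lim: "(\<lambda>k. P ((f ^^ M) (y k))) \<longlonglongrightarrow> (0, ta)"
    using PE[of 0 ta] aE(2) \<delta> by simp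
  show "\<zeta> \<longlonglongrightarrow> 0" "t \<longlonglongrightarrow> ta" using tendsto_fst[OF lim] tendsto_snd[OF lim] by (simp_all add: \<zeta>_def t_def)
  have "(\<lambda>k. (inv f ^^ M') ((f ^^ l k) (y k))) \<longlonglongrightarrow> E (zb, 0)"
    unfolding bE(1)[symmetric] by (rule continuous_UNIV_tendsto[OF continuous_on_funpow[OF cont_inv] lims(2)])
  from P_tendsto[OF this \<open>E (zb, 0) \<in> V\<close>]
  have "(\<lambda>k. P ((inv f ^^ M') ((f ^^ l k) (y k)))) \<longlonglongrightarrow> (zb, 0)"
    using PE[of zb 0] bE(2) \<delta> by simp
  then have lim': "(\<lambda>k. fst (P ((inv f ^^ M') ((f ^^ l k) (y k))))) \<longlonglongrightarrow> zb" by (auto dest: tendsto_fst)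
  show "(\<lambda>k. \<mu> ^ (l k - M - M') * \<zeta> k) \<longlonglongrightarrow> zb"
  proof (rule Lim_transform_eventually[OF lim'])
    show "\<forall>\<^sub>F k in sequentially. fst (P ((inv f ^^ M') ((f ^^ l k) (y k)))) = \<mu> ^ (l k - M - M') * \<zeta> k"
      using ev
    proof eventually_elim
      case (elim k)
      have "(inv f ^^ M') ((f ^^ l k) (y k)) = (f ^^ (l k - M')) (y k)"
        using elim by (intro inv_funpow_funpow_le bij_f) simp
      then show ?case using elim by simp
    qed
  qed
qed

text \<open>
Conversely, a segment in the chart whose endpoints converge to the stable and the unstable axis is a
passage: \<open>i\<close> steps after its start \<open>t\<close> is of size \<open>lam\<^sup>i\<close>, and \<open>i\<close> steps before its end \<open>z\<close> is of size
\<open>|\<mu>|\<^sup>-\<^sup>i\<close>.\<close>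

lemma passage_construct:
  assumes ta: "\<bar>ta\<bar> < \<delta>" and zb: "norm zb < \<delta>"
    and \<zeta>: "\<zeta> \<longlonglongrightarrow> 0" and t: "t \<longlonglongrightarrow> ta" and j: "filterlim j at_top sequentially"
    and out: "(\<lambda>k. \<mu> ^ j k * \<zeta> k) \<longlonglongrightarrow> zb"
  shows "passage f p (E (0, ta)) (E (zb, 0)) j (\<lambda>k. E (\<zeta> k, t k))"
proof -
  have small: "\<forall>\<^sub>F k in sequentially. norm (\<mu> ^ j k * \<zeta> k) < \<delta> \<and> \<bar>t k\<bar> < \<delta>"
    using order_tendstoD(2)[OF tendsto_norm[OF out] zb] order_tendstoD(2)[OF tendsto_rabs[OF t] ta] by (rule eventually_conj)
  have pow: "norm (\<mu> ^ i * \<zeta> k) \<le> norm (\<mu> ^ j k * \<zeta> k) / norm \<mu> ^ (j k - i)" if "i \<le> j k" for i k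
  proof -
    have "\<mu> ^ j k = \<mu> ^ (j k - i) * \<mu> ^ i" using that by (simp add: power_add[symmetric])
    then show ?thesis using \<mu>_nz by (simp add: norm_mult norm_power)
  qed
  have ge1: "1 \<le> norm \<mu> ^ n" for n using \<mu> by (intro one_le_power) simp
  have iter: "(f ^^ i) (E (\<zeta> k, t k)) = E (\<mu> ^ i * \<zeta> k, lam ^ i * t k)"
    if "norm (\<mu> ^ j k * \<zeta> k) < \<delta> \<and> \<bar>t k\<bar> < \<delta>" "i \<le> j k" for i k
  proof -
    have "norm (\<mu> ^ j k * \<zeta> k) / norm \<mu> ^ (j k - i) \<le> norm (\<mu> ^ j k * \<zeta> k) / 1"
      using ge1 by (intro divide_left_mono) (auto intro: less_le_trans[OF zero_less_one])
    then show ?thesis using that pow[of i k] by (intro funpow_E) auto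
  qed
  show ?thesis
    unfolding passage_def
  proof (intro conjI allI impI)
    show "(\<lambda>k. E (\<zeta> k, t k)) \<longlonglongrightarrow> E (0, ta)" using E_tendsto[OF \<zeta> t] ta \<delta> by simp
    have "(\<lambda>k. lam ^ j k * t k) \<longlonglongrightarrow> 0 * ta"
      using lam by (intro tendsto_mult t filterlim_compose[OF _ j] LIMSEQ_power_zero) simp
    then have "(\<lambda>k. E (\<mu> ^ j k * \<zeta> k, lam ^ j k * t k)) \<longlonglongrightarrow> E (zb, 0)"
      using E_tendsto[OF out] zb \<delta> by simp
    then show "(\<lambda>k. (f ^^ j k) (E (\<zeta> k, t k))) \<longlonglongrightarrow> E (zb, 0)"
    proof (rule Lim_transform_eventually)
      show "\<forall>\<^sub>F k in sequentially. E (\<mu> ^ j k * \<zeta> k, lam ^ j k * t k) = (f ^^ j k) (E (\<zeta> k, t k))"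
        using small by eventually_elim (rule iter[symmetric], auto)
    qed
    fix \<Omega> assume \<Omega>: "open \<Omega> \<and> p \<in> \<Omega>"
    have "isCont E (0, 0)"
      using contE \<delta> by (subst (asm) continuous_on_eq_continuous_at) (auto intro: open_Times)
    then have "(E \<longlongrightarrow> p) (nhds (0, 0))" using E0 by (metis isCont_def tendsto_at_iff_tendsto_nhds)
    then have "\<forall>\<^sub>F x in nhds (0, 0). E x \<in> \<Omega>" using \<Omega> by (intro topological_tendstoD) auto
    then obtain \<eta> where \<eta>: "\<eta> > 0" "\<And>x. dist x (0, 0) < \<eta> \<Longrightarrow> E x \<in> \<Omega>" unfolding eventually_nhds_metric by blast
    have "(\<lambda>n. \<delta> * (1 / norm \<mu>) ^ n) \<longlonglongrightarrow> 0" using \<mu> by (intro tendsto_mult_right_zero LIMSEQ_power_zero) (simp add: divide_less_eq)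
    moreover have "(\<lambda>n. \<delta> * lam ^ n) \<longlonglongrightarrow> 0" using lam by (intro tendsto_mult_right_zero LIMSEQ_power_zero) simp
    ultimately have "\<forall>\<^sub>F n in sequentially. \<delta> * (1 / norm \<mu>) ^ n < \<eta> / 2 \<and> \<delta> * lam ^ n < \<eta> / 2"
      using half_gt_zero[OF \<eta>(1)] by (intro eventually_conj) (blast dest: order_tendstoD(2))+
    then obtain N where N: "\<And>n. n \<ge> N \<Longrightarrow> \<delta> * (1 / norm \<mu>) ^ n < \<eta> / 2 \<and> \<delta> * lam ^ n < \<eta> / 2"
      unfolding eventually_sequentially by blast
    have "\<forall>\<^sub>F k in sequentially. \<forall>i. N \<le> i \<and> i + N \<le> j k \<longrightarrow> (f ^^ i) (E (\<zeta> k, t k)) \<in> \<Omega>"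
      using small
    proof eventually_elim
      case (elim k)
      show ?case
      proof (intro allI impI)
        fix i assume i: "N \<le> i \<and> i + N \<le> j k"
        have "norm (\<mu> ^ i * \<zeta> k) \<le> norm (\<mu> ^ j k * \<zeta> k) / norm \<mu> ^ (j k - i)" using i by (intro pow) simp
        also have "\<dots> \<le> \<delta> / norm \<mu> ^ (j k - i)" using elim by (intro divide_right_mono) auto
        also have "\<dots> = \<delta> * (1 / norm \<mu>) ^ (j k - i)" by (simp add: power_one_over)
        also have "\<dots> < \<eta> / 2"
        proof -
          have "N \<le> j k - i" using i by linarith
          then show ?thesis using N by blast
        qed
        finally have 1: "norm (\<mu> ^ i * \<zeta> k) < \<eta> / 2" .
        have "\<bar>lam ^ i * t k\<bar> \<le> lam ^ i * \<delta>" using elim lam by (simp add: abs_mult)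
        then have 2: "norm (lam ^ i * t k) < \<eta> / 2" using N[of i] i by (simp add: mult.commute)
        have "norm (\<mu> ^ i * \<zeta> k, lam ^ i * t k) < \<eta>"
          using norm_Pair_le[of "\<mu> ^ i * \<zeta> k" "lam ^ i * t k"] 1 2 by linarith
        then have "E (\<mu> ^ i * \<zeta> k, lam ^ i * t k) \<in> \<Omega>" by (intro \<eta>(2)) (simp add: dist_norm)
        then show "(f ^^ i) (E (\<zeta> k, t k)) \<in> \<Omega>" using iter[OF elim, of i] i by simp
      qed
    qed
    then show "\<exists>N. \<forall>\<^sub>F k in sequentially. \<forall>i. N \<le> i \<and> i + N \<le> j k \<longrightarrow> (f ^^ i) (E (\<zeta> k, t k)) \<in> \<Omega>" by blast
  qed
qed

end

text \<open>
The points that can be reached near a homoclinic point by two successive passages of prescribed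
lengths.\<close>

definition reach :: "('m::topological_space \<Rightarrow> 'm) \<Rightarrow> 'm \<Rightarrow> 'm \<Rightarrow> (nat \<Rightarrow> nat) \<Rightarrow> (nat \<Rightarrow> nat) \<Rightarrow> 'm \<Rightarrow> bool" where
  "reach f p q n m x \<longleftrightarrow>
     (\<exists>y. passage f p q q n y \<and> passage f p q x m (\<lambda>k. (f ^^ n k) (y k)))"

lemma reach_conjugacy:
  assumes h: "conjugacy f g h" and R: "reach f p q n m x"
  shows "reach g (h p) (h q) n m (h x)"
proof -
  obtain y where y: "passage f p q q n y" "passage f p q x m (\<lambda>k. (f ^^ n k) (y k))"
    using R unfolding reach_def by blast
  have "passage g (h p) (h q) (h x) m (\<lambda>k. (g ^^ n k) (h (y k)))"
    using passage_conjugacy[OF h y(2)] unfolding conjugacy_funpow[OF h] .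
  then show ?thesis using passage_conjugacy[OF h y(1)] unfolding reach_def by (intro exI[of _ "\<lambda>k. h (y k)"]) simp
qed

section \<open>The half-planes reached through a tangency\<close>

text \<open>
A homoclinic point \<open>q\<close> seen in a linearizing chart: after \<open>N\<close> steps it is on the stable axis at height
\<open>ts\<close>, and \<open>N\<close> steps earlier it was on the unstable axis at \<open>zq\<close>. For a point near \<open>(0, ts)\<close>,
\<open>\<Phi>\<close> is the coordinate \<open>t\<close> that it had \<open>N + N\<close> steps before; its zero set is the sheet of the unstable
manifold through \<open>(0, ts)\<close>. The last assumption is what remains of the
quadratic tangency of this sheet with the stable axis.\<close>

locale tangency_chart = saddle_chart f p \<mu> lam \<delta> E P
  for f :: "'m::{t2_space, first_countable_topology} \<Rightarrow> 'm" and p \<mu> lam \<delta> E P +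
  fixes q :: 'm and N :: nat and ts :: real and zq :: complex and D :: "complex \<times> real \<Rightarrow> real" and \<sigma> \<epsilon> :: real
    and \<Phi> :: "complex \<times> real \<Rightarrow> real"
  assumes fwd: "\<forall>i\<ge>N. (f ^^ i) q \<in> V" and fwdE: "(f ^^ N) q = E (0, ts)" and ts: "\<bar>ts\<bar> < \<delta>" "ts \<noteq> 0"
    and bwd: "\<forall>i\<ge>N. (inv f ^^ i) q \<in> V" and bwdE: "(inv f ^^ N) q = E (zq, 0)" and zq: "norm zq < \<delta>"
    and \<Phi>_def: "\<Phi> = (\<lambda>x. snd (P ((inv f ^^ (N + N)) (E x))))"
    and strict: "strict_deriv \<Phi> D (0, ts)" and D_nz: "\<exists>x. D x \<noteq> 0"
    and \<sigma>: "\<sigma> \<noteq> 0" and \<epsilon>: "\<epsilon> > 0"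
    and one_sided: "\<And>t. 0 < \<bar>t - ts\<bar> \<Longrightarrow> \<bar>t - ts\<bar> < \<epsilon> \<Longrightarrow> \<sigma> * \<Phi> (0, t) > 0"
begin

lemma \<Phi>_0: "\<Phi> (0, ts) = 0"
  using PE[of zq 0] zq \<delta> by (simp add: \<Phi>_def fwdE[symmetric] inv_funpow_double bwdE)

lemma \<Phi>_sign: "\<bar>t - ts\<bar> < \<epsilon> \<Longrightarrow> \<sigma> * \<Phi> (0, t) \<ge> 0"
  using one_sided[of t] \<Phi>_0 by (cases "t = ts") auto

text \<open>
On the stable axis \<open>\<sigma> * \<Phi>\<close> has a minimum at \<open>ts\<close>, so the derivative vanishes in that direction; being
nonzero, it is nonzero on the unstable plane.\<close>

lemma D_form: obtains A where "A \<noteq> 0" "\<And>z t. D (z, t) = Re (A * z)"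
proof -
  have bl: "bounded_linear D" using strict by (simp add: strict_deriv_def)
  then have lin: "linear D" by (rule bounded_linear.linear)
  have "((\<lambda>t. (0 :: complex, t :: real)) has_derivative (\<lambda>h. (0, h))) (at ts)"
    by (auto intro!: derivative_eq_intros)
  then have "(\<Phi> \<circ> (\<lambda>t. (0, t)) has_derivative D \<circ> (\<lambda>h. (0, h))) (at ts)"
    by (rule diff_chain_at) (rule strict_deriv_has_derivative[OF strict])
  moreover have "D \<circ> (\<lambda>h. (0, h)) = (*) (D (0, 1))"
  proof
    fix h :: real
    have "(0 :: complex, h) = h *\<^sub>R (0, 1)" by simp
    then have "D (0, h) = h *\<^sub>R D (0, 1)" using linear_cmul[OF lin, of h "(0, 1)"] by simp
    then show "(D \<circ> (\<lambda>h. (0, h))) h = D (0, 1) * h" by (simp add: mult.commute)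
  qed
  ultimately have "((\<lambda>t. \<Phi> (0, t)) has_real_derivative D (0, 1)) (at ts)"
    by (simp add: has_field_derivative_def o_def)
  then have "((\<lambda>t. \<sigma> * \<Phi> (0, t)) has_real_derivative \<sigma> * D (0, 1)) (at ts)" by (rule DERIV_cmult)
  then have "\<sigma> * D (0, 1) = 0"
    by (rule DERIV_local_min[OF _ \<epsilon>]) (use \<Phi>_sign \<Phi>_0 in \<open>simp add: abs_minus_commute\<close>)
  then have D1: "D (0, 1) = 0" using \<sigma> by simp
  define A where "A = Complex (D (1, 0)) (- D (\<i>, 0))"
  have form: "D (z, t) = Re (A * z)" for z t
  proof -
    have "(z, t) = Re z *\<^sub>R (1, 0) + Im z *\<^sub>R (\<i>, 0) + t *\<^sub>R (0, 1)" by (simp add: complex_eq_iff)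
    then have "D (z, t) = Re z * D (1, 0) + Im z * D (\<i>, 0) + t * D (0, 1)"
      by (simp only: linear_add[OF lin] linear_cmul[OF lin] real_scaleR_def)
    then show ?thesis by (simp add: D1 A_def)
  qed
  then have "A \<noteq> 0" using D_nz by force
  then show thesis using form that by blast
qed

text \<open>
Multiplication by \<open>|\<mu>|\<^sup>m\<close> is multiplication by \<open>\<mu>\<^sup>m\<close> followed by the rotation by the conjugate of
\<open>(sgn \<mu>)\<^sup>m\<close>, which converges.\<close>

lemma scaled_limit:
  assumes m: "filterlim m at_top sequentially" and u: "(\<lambda>k. sgn \<mu> ^ m k) \<longlonglongrightarrow> u"
    and w: "(\<lambda>k. \<mu> ^ (m k - a) * \<zeta> k) \<longlonglongrightarrow> w"
  shows "(\<lambda>k. of_real (norm \<mu> ^ m k) * \<zeta> k) \<longlonglongrightarrow> cnj u * (\<mu> ^ a * w)"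
proof -
  have "(\<lambda>k. cnj (sgn \<mu> ^ m k) * (\<mu> ^ a * (\<mu> ^ (m k - a) * \<zeta> k))) \<longlonglongrightarrow> cnj u * (\<mu> ^ a * w)"
    by (intro tendsto_mult tendsto_const tendsto_cnj u w)
  then show ?thesis
  proof (rule Lim_transform_eventually)
    have "\<forall>\<^sub>F k in sequentially. a \<le> m k" using m by (simp add: filterlim_at_top)
    then show "\<forall>\<^sub>F k in sequentially. cnj (sgn \<mu> ^ m k) * (\<mu> ^ a * (\<mu> ^ (m k - a) * \<zeta> k)) = of_real (norm \<mu> ^ m k) * \<zeta> k"
    proof eventually_elim
      case (elim k)
      have 1: "\<mu> ^ a * (\<mu> ^ (m k - a) * \<zeta> k) = \<mu> ^ m k * \<zeta> k" using elim by (simp add: mult.assoc[symmetric] power_add[symmetric])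
      have "cnj (sgn \<mu>) * \<mu> = of_real (norm \<mu>)" using \<mu>_nz by (rule cnj_sgn_mult)
      then have "cnj (sgn \<mu> ^ m k) * \<mu> ^ m k = of_real (norm \<mu> ^ m k)" by (simp add: power_mult_distrib[symmetric])
      then show ?case unfolding 1 by (simp add: mult.assoc[symmetric])
    qed
  qed
qed

text \<open>
Strict differentiability is applied to the two points \<open>(\<zeta>, t)\<close> and \<open>(0, t)\<close>, which both vary.\<close>

lemma linearization_error:
  assumes form: "\<And>z t. D (z, t) = Re (A * z)"
    and \<zeta>: "\<zeta> \<longlonglongrightarrow> 0" and t: "t \<longlonglongrightarrow> ts"
    and W: "(\<lambda>k. complex_of_real (c k) * \<zeta> k) \<longlonglongrightarrow> W"
  shows "(\<lambda>k. c k * (\<Phi> (\<zeta> k, t k) - \<Phi> (0, t k) - Re (A * \<zeta> k))) \<longlonglongrightarrow> 0"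
proof (rule tendstoI)
  fix e :: real assume e: "e > 0"
  define e' where "e' = e / (norm W + 1)"
  have e': "e' > 0" using e by (simp add: e'_def add_nonneg_pos)
  with strict obtain d where d: "d > 0"
    "\<And>y z. dist y (0, ts) < d \<Longrightarrow> dist z (0, ts) < d \<Longrightarrow> norm (\<Phi> y - \<Phi> z - D (y - z)) \<le> e' * norm (y - z)"
    by (rule strict_derivD) blast
  have "\<forall>\<^sub>F k in sequentially. dist (\<zeta> k, t k) (0, ts) < d"
    using tendsto_Pair[OF \<zeta> t] d(1) by (rule tendstoD)
  moreover have "\<forall>\<^sub>F k in sequentially. dist (0 :: complex, t k) (0, ts) < d"
    using tendsto_Pair[OF tendsto_const t] d(1) by (rule tendstoD)
  moreover have "\<forall>\<^sub>F k in sequentially. norm (complex_of_real (c k) * \<zeta> k) < norm W + 1"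
    by (rule order_tendstoD(2)[OF tendsto_norm[OF W]]) simp
  ultimately show "\<forall>\<^sub>F k in sequentially. dist (c k * (\<Phi> (\<zeta> k, t k) - \<Phi> (0, t k) - Re (A * \<zeta> k))) 0 < e"
  proof eventually_elim
    case (elim k)
    have "norm (\<Phi> (\<zeta> k, t k) - \<Phi> (0, t k) - Re (A * \<zeta> k)) \<le> e' * norm (\<zeta> k)"
      using d(2)[OF elim(1,2)] form[of "\<zeta> k" 0] by (simp add: norm_Pair)
    then have "\<bar>c k\<bar> * \<bar>\<Phi> (\<zeta> k, t k) - \<Phi> (0, t k) - Re (A * \<zeta> k)\<bar> \<le> \<bar>c k\<bar> * (e' * norm (\<zeta> k))"
      by (intro mult_left_mono) auto
    also have "\<dots> = e' * norm (complex_of_real (c k) * \<zeta> k)" by (simp add: norm_mult)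
    also have "\<dots> < e' * (norm W + 1)" using elim(3) e' by (intro mult_strict_left_mono)
    also have "\<dots> = e" unfolding e'_def using add_nonneg_pos[OF norm_ge_zero zero_less_one, of W] by simp
    finally show ?case by (simp add: abs_mult)
  qed
qed

lemma height_limit:
  assumes n: "filterlim n at_top sequentially" and \<rho>: "(\<lambda>k. norm \<mu> ^ m k * lam ^ n k) \<longlonglongrightarrow> \<rho>" and t: "t \<longlonglongrightarrow> ts"
  shows "(\<lambda>k. norm \<mu> ^ m k * (lam ^ (n k - N - N) * t k)) \<longlonglongrightarrow> \<rho> / lam ^ (N + N) * ts"
proof -
  have "(\<lambda>k. norm \<mu> ^ m k * lam ^ n k / lam ^ (N + N) * t k) \<longlonglongrightarrow> \<rho> / lam ^ (N + N) * ts"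
    using lam by (intro tendsto_intros \<rho> t) simp
  then show ?thesis
  proof (rule Lim_transform_eventually)
    have "\<forall>\<^sub>F k in sequentially. N + N \<le> n k" using n by (simp add: filterlim_at_top)
    then show "\<forall>\<^sub>F k in sequentially. norm \<mu> ^ m k * lam ^ n k / lam ^ (N + N) * t k = norm \<mu> ^ m k * (lam ^ (n k - N - N) * t k)"
    proof eventually_elim
      case (elim k)
      have "lam ^ n k = lam ^ (n k - N - N) * lam ^ (N + N)" using elim by (simp add: power_add[symmetric])
      then show ?case using lam by simp
    qed
  qed
qed

context
  fixes A c
  assumes A: "A \<noteq> 0" and form: "\<And>z t. D (z, t) = Re (A * z)"
    and c: "c = A * \<mu> ^ N * of_real (lam ^ (N + N) / ts)"
begin

text \<open>
The constant \<open>c\<close> is chosen such that the limiting inequality takes its normal form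
\<open>\<rho> - Re (cnj u * (c * X))\<close>, up to a factor of constant sign.\<close>

lemma rescale:
  "\<rho> / lam ^ (N + N) * ts - Re (A * (cnj u * (\<mu> ^ N * X))) = ts / lam ^ (N + N) * (\<rho> - Re (cnj u * (c * X)))"
proof -
  have "cnj u * (c * X) = of_real (lam ^ (N + N) / ts) * (A * (cnj u * (\<mu> ^ N * X)))" by (simp only: c mult_ac)
  then have "Re (cnj u * (c * X)) = lam ^ (N + N) / ts * Re (A * (cnj u * (\<mu> ^ N * X)))"
    by (simp only: Re_of_real_mult)
  then show ?thesis using ts lam by (simp add: right_diff_distrib)
qed

text \<open>
After the first passage the height is \<open>lam\<^sup>n\<^sup>-\<^sup>2\<^sup>N\<close> times a number that tends to \<open>ts\<close>. Subtracting
\<open>Re (A \<zeta>')\<close> leaves \<open>\<Phi> (0, t')\<close> up to an error \<open>o(|\<zeta>'|)\<close>. All terms are multiplied by \<open>|\<mu>|\<^sup>m\<close>, for which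
\<open>\<zeta>'\<close> converges to a rotated multiple of the coordinate of \<open>x\<close>; the sign of \<open>\<Phi> (0, t')\<close> gives the
inequality.\<close>

lemma reach_imp_halfplane:
  assumes n: "filterlim n at_top sequentially" and m: "filterlim m at_top sequentially"
    and \<rho>: "(\<lambda>k. norm \<mu> ^ m k * lam ^ n k) \<longlonglongrightarrow> \<rho>" and u: "(\<lambda>k. sgn \<mu> ^ m k) \<longlonglongrightarrow> u"
    and x: "x \<in> unstable_mfd f p" and R: "reach f p q n m x"
  shows "\<sigma> * ts * (\<rho> - Re (cnj u * (c * ucoord x))) \<ge> 0"
proof -
  obtain y where y: "passage f p q q n y" "passage f p q x m (\<lambda>k. (f ^^ n k) (y k))"
    using R unfolding reach_def by blast
  obtain N1 where N1: "\<forall>i\<ge>N1. (inv f ^^ i) x \<in> V" "\<And>i. i \<ge> N1 \<Longrightarrow> \<exists>z. norm z < \<delta> \<and> (inv f ^^ i) x = E (z, 0)"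
    using unstable_eventually[OF x] by blast
  obtain zx where zx: "norm zx < \<delta>" "(inv f ^^ N1) x = E (zx, 0)" using N1(2) by blast
  note first = passage_coords[OF y(1) n fwd fwdE ts(1) bwd bwdE zq]
  note second = passage_coords[OF y(2) m fwd fwdE ts(1) N1(1) zx(2,1)]
  define t where "t k = snd (P ((f ^^ N) (y k)))" for k
  define \<zeta>' where "\<zeta>' k = fst (P ((f ^^ N) ((f ^^ n k) (y k))))" for k
  define t' where "t' k = snd (P ((f ^^ N) ((f ^^ n k) (y k))))" for k
  note defs = t_def[symmetric] \<zeta>'_def[symmetric] t'_def[symmetric]
  have t: "t \<longlonglongrightarrow> ts" using first(3) unfolding defs .
  have \<zeta>': "\<zeta>' \<longlonglongrightarrow> 0" and t': "t' \<longlonglongrightarrow> ts" and out: "(\<lambda>k. \<mu> ^ (m k - N - N1) * \<zeta>' k) \<longlonglongrightarrow> zx"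
    using second(2-4) unfolding defs .
  have "(\<lambda>k. \<mu> ^ (m k - (N + N1)) * \<zeta>' k) \<longlonglongrightarrow> zx" using out by (simp only: diff_diff_left)
  from scaled_limit[OF m u this]
  have W: "(\<lambda>k. of_real (norm \<mu> ^ m k) * \<zeta>' k) \<longlonglongrightarrow> cnj u * (\<mu> ^ N * ucoord x)"
    by (simp add: ucoord_eq[OF zx] power_add mult.assoc)
  have height: "\<forall>\<^sub>F k in sequentially. \<Phi> (\<zeta>' k, t' k) = lam ^ (n k - N - N) * t k"
    using first(1) second(1)
  proof eventually_elim
    case (elim k)
    have "(inv f ^^ (N + N)) (E (\<zeta>' k, t' k)) = (inv f ^^ N) ((f ^^ n k) (y k))"
      using elim(2) inv_funpow_double[of N "(f ^^ n k) (y k)"] unfolding defs by simp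
    also have "\<dots> = (f ^^ (n k - N)) (y k)" using elim(1) by (intro inv_funpow_funpow_le bij_f) simp
    finally show ?case using elim(1) unfolding \<Phi>_def defs by simp
  qed
  have "(\<lambda>k. norm \<mu> ^ m k * (lam ^ (n k - N - N) * t k)
        - Re (A * (of_real (norm \<mu> ^ m k) * \<zeta>' k))
        - norm \<mu> ^ m k * (\<Phi> (\<zeta>' k, t' k) - \<Phi> (0, t' k) - Re (A * \<zeta>' k)))
      \<longlonglongrightarrow> \<rho> / lam ^ (N + N) * ts - Re (A * (cnj u * (\<mu> ^ N * ucoord x))) - 0"
    by (intro tendsto_diff height_limit[OF n \<rho> t] tendsto_Re tendsto_mult tendsto_const W
        linearization_error[OF form \<zeta>' t' W])
  then have "(\<lambda>k. norm \<mu> ^ m k * \<Phi> (0, t' k)) \<longlonglongrightarrow> \<rho> / lam ^ (N + N) * ts - Re (A * (cnj u * (\<mu> ^ N * ucoord x))) - 0"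
  proof (rule Lim_transform_eventually)
    show "\<forall>\<^sub>F k in sequentially. norm \<mu> ^ m k * (lam ^ (n k - N - N) * t k)
        - Re (A * (of_real (norm \<mu> ^ m k) * \<zeta>' k))
        - norm \<mu> ^ m k * (\<Phi> (\<zeta>' k, t' k) - \<Phi> (0, t' k) - Re (A * \<zeta>' k)) = norm \<mu> ^ m k * \<Phi> (0, t' k)"
      using height
    proof eventually_elim
      case (elim k)
      have "A * (of_real (norm \<mu> ^ m k) * \<zeta>' k) = of_real (norm \<mu> ^ m k) * (A * \<zeta>' k)" by (simp only: mult_ac)
      then have "Re (A * (of_real (norm \<mu> ^ m k) * \<zeta>' k)) = norm \<mu> ^ m k * Re (A * \<zeta>' k)"
        by (simp only: Re_of_real_mult)
      then show ?case unfolding elim[symmetric] by (simp only: right_diff_distrib)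
    qed
  qed
  then have lim: "(\<lambda>k. \<sigma> * (norm \<mu> ^ m k * \<Phi> (0, t' k))) \<longlonglongrightarrow> \<sigma> * (ts / lam ^ (N + N) * (\<rho> - Re (cnj u * (c * ucoord x))))"
    unfolding rescale diff_0_right by (rule tendsto_mult[OF tendsto_const])
  have "\<forall>\<^sub>F k in sequentially. \<sigma> * (norm \<mu> ^ m k * \<Phi> (0, t' k)) \<ge> 0"
    using tendstoD[OF t' \<epsilon>]
  proof eventually_elim
    case (elim k)
    then have "\<sigma> * \<Phi> (0, t' k) \<ge> 0" using \<Phi>_sign by (simp add: dist_real_def)
    then have "norm \<mu> ^ m k * (\<sigma> * \<Phi> (0, t' k)) \<ge> 0" by (rule mult_nonneg_nonneg[OF zero_le_power[OF norm_ge_zero]])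
    then show ?case by (simp add: mult.left_commute)
  qed
  with lim have "\<sigma> * (ts / lam ^ (N + N) * (\<rho> - Re (cnj u * (c * ucoord x)))) \<ge> 0"
    by (rule tendsto_lowerbound) simp
  then have "lam ^ (N + N) * (\<sigma> * (ts / lam ^ (N + N) * (\<rho> - Re (cnj u * (c * ucoord x))))) \<ge> 0"
    by (rule mult_nonneg_nonneg[rotated]) (use lam in simp)
  moreover have "lam ^ (N + N) * (\<sigma> * (ts / lam ^ (N + N) * (\<rho> - Re (cnj u * (c * ucoord x))))) = \<sigma> * ts * (\<rho> - Re (cnj u * (c * ucoord x)))"
    using lam by simp
  ultimately show ?thesis by simp
qed

lemma \<Phi>_continuous_near:
  obtains \<eta> where "\<eta> > 0" "continuous_on (ball 0 \<eta> \<times> ball ts \<eta>) \<Phi>"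
    "\<And>\<zeta> t. norm \<zeta> < \<eta> \<Longrightarrow> \<bar>t - ts\<bar> < \<eta> \<Longrightarrow> norm \<zeta> < \<delta> \<and> \<bar>t\<bar> < \<delta> \<and> (inv f ^^ (N + N)) (E (\<zeta>, t)) \<in> V"
proof -
  let ?Q = "ball (0 :: complex) \<delta> \<times> ball (0 :: real) \<delta>"
  define B where "B = ?Q \<inter> (\<lambda>x. (inv f ^^ (N + N)) (E x)) -` V"
  have cont: "continuous_on ?Q (\<lambda>x. (inv f ^^ (N + N)) (E x))"
    by (rule continuous_on_compose2[OF continuous_on_funpow[OF cont_inv] contE]) simp
  have "open B" unfolding B_def using cont open_V by (intro continuous_open_preimage) (auto intro: open_Times)
  moreover have "(0, ts) \<in> B"
    using ts \<delta> zq V_E[of zq 0] by (simp add: B_def fwdE[symmetric] inv_funpow_double bwdE)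
  ultimately obtain S T where ST: "open S" "open T" "0 \<in> S" "ts \<in> T" "S \<times> T \<subseteq> B"
    by (metis open_prod_elim mem_Sigma_iff)
  obtain \<eta>1 where \<eta>1: "\<eta>1 > 0" "ball 0 \<eta>1 \<subseteq> S" using ST(1,3) unfolding open_contains_ball by blast
  obtain \<eta>2 where \<eta>2: "\<eta>2 > 0" "ball ts \<eta>2 \<subseteq> T" using ST(2,4) unfolding open_contains_ball by blast
  note \<eta> = \<eta>1 \<eta>2
  define \<eta> where "\<eta> = min \<eta>1 \<eta>2"
  have sub: "ball 0 \<eta> \<times> ball ts \<eta> \<subseteq> B"
  proof -
    have "ball 0 \<eta> \<subseteq> S" "ball ts \<eta> \<subseteq> T" using \<eta> by (auto simp: \<eta>_def)
    then show ?thesis using ST(5) by blast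
  qed
  have contV: "continuous_on V P" using contP by (simp add: V_def)
  have "continuous_on B (\<lambda>x. P ((inv f ^^ (N + N)) (E x)))"
    by (rule continuous_on_compose2[OF contV continuous_on_subset[OF cont]]) (auto simp: B_def)
  then have "continuous_on B \<Phi>" unfolding \<Phi>_def by (rule continuous_on_snd)
  then have "continuous_on (ball 0 \<eta> \<times> ball ts \<eta>) \<Phi>" using sub by (rule continuous_on_subset)
  moreover have "norm \<zeta> < \<delta> \<and> \<bar>t\<bar> < \<delta> \<and> (inv f ^^ (N + N)) (E (\<zeta>, t)) \<in> V" if "norm \<zeta> < \<eta>" "\<bar>t - ts\<bar> < \<eta>" for \<zeta> t
  proof -
    have "(\<zeta>, t) \<in> ball 0 \<eta> \<times> ball ts \<eta>" using that by (simp add: dist_real_def abs_minus_commute)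
    then have "(\<zeta>, t) \<in> B" using sub by blast
    then show ?thesis by (simp add: B_def)
  qed
  moreover have "\<eta> > 0" using \<eta> by (simp add: \<eta>_def)
  ultimately show thesis using that by blast
qed

text \<open>
By the intermediate value theorem in \<open>t\<close>: for \<open>t = ts\<close> the assumed inequality says that \<open>\<Phi>\<close> has not
reached the prescribed level, and at a fixed small distance from \<open>ts\<close> it is past that level, which
tends to \<open>0\<close>.\<close>

lemma halfplane_imp_level_points:
  assumes n: "filterlim n at_top sequentially" and m: "filterlim m at_top sequentially"
    and \<rho>: "(\<lambda>k. norm \<mu> ^ m k * lam ^ n k) \<longlonglongrightarrow> \<rho>" and u: "(\<lambda>k. sgn \<mu> ^ m k) \<longlonglongrightarrow> u"
    and pos: "\<sigma> * ts * (\<rho> - Re (cnj u * (c * X))) > 0" and e: "e > 0"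
  shows "\<forall>\<^sub>F k in sequentially. \<exists>t. \<bar>t - ts\<bar> \<le> e \<and> \<Phi> (\<mu> ^ N * X / \<mu> ^ m k, t) = lam ^ (n k - N - N) * ts"
proof -
  define \<zeta> where "\<zeta> k = \<mu> ^ N * X / \<mu> ^ m k" for k
  obtain \<eta> where \<eta>: "\<eta> > 0" "continuous_on (ball 0 \<eta> \<times> ball ts \<eta>) \<Phi>" using \<Phi>_continuous_near .
  define e0 where "e0 = min e (min (\<eta> / 2) (\<epsilon> / 2))"
  have e0: "e0 > 0" "e0 \<le> e" "e0 < \<eta>" "e0 < \<epsilon>" using e \<eta> \<epsilon> by (auto simp: e0_def)
  have \<zeta>: "\<zeta> \<longlonglongrightarrow> 0" unfolding \<zeta>_def by (rule filterlim_compose[OF over_power_tendsto m])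
  have "(\<lambda>k. \<mu> ^ (m k - 0) * \<zeta> k) \<longlonglongrightarrow> \<mu> ^ N * X" using \<mu>_nz by (simp add: \<zeta>_def)
  from scaled_limit[OF m u this] have W: "(\<lambda>k. of_real (norm \<mu> ^ m k) * \<zeta> k) \<longlonglongrightarrow> cnj u * (\<mu> ^ N * X)" by simp
  \<comment> \<open>at \<open>t = ts\<close> the height has not yet been reached\<close>
  have "(\<lambda>k. \<sigma> * (norm \<mu> ^ m k * (\<Phi> (\<zeta> k, ts) - \<Phi> (0, ts) - Re (A * \<zeta> k)) + Re (A * (of_real (norm \<mu> ^ m k) * \<zeta> k))
        - norm \<mu> ^ m k * (lam ^ (n k - N - N) * ts)))
      \<longlonglongrightarrow> \<sigma> * (0 + Re (A * (cnj u * (\<mu> ^ N * X))) - \<rho> / lam ^ (N + N) * ts)"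
    by (intro tendsto_diff tendsto_add height_limit[OF n \<rho> tendsto_const] tendsto_Re tendsto_mult tendsto_const W
        linearization_error[OF form \<zeta> tendsto_const W])
  moreover have "\<sigma> * (0 + Re (A * (cnj u * (\<mu> ^ N * X))) - \<rho> / lam ^ (N + N) * ts) < 0"
  proof -
    have "\<sigma> * (0 + Re (A * (cnj u * (\<mu> ^ N * X))) - \<rho> / lam ^ (N + N) * ts) = - (\<sigma> * (\<rho> / lam ^ (N + N) * ts - Re (A * (cnj u * (\<mu> ^ N * X)))))"
      by (simp add: algebra_simps)
    also have "\<dots> = - (\<sigma> * ts * (\<rho> - Re (cnj u * (c * X))) / lam ^ (N + N))" unfolding rescale by simp
    also have "\<dots> < 0" using pos lam by simp
    finally show ?thesis .
  qed
  ultimately have "\<forall>\<^sub>F k in sequentially. \<sigma> * (norm \<mu> ^ m k * (\<Phi> (\<zeta> k, ts) - \<Phi> (0, ts) - Re (A * \<zeta> k)) + Re (A * (of_real (norm \<mu> ^ m k) * \<zeta> k))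
        - norm \<mu> ^ m k * (lam ^ (n k - N - N) * ts)) < 0" by (rule order_tendstoD)
  then have low: "\<forall>\<^sub>F k in sequentially. \<sigma> * (\<Phi> (\<zeta> k, ts) - lam ^ (n k - N - N) * ts) < 0"
  proof eventually_elim
    case (elim k)
    have "A * (of_real (norm \<mu> ^ m k) * \<zeta> k) = of_real (norm \<mu> ^ m k) * (A * \<zeta> k)" by (simp only: mult_ac)
    then have "Re (A * (of_real (norm \<mu> ^ m k) * \<zeta> k)) = norm \<mu> ^ m k * Re (A * \<zeta> k)"
      by (simp only: Re_of_real_mult)
    with elim have "norm \<mu> ^ m k * (\<sigma> * (\<Phi> (\<zeta> k, ts) - lam ^ (n k - N - N) * ts)) < 0"
      by (simp only: \<Phi>_0) (simp add: algebra_simps)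
    moreover have "norm \<mu> ^ m k > 0" using \<mu>_nz by simp
    ultimately show ?case by (simp add: mult_less_0_iff)
  qed
  \<comment> \<open>at \<open>t = ts + e0\<close> it has been passed\<close>
  have "isCont \<Phi> (0, ts + e0)"
    using \<eta>(2) e0 by (subst (asm) continuous_on_eq_continuous_at) (auto intro!: open_Times simp: dist_real_def)
  then have past: "(\<lambda>k. \<Phi> (\<zeta> k, ts + e0)) \<longlonglongrightarrow> \<Phi> (0, ts + e0)"
    using tendsto_Pair[OF \<zeta> tendsto_const] by (rule isCont_tendsto_compose)
  have "filterlim (\<lambda>k. n k - (N + N)) at_top sequentially"
    using filterlim_compose[OF filterlim_minus_const_nat_at_top n] .
  then have h0: "(\<lambda>k. lam ^ (n k - (N + N)) * ts) \<longlonglongrightarrow> 0 * ts"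
    using lam by (intro tendsto_mult tendsto_const filterlim_compose[OF LIMSEQ_power_zero]) auto
  have "(\<lambda>k. \<sigma> * (\<Phi> (\<zeta> k, ts + e0) - lam ^ (n k - N - N) * ts)) \<longlonglongrightarrow> \<sigma> * (\<Phi> (0, ts + e0) - 0 * ts)"
    unfolding diff_diff_left by (rule tendsto_mult[OF tendsto_const tendsto_diff[OF past h0]])
  moreover have "\<sigma> * (\<Phi> (0, ts + e0) - 0 * ts) > 0" using one_sided[of "ts + e0"] e0 by simp
  ultimately have high: "\<forall>\<^sub>F k in sequentially. \<sigma> * (\<Phi> (\<zeta> k, ts + e0) - lam ^ (n k - N - N) * ts) > 0"
    by (rule order_tendstoD)
  have "\<forall>\<^sub>F k in sequentially. dist (\<zeta> k) 0 < \<eta>" using \<zeta> \<eta>(1) by (rule tendstoD)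
  with low high show ?thesis
  proof eventually_elim
    case (elim k)
    let ?g = "\<lambda>t. \<sigma> * (\<Phi> (\<zeta> k, t) - lam ^ (n k - N - N) * ts)"
    have "continuous_on {ts..ts + e0} (\<lambda>t. \<Phi> (\<zeta> k, t))"
      by (rule continuous_on_compose2[OF \<eta>(2)]) (use elim(3) e0 in \<open>auto intro!: continuous_intros simp: dist_real_def dist_norm\<close>)
    then have "continuous_on {ts..ts + e0} ?g" by (intro continuous_intros)
    then obtain t where "ts \<le> t" "t \<le> ts + e0" "?g t = 0" using IVT'[of ?g ts 0 "ts + e0"] elim e0 by force
    then show ?case using \<sigma> e0 by (intro exI[of _ t]) (simp add: \<zeta>_def)
  qed
qed

text \<open>
The points found above are placed at the beginning of the second passage. Their preimages under
\<open>N + N\<close> steps have exactly the height needed to have come from height \<open>ts\<close> in \<open>n - 2 N\<close> linear steps,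
which provides the first passage.\<close>

lemma halfplane_imp_reach:
  assumes n: "filterlim n at_top sequentially" and m: "filterlim m at_top sequentially"
    and \<rho>: "(\<lambda>k. norm \<mu> ^ m k * lam ^ n k) \<longlonglongrightarrow> \<rho>" and u: "(\<lambda>k. sgn \<mu> ^ m k) \<longlonglongrightarrow> u"
    and x: "x \<in> unstable_mfd f p" and pos: "\<sigma> * ts * (\<rho> - Re (cnj u * (c * ucoord x))) > 0"
  shows "reach f p q n m x"
proof -
  define X where "X = ucoord x"
  define \<zeta>' where "\<zeta>' k = \<mu> ^ N * X / \<mu> ^ m k" for k
  obtain t' where t': "t' \<longlonglongrightarrow> ts" "\<forall>\<^sub>F k in sequentially. \<Phi> (\<zeta>' k, t' k) = lam ^ (n k - N - N) * ts"
    using tendsto_select[OF halfplane_imp_level_points[OF n m \<rho> u pos]] unfolding \<zeta>'_def X_def by blast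
  have \<zeta>': "\<zeta>' \<longlonglongrightarrow> 0" unfolding \<zeta>'_def by (rule filterlim_compose[OF over_power_tendsto m])
  obtain \<eta> where \<eta>: "\<eta> > 0" "\<And>\<zeta> t. norm \<zeta> < \<eta> \<Longrightarrow> \<bar>t - ts\<bar> < \<eta> \<Longrightarrow> norm \<zeta> < \<delta> \<and> \<bar>t\<bar> < \<delta> \<and> (inv f ^^ (N + N)) (E (\<zeta>, t)) \<in> V"
    using \<Phi>_continuous_near by metis
  define w where "w k = (inv f ^^ (N + N)) (E (\<zeta>' k, t' k))" for k
  have "(\<lambda>k. E (\<zeta>' k, t' k)) \<longlonglongrightarrow> E (0, ts)" by (rule E_tendsto[OF \<zeta>' t'(1)]) (use ts \<delta> in simp_all)
  then have "w \<longlonglongrightarrow> (inv f ^^ (N + N)) (E (0, ts))"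
    unfolding w_def by (rule continuous_UNIV_tendsto[OF continuous_on_funpow[OF cont_inv]])
  then have w: "w \<longlonglongrightarrow> E (zq, 0)" unfolding fwdE[symmetric] inv_funpow_double bwdE .
  define z2 where "z2 k = fst (P (w k))" for k
  have EV: "E (zq, 0) \<in> V" using V_E zq \<delta> by simp
  have "(\<lambda>k. P (w k)) \<longlonglongrightarrow> (zq, 0)" using P_tendsto[OF w EV] PE[of zq 0] zq \<delta> by simp
  then have z2: "z2 \<longlonglongrightarrow> zq" unfolding z2_def by (auto dest: tendsto_fst)
  have ev_w: "\<forall>\<^sub>F k in sequentially. w k = E (z2 k, lam ^ (n k - N - N) * ts) \<and> norm (z2 k) < \<delta>"
    using topological_tendstoD[OF w open_V EV] t'(2)
  proof eventually_elim
    case (elim k)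
    have "snd (P (w k)) = lam ^ (n k - N - N) * ts" using elim(2) by (simp add: \<Phi>_def w_def)
    then have "P (w k) = (z2 k, lam ^ (n k - N - N) * ts)" by (simp add: z2_def prod_eq_iff)
    then show ?case using V_P[OF elim(1)] by simp
  qed
  \<comment> \<open>dividing \<open>z2\<close> by \<open>\<mu> ^ j\<close> makes the linear orbit from height \<open>ts\<close> end at \<open>w k\<close>\<close>
  define j where "j k = n k - N - N" for k
  have j: "filterlim j at_top sequentially"
    unfolding j_def diff_diff_left using filterlim_compose[OF filterlim_minus_const_nat_at_top n] .
  have n_large: "\<forall>\<^sub>F k in sequentially. N + N \<le> n k" using n by (simp add: filterlim_at_top)
  have "(\<lambda>k. z2 k * (1 / \<mu> ^ j k)) \<longlonglongrightarrow> zq * 0"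
    by (intro tendsto_mult z2 filterlim_compose[OF over_power_tendsto j])
  then have z2': "(\<lambda>k. z2 k / \<mu> ^ j k) \<longlonglongrightarrow> 0" by simp
  have "passage f p (E (0, ts)) (E (zq, 0)) j (\<lambda>k. E (z2 k / \<mu> ^ j k, ts))"
    by (rule passage_construct[OF ts(1) zq z2' tendsto_const j]) (use z2 \<mu>_nz in simp)
  from passage_shift[OF bij_f cont_f cont_inv this, of N N]
  have "passage f p ((inv f ^^ N) ((f ^^ N) q)) ((f ^^ N) ((inv f ^^ N) q)) (\<lambda>k. N + j k + N) (\<lambda>k. (inv f ^^ N) (E (z2 k / \<mu> ^ j k, ts)))"
    unfolding fwdE bwdE .
  then have pass1: "passage f p q q (\<lambda>k. N + j k + N) (\<lambda>k. (inv f ^^ N) (E (z2 k / \<mu> ^ j k, ts)))"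
    unfolding inv_funpow_funpow[OF bij_f] funpow_inv_funpow[OF bij_f] .
  define y where "y k = (inv f ^^ N) (E (z2 k / \<mu> ^ j k, ts))" for k
  have y: "passage f p q q n y"
    by (rule passage_cong[OF pass1]) (use n_large in eventually_elim, simp add: j_def y_def)
  \<comment> \<open>from \<open>\<zeta>'\<close> it takes \<open>i k\<close> linear steps to the point of the unstable axis that \<open>f ^^ N1\<close> carries to \<open>x\<close>\<close>
  obtain N1 where N1: "norm (X / \<mu> ^ N1) < \<delta>" using ex_small by blast
  define i where "i k = m k - (N + N1)" for k
  have i: "filterlim i at_top sequentially"
    unfolding i_def using filterlim_compose[OF filterlim_minus_const_nat_at_top m] .
  have m_large: "\<forall>\<^sub>F k in sequentially. N + N1 \<le> m k" using m by (simp add: filterlim_at_top)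
  have out: "(\<lambda>k. \<mu> ^ i k * \<zeta>' k) \<longlonglongrightarrow> X / \<mu> ^ N1"
  proof (rule Lim_transform_eventually[OF tendsto_const])
    show "\<forall>\<^sub>F k in sequentially. X / \<mu> ^ N1 = \<mu> ^ i k * \<zeta>' k"
      using m_large
    proof eventually_elim
      case (elim k)
      have "\<mu> ^ m k = \<mu> ^ i k * \<mu> ^ N * \<mu> ^ N1" using elim by (simp add: i_def power_add[symmetric])
      then show ?case using \<mu>_nz by (simp add: \<zeta>'_def)
    qed
  qed
  have "passage f p (E (0, ts)) (E (X / \<mu> ^ N1, 0)) i (\<lambda>k. E (\<zeta>' k, t' k))"
    by (rule passage_construct[OF ts(1) N1 \<zeta>' t'(1) i out])
  from passage_shift[OF bij_f cont_f cont_inv this, of N N1]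
  have "passage f p ((inv f ^^ N) ((f ^^ N) q)) (upoint X) (\<lambda>k. N + i k + N1) (\<lambda>k. (inv f ^^ N) (E (\<zeta>' k, t' k)))"
    unfolding fwdE upoint_eq[OF N1] .
  then have pass2: "passage f p q x (\<lambda>k. N + i k + N1) (\<lambda>k. (inv f ^^ N) (E (\<zeta>' k, t' k)))"
    unfolding inv_funpow_funpow[OF bij_f] X_def upoint_ucoord[OF x] .
  have "passage f p q x m (\<lambda>k. (f ^^ n k) (y k))"
  proof (rule passage_cong[OF pass2])
    show "\<forall>\<^sub>F k in sequentially. N + i k + N1 = m k \<and> (inv f ^^ N) (E (\<zeta>' k, t' k)) = (f ^^ n k) (y k)"
      using m_large n_large ev_w
    proof eventually_elim
      case (elim k)
      have nk: "n k = N + (j k + N)" using elim(2) by (simp add: j_def)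
      have "(f ^^ n k) (y k) = (f ^^ N) ((f ^^ j k) (E (z2 k / \<mu> ^ j k, ts)))"
        unfolding nk y_def funpow_add o_apply funpow_inv_funpow[OF bij_f] ..
      also have "(f ^^ j k) (E (z2 k / \<mu> ^ j k, ts)) = E (\<mu> ^ j k * (z2 k / \<mu> ^ j k), lam ^ j k * ts)"
        using elim(3) ts \<mu>_nz by (intro funpow_E) simp_all
      also have "\<mu> ^ j k * (z2 k / \<mu> ^ j k) = z2 k" using \<mu>_nz by simp
      also have "E (z2 k, lam ^ j k * ts) = w k" using elim(3) by (simp add: j_def)
      also have "(f ^^ N) (w k) = (inv f ^^ N) (E (\<zeta>' k, t' k))"
        unfolding w_def funpow_add o_apply funpow_inv_funpow[OF bij_f] ..
      finally show ?case using elim(1) by (simp add: i_def)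
    qed
  qed
  then show ?thesis using y unfolding reach_def by blast
qed

end

theorem reach_halfplane:
  obtains c s where "c \<noteq> 0" "s \<noteq> 0"
    "\<And>n m \<rho> u x. \<lbrakk>filterlim n at_top sequentially; filterlim m at_top sequentially;
        (\<lambda>k. norm \<mu> ^ m k * lam ^ n k) \<longlonglongrightarrow> \<rho>; (\<lambda>k. sgn \<mu> ^ m k) \<longlonglongrightarrow> u; x \<in> unstable_mfd f p\<rbrakk> \<Longrightarrow>
      (reach f p q n m x \<longrightarrow> s * (\<rho> - Re (cnj u * (c * ucoord x))) \<ge> 0) \<and>
      (s * (\<rho> - Re (cnj u * (c * ucoord x))) > 0 \<longrightarrow> reach f p q n m x)"
proof -
  obtain A where A: "A \<noteq> 0" "\<And>z t. D (z, t) = Re (A * z)" using D_form by blast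
  show thesis
  proof
    show "A * \<mu> ^ N * of_real (lam ^ (N + N) / ts) \<noteq> 0" using A \<mu>_nz lam ts by simp
    show "\<sigma> * ts \<noteq> 0" using \<sigma> ts by simp
  qed (use reach_imp_halfplane[OF A refl] halfplane_imp_reach[OF A refl] in blast)
qed

end

section \<open>Linearizing neighbourhoods and quadratic tangencies\<close>

text \<open>
The hypotheses on one of the two maps, once its derivative is in normal form: \<open>S\<close> is the linear change
of coordinates with inverse \<open>S'\<close>, so that \<open>E\<close> and \<open>P\<close> are the linearizing coordinate \<open>\<phi>\<close> read in
\<open>\<complex> \<times> \<real>\<close>. The radius \<open>\<delta>\<close> keeps the images under \<open>f\<close> in \<open>U\<close>, where linearity is known.\<close>

locale linearized_saddle =
  fixes r :: enat and A :: "'m::{t2_space, first_countable_topology} chart3 set" and f :: "'m \<Rightarrow> 'm" and p :: 'm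
    and U :: "'m set" and \<phi> :: "'m \<Rightarrow> real ^ 3" and \<mu> :: complex and lam \<delta> :: real
    and S :: "complex \<times> real \<Rightarrow> real ^ 3" and S' :: "real ^ 3 \<Rightarrow> complex \<times> real"
    and E :: "complex \<times> real \<Rightarrow> 'm" and P :: "'m \<Rightarrow> complex \<times> real"
  assumes r: "3 \<le> r" and atlas: "Cr_atlas r A" and diffeo: "f \<in> Diff r A" and fix_p: "f p = p"
    and coord: "local_coord r A U \<phi>" and p_U: "p \<in> U" and \<phi>_p: "\<phi> p = 0"
    and S: "linear S" "linear S'" "\<And>x. S' (S x) = x" "\<And>v. S (S' v) = v"
    and lin: "\<And>x. x \<in> U \<Longrightarrow> f x \<in> U \<Longrightarrow> S' (\<phi> (f x)) = (\<mu> * fst (S' (\<phi> x)), lam * snd (S' (\<phi> x)))"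
    and box: "\<And>z t. norm z < \<delta> \<Longrightarrow> \<bar>t\<bar> < \<delta> \<Longrightarrow> S (z, t) \<in> \<phi> ` U \<and> f (inv_into U \<phi> (S (z, t))) \<in> U"
    and norm_\<mu>: "norm \<mu> > 1" and lam_bounds: "0 < lam" "lam < 1" and \<delta>_pos: "\<delta> > 0"
    and E_def: "E = (\<lambda>x. inv_into U \<phi> (S x))" and P_def: "P = (\<lambda>x. S' (\<phi> x))"
begin

lemma chart_U: "chart U \<phi>"
  using coord by (simp add: local_coord_def)

lemma E_in_U: "norm z < \<delta> \<Longrightarrow> \<bar>t\<bar> < \<delta> \<Longrightarrow> E (z, t) \<in> U"
  and \<phi>_E: "norm z < \<delta> \<Longrightarrow> \<bar>t\<bar> < \<delta> \<Longrightarrow> \<phi> (E (z, t)) = S (z, t)"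
  using box chart_inverse'[OF chart_U] by (simp_all add: E_def)

lemma E_P: "x \<in> U \<Longrightarrow> E (P x) = x"
  using S(4) chart_inverse[OF chart_U] by (simp add: E_def P_def)

lemma f_E: "norm z < \<delta> \<Longrightarrow> \<bar>t\<bar> < \<delta> \<Longrightarrow> f (E (z, t)) = E (\<mu> * z, lam * t)"
proof -
  assume zt: "norm z < \<delta>" "\<bar>t\<bar> < \<delta>"
  have fU: "f (E (z, t)) \<in> U" using box[OF zt] by (simp add: E_def)
  have "P (f (E (z, t))) = (\<mu> * z, lam * t)"
    using lin[OF E_in_U[OF zt] fU] by (simp add: P_def \<phi>_E[OF zt] S(3))
  then show ?thesis using E_P[OF fU] by simp
qed

sublocale saddle_chart f p \<mu> lam \<delta> E P
proof
  show "bij f" "continuous_on UNIV f" "continuous_on UNIV (inv f)"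
    using diffeo by (simp_all add: Diff_def Cr_map_def)
  show "f p = p" "norm \<mu> > 1" "0 < lam" "lam < 1" "\<delta> > 0" by (fact fix_p norm_\<mu> lam_bounds \<delta>_pos)+
  show "E (0, 0) = p"
    using linear_0[OF S(1)] chart_inverse[OF chart_U p_U] by (simp add: E_def \<phi>_p zero_prod_def)
  show PE: "P (E (z, t)) = (z, t)" if "norm z < \<delta>" "\<bar>t\<bar> < \<delta>" for z t
    using that by (simp add: P_def \<phi>_E S(3))
  have contS: "continuous_on X S" and contS': "continuous_on Y S'" for X Y
    using S(1,2) by (simp_all add: linear_continuous_on linear_conv_bounded_linear)
  let ?Q = "ball (0 :: complex) \<delta> \<times> ball (0 :: real) \<delta>"
  have SQ: "S ` ?Q \<subseteq> \<phi> ` U" using box by auto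
  show "continuous_on ?Q E" unfolding E_def
    by (rule continuous_on_compose2[OF chart_inverse_continuous[OF chart_U] contS SQ])
  have EQ: "E ` ?Q \<subseteq> U" using E_in_U by auto
  show "continuous_on (E ` ?Q) P" unfolding P_def
    by (rule continuous_on_compose2[OF contS' continuous_on_subset[OF chart_continuous[OF chart_U] EQ]]) auto
  have "E ` ?Q = U \<inter> \<phi> -` (S' -` ?Q)"
  proof (intro equalityI subsetI)
    fix x assume "x \<in> E ` ?Q"
    then show "x \<in> U \<inter> \<phi> -` (S' -` ?Q)" using EQ PE by (auto simp: P_def)
  next
    fix x assume x: "x \<in> U \<inter> \<phi> -` (S' -` ?Q)"
    then have "x = E (P x)" "P x \<in> ?Q" using E_P by (auto simp: P_def)
    then show "x \<in> E ` ?Q" by (rule image_eqI)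
  qed
  moreover have "open (S' -` ?Q)" using contS'[of UNIV] by (intro open_vimage) (auto intro: open_Times)
  ultimately show "open (E ` ?Q)"
    using chart_continuous[OF chart_U] chart_open[OF chart_U] continuous_open_preimage by metis
  show "f (E (z, t)) = E (\<mu> * z, lam * t)" if "norm z < \<delta>" "\<bar>t\<bar> < \<delta>" for z t
    using that by (rule f_E)
  show "P (f (E (z, t))) = (\<mu> * z, lam * t)" if "norm z < \<delta>" "\<bar>t\<bar> < \<delta>" for z t
  proof -
    have "f (E (z, t)) \<in> U" using box[OF that] by (simp add: E_def)
    from lin[OF E_in_U[OF that] this] show ?thesis using that by (simp add: P_def \<phi>_E S(3))
  qed
qed

lemma V_subset_U: "V \<subseteq> U"
  unfolding V_def using E_in_U by auto

lemma orbit_in_U: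
  assumes "\<And>i. i \<le> n \<Longrightarrow> (f ^^ i) x \<in> U"
  shows "P ((f ^^ n) x) = (\<mu> ^ n * fst (P x), lam ^ n * snd (P x))"
  using assms
proof (induction n)
  case (Suc n)
  have y: "(f ^^ n) x \<in> U" "f ((f ^^ n) x) \<in> U" using Suc.prems[of n] Suc.prems[of "Suc n"] by simp_all
  have "P ((f ^^ n) x) = (\<mu> ^ n * fst (P x), lam ^ n * snd (P x))" using Suc by simp
  then show ?case using lin[OF y] unfolding P_def by (simp add: mult.assoc)
qed simp

text \<open>
Here the orbit is known to stay in \<open>U\<close>, but not in the small product neighbourhood; linearity on \<open>U\<close>
identifies the global coordinate with \<open>P\<close> on the whole local unstable manifold.\<close>

lemma local_unstable_ucoord:
  assumes "x \<in> local_unstable_mfd U f p" shows "ucoord x = fst (P x)"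
proof -
  have x: "x \<in> unstable_mfd f p" "\<And>n. (inv f ^^ n) x \<in> U"
    using assms by (simp_all add: local_unstable_mfd_def local_stable_mfd_def unstable_mfd_def)
  obtain N z where N: "norm z < \<delta>" "(inv f ^^ N) x = E (z, 0)" using unstable_eventually[OF x(1)] by (metis order_refl)
  have "P ((f ^^ N) ((inv f ^^ N) x)) = (\<mu> ^ N * fst (P ((inv f ^^ N) x)), lam ^ N * snd (P ((inv f ^^ N) x)))"
    using x(2) funpow_inv_funpow_le[OF bij_f] by (intro orbit_in_U) simp
  then have "P x = (\<mu> ^ N * fst (P ((inv f ^^ N) x)), lam ^ N * snd (P ((inv f ^^ N) x)))"
    by (simp only: funpow_inv_funpow[OF bij_f])
  then have "fst (P x) = \<mu> ^ N * fst (P (E (z, 0)))" by (simp add: N(2))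
  then show ?thesis using ucoord_eq[OF N] PE[of z 0] N(1) \<delta> by simp
qed

lemma local_stable_vertical:
  assumes "x \<in> local_stable_mfd U f p" shows "fst (P x) = 0"
proof -
  have x: "x \<in> stable_mfd f p" "\<And>n. (f ^^ n) x \<in> U" using assms by (simp_all add: local_stable_mfd_def)
  obtain N t where N: "\<bar>t\<bar> < \<delta>" "(f ^^ N) x = E (0, t)" using stable_eventually[OF x(1)] by (metis order_refl)
  have "P ((f ^^ N) x) = (\<mu> ^ N * fst (P x), lam ^ N * snd (P x))" using x(2) by (intro orbit_in_U)
  then have "\<mu> ^ N * fst (P x) = 0" using PE[of 0 t] N \<delta> by simp
  then show ?thesis using \<mu>_nz by simp
qed

lemma smooth_iterates:
  assumes "local_coord r A W \<psi>" "local_coord r A W' \<psi>'" "x \<in> W"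
  shows "(f ^^ n) x \<in> W' \<Longrightarrow> \<exists>L. strict_deriv (\<psi>' \<circ> (f ^^ n) \<circ> inv_into W \<psi>) L (\<psi> x)"
    and "(inv f ^^ n) x \<in> W' \<Longrightarrow> \<exists>L. strict_deriv (\<psi>' \<circ> (inv f ^^ n) \<circ> inv_into W \<psi>) L (\<psi> x)"
proof -
  have "1 \<le> r" using r order_trans[of 1 3 r] by (simp add: one_enat_def numeral_eq_enat)
  moreover have "Cr_map r A f" "Cr_map r A (inv f)" using diffeo by (simp_all add: Diff_def)
  ultimately have "strictly_smooth_at r A (f ^^ n) x" "strictly_smooth_at r A (inv f ^^ n) x"
    using strictly_smooth_funpow atlas by blast+
  then show "(f ^^ n) x \<in> W' \<Longrightarrow> \<exists>L. strict_deriv (\<psi>' \<circ> (f ^^ n) \<circ> inv_into W \<psi>) L (\<psi> x)"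
    "(inv f ^^ n) x \<in> W' \<Longrightarrow> \<exists>L. strict_deriv (\<psi>' \<circ> (inv f ^^ n) \<circ> inv_into W \<psi>) L (\<psi> x)"
    using assms unfolding strictly_smooth_at_def by blast+
qed

end

text \<open>
The chain rule for \<open>k \<circ> g = id\<close>: derivatives of iterates in charts are invertible.\<close>

lemma strict_deriv_inverse:
  assumes W: "chart W \<psi>" and W': "chart W' \<psi>'" and x: "x \<in> W" "g x \<in> W'"
    and cont: "continuous_on UNIV g" and kg: "\<And>y. k (g y) = y"
    and L: "strict_deriv (\<psi>' \<circ> g \<circ> inv_into W \<psi>) L (\<psi> x)"
    and K: "strict_deriv (\<psi> \<circ> k \<circ> inv_into W' \<psi>') K (\<psi>' (g x))"
  shows "K (L v) = v"
proof -
  have "strict_deriv ((\<psi> \<circ> k) \<circ> g \<circ> inv_into W \<psi>) (K \<circ> L) (\<psi> x)"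
    by (rule strict_deriv_through_chart[OF W W' x cont L K])
  then have "strict_deriv id (K \<circ> L) (\<psi> x)"
  proof (rule strict_deriv_cong)
    show "open (\<psi> ` W)" using W by (simp add: chart_def)
    show "\<psi> x \<in> \<psi> ` W" using x by simp
    show "((\<psi> \<circ> k) \<circ> g \<circ> inv_into W \<psi>) y = id y" if "y \<in> \<psi> ` W" for y
      using chart_inverse'[OF W that] kg by simp
  qed
  then have "(id has_derivative K \<circ> L) (at (\<psi> x))" by (rule strict_deriv_has_derivative)
  moreover have "(id has_derivative id) (at (\<psi> x))" by (simp add: id_def)
  ultimately have "K \<circ> L = id" by (rule has_derivative_unique)
  then show ?thesis by (metis comp_apply id_apply)
qed

text \<open>
By the mean value theorem \<open>g t = t * g' \<xi>\<close> with \<open>\<xi>\<close> between \<open>0\<close> and \<open>t\<close>, and \<open>g' \<xi> / \<xi>\<close> is close to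
\<open>D\<close>.\<close>

lemma second_derivative_sign:
  fixes g g' :: "real \<Rightarrow> real"
  assumes J: "open J" "0 \<in> J" and g: "\<And>t. t \<in> J \<Longrightarrow> (g has_real_derivative g' t) (at t)"
    and g0: "g 0 = 0" "g' 0 = 0" and g': "(g' has_real_derivative D) (at 0)" and D: "D \<noteq> 0"
  shows "\<exists>d>0. \<forall>t. 0 < \<bar>t\<bar> \<and> \<bar>t\<bar> < d \<longrightarrow> D * g t > 0"
proof -
  have "((\<lambda>t. g' t / t) \<longlongrightarrow> D) (at 0)" using g' g0 by (simp add: DERIV_def)
  then have "((\<lambda>t. D * (g' t / t)) \<longlongrightarrow> D * D) (at 0)" by (intro tendsto_intros)
  moreover have "D * D > 0" using D by (simp add: zero_less_mult_iff) linarith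
  ultimately have "\<forall>\<^sub>F t in at 0. D * (g' t / t) > 0" by (rule order_tendstoD)
  moreover have "\<forall>\<^sub>F t in at 0. t \<in> J" using J by (rule eventually_at_in_open')
  ultimately have "\<forall>\<^sub>F t in at 0. D * (g' t / t) > 0 \<and> t \<in> J" by (rule eventually_conj)
  then obtain d where d: "d > 0" "\<And>t. t \<noteq> 0 \<Longrightarrow> \<bar>t\<bar> < d \<Longrightarrow> D * (g' t / t) > 0 \<and> t \<in> J"
    unfolding eventually_at by (auto simp: dist_real_def)
  have dJ: "t \<in> J" if "\<bar>t\<bar> < d" for t using d(2)[of t] J that by (cases "t = 0") auto
  have "D * g t > 0" if t: "0 < \<bar>t\<bar>" "\<bar>t\<bar> < d" for t
  proof -
    have "\<exists>\<xi>. \<xi> \<noteq> 0 \<and> \<bar>\<xi>\<bar> < d \<and> \<xi> * t > 0 \<and> g t = t * g' \<xi>"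
    proof (cases "t > 0")
      case True
      have "(g has_real_derivative g' x) (at x)" if "0 \<le> x" "x \<le> t" for x using that t by (intro g dJ) auto
      from MVT2[OF True this] obtain \<xi> where "0 < \<xi>" "\<xi> < t" "g t - g 0 = (t - 0) * g' \<xi>" by blast
      then show ?thesis using g0 t True by (intro exI[of _ \<xi>]) auto
    next
      case False
      then have t0: "t < 0" using t by auto
      have "(g has_real_derivative g' x) (at x)" if "t \<le> x" "x \<le> 0" for x using that t by (intro g dJ) auto
      from MVT2[OF t0 this] obtain \<xi> where "t < \<xi>" "\<xi> < 0" "g 0 - g t = (0 - t) * g' \<xi>" by blast
      then show ?thesis using g0 t t0 by (intro exI[of _ \<xi>]) (auto simp: mult_neg_neg)
    qed
    then obtain \<xi> where \<xi>: "\<xi> \<noteq> 0" "\<bar>\<xi>\<bar> < d" "\<xi> * t > 0" "g t = t * g' \<xi>" by blast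
    have "D * g t = \<xi> * t * (D * (g' \<xi> / \<xi>))" using \<xi> by simp
    moreover have "\<xi> * t * (D * (g' \<xi> / \<xi>)) > 0" 
      by (rule mult_pos_pos[OF \<xi>(3)]) (use d(2)[OF \<xi>(1,2)] in blast)
    ultimately show ?thesis by simp
  qed
  then show ?thesis using d(1) by blast
qed

lemma covers_neighbourhood_pos:
  fixes \<kappa> :: "real \<Rightarrow> real"
  assumes J: "open J" "0 \<in> J" "continuous_on J \<kappa>" and \<kappa>: "(\<kappa> has_real_derivative w) (at 0)" "w > 0" and d: "d > 0"
  shows "\<exists>e>0. \<forall>t. \<bar>t - \<kappa> 0\<bar> < e \<longrightarrow> (\<exists>s\<in>J. \<bar>s\<bar> < d \<and> \<kappa> s = t)"
proof -
  obtain a where a: "a > 0" "\<And>h. h > 0 \<Longrightarrow> h < a \<Longrightarrow> \<kappa> 0 < \<kappa> h"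
    using DERIV_pos_inc_right[OF \<kappa>] by auto
  obtain b where b: "b > 0" "\<And>h. h > 0 \<Longrightarrow> h < b \<Longrightarrow> \<kappa> (- h) < \<kappa> 0"
    using DERIV_pos_inc_left[OF \<kappa>] by auto
  obtain c where c: "c > 0" "\<And>x. \<bar>x\<bar> < c \<Longrightarrow> x \<in> J"
    using J(1,2) unfolding open_dist by (auto simp: dist_real_def)
  define h where "h = min (min a b) (min c d) / 2"
  have h: "h > 0" "h < a" "h < b" "h < c" "h < d" using a(1) b(1) c(1) d by (auto simp: h_def)
  define e where "e = min (\<kappa> h - \<kappa> 0) (\<kappa> 0 - \<kappa> (- h))"
  have "e > 0" using a(2)[of h] b(2)[of h] h by (simp add: e_def)
  moreover have "\<exists>s\<in>J. \<bar>s\<bar> < d \<and> \<kappa> s = t" if t: "\<bar>t - \<kappa> 0\<bar> < e" for t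
  proof -
    have "continuous_on {-h..h} \<kappa>" by (rule continuous_on_subset[OF J(3)]) (use c h in auto)
    moreover have "\<kappa> (- h) \<le> t" "t \<le> \<kappa> h" using t unfolding e_def by linarith+
    ultimately obtain s where "- h \<le> s" "s \<le> h" "\<kappa> s = t" using IVT'[of \<kappa> "- h" t h] h by auto
    then show ?thesis using c(2)[of s] h by (intro bexI[of _ s]) auto
  qed
  ultimately show ?thesis by blast
qed

lemma covers_neighbourhood:
  fixes \<kappa> :: "real \<Rightarrow> real"
  assumes J: "open J" "0 \<in> J" "continuous_on J \<kappa>" and \<kappa>: "(\<kappa> has_real_derivative w) (at 0)" "w \<noteq> 0" and d: "d > 0"
  shows "\<exists>e>0. \<forall>t. \<bar>t - \<kappa> 0\<bar> < e \<longrightarrow> (\<exists>s\<in>J. \<bar>s\<bar> < d \<and> \<kappa> s = t)"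
proof (cases "w > 0")
  case True
  then show ?thesis using covers_neighbourhood_pos assms by blast
next
  case False
  then have "- w > 0" using \<kappa>(2) by simp
  from covers_neighbourhood_pos[OF J(1,2) continuous_on_minus[OF J(3)] DERIV_minus[OF \<kappa>(1)] this d]
  obtain e where e: "e > 0" "\<And>t. \<bar>t - - \<kappa> 0\<bar> < e \<Longrightarrow> \<exists>s\<in>J. \<bar>s\<bar> < d \<and> - \<kappa> s = t" by blast
  have "\<exists>s\<in>J. \<bar>s\<bar> < d \<and> \<kappa> s = t" if "\<bar>t - \<kappa> 0\<bar> < e" for t
    using e(2)[of "- t"] that by (auto simp: abs_minus_commute)
  then show ?thesis using e(1) by blast
qed

lemma connected_nonzero_sign:
  fixes u :: "'a::topological_space \<Rightarrow> real"
  assumes "connected H" "continuous_on H u" and nz: "\<And>x. x \<in> H \<Longrightarrow> u x \<noteq> 0"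
  shows "\<exists>\<sigma>. \<sigma> \<noteq> 0 \<and> (\<forall>x\<in>H. \<sigma> * u x > 0)"
proof (cases "\<exists>x\<in>H. u x > 0")
  case True
  then obtain x where x: "x \<in> H" "u x > 0" by blast
  have "u y > 0" if y: "y \<in> H" for y
  proof (rule ccontr)
    assume "\<not> u y > 0"
    then have "0 \<in> u ` H"
      using connectedD_interval[OF connected_continuous_image[OF assms(2,1)], of "u y" "u x" 0] x y by auto
    then show False using nz by force
  qed
  then show ?thesis by (intro exI[of _ 1]) simp
next
  case False
  then have "u x < 0" if "x \<in> H" for x using nz[OF that] that by (meson linorder_neqE)
  then show ?thesis by (intro exI[of _ "-1"]) simp
qed

context linearized_saddle
begin

text \<open>
The tangency is stated for a level set in some coordinate \<open>\<psi>\<close>, which is an open piece of a forward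
iterate of the local unstable manifold. Near \<open>q\<close> the points of height \<open>0\<close> at time \<open>-N\<close> belong to that
iterate: their backward orbits remain in \<open>U\<close>, in the first finitely many steps by continuity and
afterwards by linearity.\<close>

lemma sheet_is_level_set:
  assumes coord_W: "local_coord r A W \<psi>" and q: "q \<in> W" "\<psi> q $ 3 = 0"
    and sheet: "openin (top_of_set ((f ^^ m) ` local_unstable_mfd U f p)) {x \<in> W. \<psi> x $ 3 = 0}"
    and N: "m \<le> N" "(inv f ^^ N) q \<in> V"
  obtains W' where "open W'" "q \<in> W'" "W' \<subseteq> W"
    "\<And>x. x \<in> W' \<Longrightarrow> (inv f ^^ N) x \<in> V" "\<And>x. x \<in> W' \<Longrightarrow> snd (P ((inv f ^^ N) x)) = 0 \<Longrightarrow> \<psi> x $ 3 = 0"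
proof -
  obtain G where G: "open G" "{x \<in> W. \<psi> x $ 3 = 0} = (f ^^ m) ` local_unstable_mfd U f p \<inter> G"
    using sheet unfolding openin_open by blast
  have qG: "q \<in> (f ^^ m) ` local_unstable_mfd U f p" "q \<in> G" using q G(2) by blast+
  then obtain q' where q': "q' \<in> local_unstable_mfd U f p" "q = (f ^^ m) q'" by blast
  have q'U: "(inv f ^^ i) q' \<in> U" for i using q'(1) by (simp add: local_unstable_mfd_def local_stable_mfd_def)
  define W' where "W' = W \<inter> G \<inter> (inv f ^^ N) -` V \<inter> (\<Inter>i\<in>{m..N}. (inv f ^^ i) -` U)"
  have vim: "open ((inv f ^^ i) -` X)" if "open X" for i X
    using that continuous_on_funpow[OF cont_inv, of i] by (simp add: continuous_on_open_vimage)
  have "open W" "open U" using coord_W chart_U chart_open by (auto simp: local_coord_def)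
  then have "open W'" unfolding W'_def using G(1) open_V vim by (intro open_Int open_INT) auto
  moreover have "q \<in> W'"
  proof -
    have "(inv f ^^ i) q \<in> U" if "m \<le> i" for i
    proof -
      have "(inv f ^^ i) q = (inv f ^^ (i - m)) ((inv f ^^ m) q)" using that funpow_add[of "i - m" m "inv f"] by simp
      also have "(inv f ^^ m) q = q'" unfolding q'(2) by (rule inv_funpow_funpow[OF bij_f])
      finally show ?thesis using q'U by simp
    qed
    then show ?thesis using q qG N(2) by (simp add: W'_def)
  qed
  moreover have "W' \<subseteq> W" by (auto simp: W'_def)
  moreover have "(inv f ^^ N) x \<in> V" if "x \<in> W'" for x using that by (simp add: W'_def)
  moreover have "\<psi> x $ 3 = 0" if x: "x \<in> W'" and 0: "snd (P ((inv f ^^ N) x)) = 0" for x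
  proof -
    have V: "(inv f ^^ N) x \<in> V" using x by (simp add: W'_def)
    define z where "z = fst (P ((inv f ^^ N) x))"
    have z: "norm z < \<delta>" "(inv f ^^ N) x = E (z, 0)" using V_P[OF V] 0 by (simp_all add: z_def) (metis prod.collapse)
    define y where "y = (inv f ^^ m) x"
    have back_y: "(inv f ^^ i) y = (inv f ^^ (i + m)) x" for i by (simp add: y_def funpow_add)
    have "y = (f ^^ (N - m)) (E (z, 0))"
      using funpow_inv_funpow_le[OF bij_f, of "N - m" N x] N(1) by (simp add: z(2) y_def)
    then have "y \<in> unstable_mfd f p" using unstable_funpow[OF E0_unstable[OF z(1)]] by simp
    moreover have "(inv f ^^ i) y \<in> U" for i
    proof (cases "i + m \<le> N")
      case True
      then show ?thesis using x unfolding back_y by (simp add: W'_def)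
    next
      case False
      then have "(inv f ^^ (i + m)) x = (inv f ^^ (i + m - N)) (E (z, 0))"
        using funpow_add[of "i + m - N" N "inv f"] by (simp add: z(2))
      also have "\<dots> = E (z / \<mu> ^ (i + m - N), 0)" using z(1) by (rule inv_funpow_E0)
      also have "\<dots> \<in> U" using E_in_U norm_over_power[of z "i + m - N"] z(1) \<delta> by simp
      finally show ?thesis unfolding back_y .
    qed
    ultimately have "y \<in> local_unstable_mfd U f p"
      by (simp add: local_unstable_mfd_def local_stable_mfd_def unstable_mfd_def)
    moreover have "x = (f ^^ m) y" unfolding y_def using funpow_inv_funpow[OF bij_f] by metis
    ultimately have "x \<in> (f ^^ m) ` local_unstable_mfd U f p \<inter> G" using x by (auto simp: W'_def)
    then show ?thesis using G(2) by blast
  qed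
  ultimately show thesis using that by blast
qed

text \<open>
On either half of a small ball in the coordinate \<open>\<psi>\<close> the height has no zero, and the half-ball is
connected, so the height has a constant sign there.\<close>

lemma half_sheet_sign:
  assumes W: "chart W \<psi>" and W': "open W'" "q \<in> W'" "W' \<subseteq> W" and s: "s \<noteq> 0"
    and V: "\<forall>x\<in>W'. (inv f ^^ N) x \<in> V"
    and zero: "\<forall>x\<in>W'. snd (P ((inv f ^^ N) x)) = 0 \<longrightarrow> \<psi> x $ 3 = 0"
  obtains \<sigma> B where "\<sigma> \<noteq> 0" "open B" "q \<in> B"
    "\<And>x. x \<in> B \<Longrightarrow> s * \<psi> x $ 3 > 0 \<Longrightarrow> \<sigma> * snd (P ((inv f ^^ N) x)) > 0"
proof -
  have "open (\<psi> ` W')" using chart_open_image[OF W W'(1,3)] .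
  then obtain e where e: "e > 0" "ball (\<psi> q) e \<subseteq> \<psi> ` W'" using W'(2) unfolding open_contains_ball by blast
  define H where "H = ball (\<psi> q) e \<inter> {y. s * y $ 3 > 0}"
  define u where "u y = snd (P ((inv f ^^ N) (inv_into W \<psi> y)))" for y
  have inv: "inv_into W \<psi> y \<in> W' \<and> \<psi> (inv_into W \<psi> y) = y" if "y \<in> ball (\<psi> q) e" for y
    using that e(2) chart_inverse[OF W] W'(3) by fastforce
  have "convex {y :: real ^ 3. 0 < s * y $ 3}"
  proof -
    have "{y :: real ^ 3. 0 < s * y $ 3} = {y. axis 3 s \<bullet> y > 0}" by (simp add: inner_axis')
    then show ?thesis using convex_halfspace_gt[of 0 "axis 3 s"] by simp
  qed
  then have "connected H" unfolding H_def by (intro convex_connected convex_Int) auto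
  moreover have "continuous_on H u"
  proof -
    have 1: "continuous_on (ball (\<psi> q) e) (inv_into W \<psi>)"
      using continuous_on_subset[OF chart_inverse_continuous[OF W]] e(2) W'(3) by (meson image_mono subset_trans)
    have 2: "continuous_on (ball (\<psi> q) e) (\<lambda>y. (inv f ^^ N) (inv_into W \<psi> y))"
      by (rule continuous_on_compose2[OF continuous_on_funpow[OF cont_inv] 1]) simp
    have contV: "continuous_on V P" using contP by (simp add: V_def)
    have "continuous_on (ball (\<psi> q) e) (\<lambda>y. P ((inv f ^^ N) (inv_into W \<psi> y)))"
      by (rule continuous_on_compose2[OF contV 2]) (use inv V in blast)
    then have "continuous_on (ball (\<psi> q) e) u" unfolding u_def by (rule continuous_on_snd)
    then show ?thesis by (rule continuous_on_subset) (simp add: H_def)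
  qed
  moreover have "u y \<noteq> 0" if "y \<in> H" for y
    using zero inv[of y] that by (auto simp: H_def u_def)
  ultimately obtain \<sigma> where \<sigma>: "\<sigma> \<noteq> 0" "\<And>y. y \<in> H \<Longrightarrow> \<sigma> * u y > 0"
    using connected_nonzero_sign by metis
  define B where "B = W \<inter> \<psi> -` ball (\<psi> q) e"
  have "open B" unfolding B_def
    using chart_continuous[OF W] chart_open[OF W] by (intro continuous_open_preimage) auto
  moreover have "q \<in> B" using W' e(1) by (auto simp: B_def)
  moreover have "\<sigma> * snd (P ((inv f ^^ N) x)) > 0" if "x \<in> B" "s * \<psi> x $ 3 > 0" for x
    using \<sigma>(2)[of "\<psi> x"] that chart_inverse[OF W, of x] by (simp add: B_def H_def u_def)
  ultimately show thesis using that \<sigma>(1) by blast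
qed

end

lemma Cr_on_second_derivative:
  assumes "Cr_on r S F" "3 \<le> r" "x \<in> S"
  shows "F differentiable (at x)" "(\<lambda>x. frechet_derivative F (at x) v) differentiable (at x)"
proof -
  have "enat 2 \<le> r" using assms(2) order_trans[of "enat 2" 3 r] by (simp add: numeral_eq_enat)
  then have "Ck_on (Suc (Suc 0)) S F" using assms(1) unfolding Cr_on_def numeral_2_eq_2 by blast
  then show "F differentiable (at x)" "(\<lambda>x. frechet_derivative F (at x) v) differentiable (at x)"
    using assms(3) by auto
qed

text \<open>
The chain rule in a basis expresses the first derivative of \<open>g \<circ> \<eta>\<close> by products of differentiable
functions. The second derivative is needed as an honest derivative, because \<open>deriv\<close> says nothing where
it does not exist.\<close>

lemma composition_twice_differentiable:
  fixes g :: "'a::euclidean_space \<Rightarrow> real" and \<eta> :: "real \<Rightarrow> 'a"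
  assumes J: "open J" "0 \<in> J" and \<eta>: "Cr_on r J \<eta>" and G: "\<And>t. t \<in> J \<Longrightarrow> \<eta> t \<in> G"
    and g: "\<And>y. y \<in> G \<Longrightarrow> g differentiable (at y)"
      "\<And>v y. y \<in> G \<Longrightarrow> (\<lambda>y. frechet_derivative g (at y) v) differentiable (at y)" and r: "3 \<le> r"
  obtains \<tau>' D where "\<And>t. t \<in> J \<Longrightarrow> ((g \<circ> \<eta>) has_real_derivative \<tau>' t) (at t)" "(\<tau>' has_real_derivative D) (at 0)"
proof -
  define \<eta>' where "\<eta>' t = frechet_derivative \<eta> (at t) 1" for t
  have d\<eta>: "\<eta> differentiable (at t)" and d\<eta>': "\<eta>' differentiable (at t)" if "t \<in> J" for t
    using Cr_on_second_derivative[OF \<eta> r that] by (simp_all add: \<eta>'_def[abs_def])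
  define \<tau>' where "\<tau>' t = (\<Sum>b\<in>Basis. (\<eta>' t \<bullet> b) * frechet_derivative g (at (\<eta> t)) b)" for t
  have "((g \<circ> \<eta>) has_real_derivative \<tau>' t) (at t)" if t: "t \<in> J" for t
  proof -
    have D\<eta>: "(\<eta> has_derivative frechet_derivative \<eta> (at t)) (at t)" using d\<eta>[OF t] by (simp add: frechet_derivative_works)
    have Dg: "(g has_derivative frechet_derivative g (at (\<eta> t))) (at (\<eta> t))" using g(1)[OF G[OF t]] by (simp add: frechet_derivative_works)
    have linear: "linear (frechet_derivative g (at (\<eta> t)))" "linear (frechet_derivative \<eta> (at t))"
      using Dg D\<eta> by (auto dest: has_derivative_linear)
    have "frechet_derivative g (at (\<eta> t)) (frechet_derivative \<eta> (at t) h) = \<tau>' t * h" for h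
    proof -
      have "frechet_derivative \<eta> (at t) h = h *\<^sub>R \<eta>' t"
        using linear_cmul[OF linear(2), of h 1] by (simp add: \<eta>'_def)
      also have "\<eta>' t = (\<Sum>b\<in>Basis. (\<eta>' t \<bullet> b) *\<^sub>R b)" by (simp add: euclidean_representation)
      finally have "frechet_derivative g (at (\<eta> t)) (frechet_derivative \<eta> (at t) h) = h *\<^sub>R (\<Sum>b\<in>Basis. (\<eta>' t \<bullet> b) *\<^sub>R frechet_derivative g (at (\<eta> t)) b)"
        by (simp only: linear_cmul[OF linear(1)] linear_sum[OF linear(1)])
      then show ?thesis by (simp add: \<tau>'_def mult.commute)
    qed
    then show ?thesis using diff_chain_at[OF D\<eta> Dg] by (simp add: has_field_derivative_def o_def)
  qed
  moreover have "\<tau>' differentiable (at 0)"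
    unfolding \<tau>'_def
  proof (intro differentiable_sum differentiable_mult ballI)
    fix b :: 'a
    obtain d where "(\<eta>' has_derivative d) (at 0)" using d\<eta>'[OF J(2)] by (auto simp: differentiable_def)
    then show "(\<lambda>t. \<eta>' t \<bullet> b) differentiable (at 0)"
      using has_derivative_inner_left unfolding differentiable_def by blast
    have "(\<lambda>y. frechet_derivative g (at y) b) \<circ> \<eta> differentiable (at 0)"
      by (rule differentiable_chain_at[OF d\<eta>[OF J(2)] g(2)[OF G[OF J(2)]]])
    then show "(\<lambda>t. frechet_derivative g (at (\<eta> t)) b) differentiable (at 0)" by (simp add: o_def)
  qed simp
  then obtain D where "(\<tau>' has_real_derivative D) (at 0)" by (rule real_differentiableE)
  ultimately show thesis using that by blast
qed

lemma vec_component_differentiable: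
  fixes F :: "'a::real_normed_vector \<Rightarrow> real ^ 'n"
  assumes "F differentiable (at x)"
  shows "(\<lambda>y. F y $ i) differentiable (at x)" "frechet_derivative (\<lambda>y. F y $ i) (at x) v = frechet_derivative F (at x) v $ i"
proof -
  have "((\<lambda>y. F y $ i) has_derivative (\<lambda>v. frechet_derivative F (at x) v $ i)) (at x)"
    using assms by (intro bounded_linear.has_derivative[OF bounded_linear_vec_nth]) (simp add: frechet_derivative_works)
  then show "(\<lambda>y. F y $ i) differentiable (at x)" "frechet_derivative (\<lambda>y. F y $ i) (at x) v = frechet_derivative F (at x) v $ i"
    by (auto simp: differentiable_def dest: frechet_derivative_at[symmetric])
qed

context linearized_saddle
begin

lemma arc_open_preimage:
  "stable_arc r A f p U q \<epsilon> \<gamma> \<Longrightarrow> open X \<Longrightarrow> open {t \<in> {-\<epsilon><..<\<epsilon>}. \<gamma> t \<in> X}"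
  using continuous_open_preimage[of "{-\<epsilon><..<\<epsilon>}" \<gamma> X]
  by (simp add: stable_arc_def vimage_def Int_def)

text \<open>
The arc and the coordinate \<open>\<psi>\<close> are smooth only with respect to charts of the atlas, so the height
along the arc is first written as a composition through such a chart.\<close>

lemma tangent_arc_on_one_side:
  assumes coord_W: "local_coord r A W \<psi>" and q: "q \<in> W" and arc: "stable_arc r A f p U q \<epsilon> \<gamma>"
    and \<tau>: "\<psi> (\<gamma> 0) $ 3 = 0" "deriv (\<lambda>t. \<psi> (\<gamma> t) $ 3) 0 = 0" "deriv (deriv (\<lambda>t. \<psi> (\<gamma> t) $ 3)) 0 \<noteq> 0"
  obtains s d where "s \<noteq> 0" "d > 0" "\<And>t. 0 < \<bar>t\<bar> \<Longrightarrow> \<bar>t\<bar> < d \<Longrightarrow> s * \<psi> (\<gamma> t) $ 3 > 0"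
proof -
  have \<epsilon>: "\<epsilon> > 0" "\<gamma> 0 = q" using arc by (simp_all add: stable_arc_def)
  obtain C c where C: "(C, c) \<in> A" "q \<in> C" using atlas_cover[OF atlas] .
  have C': "chart C c" using atlas_chart_local_coord[OF atlas C(1)] by (simp add: local_coord_def)
  have W: "chart W \<psi>" and comp: "Cr_on r (c ` (W \<inter> C)) (\<psi> \<circ> inv_into C c)"
    using coord_W C(1) by (auto simp: local_coord_def Cr_compatible_def)
  define J where "J = {t \<in> {-\<epsilon><..<\<epsilon>}. \<gamma> t \<in> C \<inter> W}"
  have J: "open J" "0 \<in> J"
    using arc_open_preimage[OF arc open_Int[OF chart_open[OF C'] chart_open[OF W]]] \<epsilon> C q by (auto simp: J_def)
  have "Cr_on r {t \<in> {-\<epsilon><..<\<epsilon>}. \<gamma> t \<in> C} (c \<circ> \<gamma>)" using arc C(1) by (auto simp: stable_arc_def)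
  then have \<eta>: "Cr_on r J (c \<circ> \<gamma>)"
  proof -
    assume *: "Cr_on r {t \<in> {-\<epsilon><..<\<epsilon>}. \<gamma> t \<in> C} (c \<circ> \<gamma>)"
    have sub: "Ck_on k X F \<Longrightarrow> Y \<subseteq> X \<Longrightarrow> Ck_on k Y F" for k X Y and F :: "real \<Rightarrow> real ^ 3"
      by (induction k arbitrary: F) (auto intro: continuous_on_subset)
    show ?thesis using * unfolding Cr_on_def by (blast intro: sub[where Y = J] subsetI elim: CollectE dest: J_def[THEN equalityD1, THEN subsetD])
  qed
  define G where "G = c ` (W \<inter> C)"
  define g where "g y = (\<psi> \<circ> inv_into C c) y $ 3" for y
  have g1: "g differentiable (at y)" if "y \<in> G" for y
    unfolding g_def using Cr_on_second_derivative(1)[OF comp r] that vec_component_differentiable(1) unfolding G_def by blast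
  have openG: "open G" unfolding G_def
    using chart_open_image[OF C', of "W \<inter> C"] chart_open[OF C'] chart_open[OF W] by blast
  have g2: "(\<lambda>y. frechet_derivative g (at y) v) differentiable (at y)" if y: "y \<in> G" for v y
  proof -
    have eq: "frechet_derivative g (at z) v = frechet_derivative (\<psi> \<circ> inv_into C c) (at z) v $ 3" if "z \<in> G" for z
      unfolding g_def using Cr_on_second_derivative(1)[OF comp r] that vec_component_differentiable(2) unfolding G_def by blast
    have "(\<lambda>z. frechet_derivative (\<psi> \<circ> inv_into C c) (at z) v $ 3) differentiable (at y)"
      using Cr_on_second_derivative(2)[OF comp r, of y v] y by (intro vec_component_differentiable(1)) (simp add: G_def)
    then obtain d where "((\<lambda>z. frechet_derivative (\<psi> \<circ> inv_into C c) (at z) v $ 3) has_derivative d) (at y)"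
      by (auto simp: differentiable_def)
    then have "((\<lambda>z. frechet_derivative g (at z) v) has_derivative d) (at y)"
      by (rule has_derivative_transform_within_open[OF _ openG y]) (simp add: eq)
    then show ?thesis by (auto simp: differentiable_def)
  qed
  obtain \<tau>' D where \<tau>': "\<And>t. t \<in> J \<Longrightarrow> ((g \<circ> (c \<circ> \<gamma>)) has_real_derivative \<tau>' t) (at t)" "(\<tau>' has_real_derivative D) (at 0)"
    by (rule composition_twice_differentiable[OF J \<eta> _ g1 g2 r, of G]) (auto simp: J_def G_def)
  define h where "h t = \<psi> (\<gamma> t) $ 3" for t
  have heq: "(g \<circ> (c \<circ> \<gamma>)) t = h t" if "t \<in> J" for t
    using that chart_inverse[OF C'] by (simp add: J_def g_def h_def)
  have h': "(h has_real_derivative \<tau>' t) (at t)" if "t \<in> J" for t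
    using has_field_derivative_transform_within_open[OF \<tau>'(1)[OF that] J(1) that heq] .
  have dh: "deriv h t = \<tau>' t" if "t \<in> J" for t using h'[OF that] by (rule DERIV_imp_deriv)
  have "(deriv h has_real_derivative D) (at 0)"
    using has_field_derivative_transform_within_open[OF \<tau>'(2) J(1,2)] dh by simp
  then have "deriv (deriv h) 0 = D" by (rule DERIV_imp_deriv)
  then have "D \<noteq> 0" using \<tau>(3) unfolding h_def[abs_def] by simp
  moreover have "h 0 = 0" "\<tau>' 0 = 0" using \<tau>(1,2) dh[OF J(2)] unfolding h_def[abs_def] by simp_all
  ultimately obtain d where "d > 0" "\<forall>t. 0 < \<bar>t\<bar> \<and> \<bar>t\<bar> < d \<longrightarrow> D * h t > 0"
    using second_derivative_sign[OF J h' _ _ \<tau>'(2)] by blast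
  then show thesis using that[OF \<open>D \<noteq> 0\<close>] by (simp add: h_def)
qed

text \<open>
A forward iterate of the arc lies on the stable axis. It moves along it with nonzero speed, because the
arc is regular and the iterate has an invertible derivative; so it covers a neighbourhood of \<open>ts\<close>.\<close>

lemma arc_covers_vertical_segment:
  assumes arc: "stable_arc r A f p U q \<epsilon> \<gamma>"
    and n: "(f ^^ n) ` \<gamma> ` {-\<epsilon><..<\<epsilon>} \<subseteq> local_stable_mfd U f p" "n \<le> N"
    and qE: "(f ^^ N) q = E (0, ts)" "\<bar>ts\<bar> < \<delta>" and d: "d > 0"
  obtains e where "e > 0"
    "\<And>t. \<bar>t - ts\<bar> < e \<Longrightarrow> \<exists>s. \<bar>s\<bar> < \<epsilon> \<and> \<bar>s\<bar> < d \<and> (f ^^ N) (\<gamma> s) = E (0, t) \<and> (s = 0 \<longrightarrow> t = ts)"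
proof -
  have \<epsilon>: "\<epsilon> > 0" "\<gamma> 0 = q" and cont\<gamma>: "continuous_on {-\<epsilon><..<\<epsilon>} \<gamma>" using arc by (simp_all add: stable_arc_def)
  obtain C c where C: "(C, c) \<in> A" "q \<in> C" using atlas_cover[OF atlas] .
  have lcC: "local_coord r A C c" using atlas_chart_local_coord[OF atlas C(1)] .
  then have C': "chart C c" by (simp add: local_coord_def)
  have EV: "E (0, ts) \<in> V" using V_E qE(2) \<delta> by simp
  then have qU: "(f ^^ N) q \<in> U" using qE(1) V_subset_U by auto
  obtain L where L: "strict_deriv (\<phi> \<circ> (f ^^ N) \<circ> inv_into C c) L (c q)"
    using smooth_iterates(1)[OF lcC coord C(2) qU] by blast
  have q_C: "(inv f ^^ N) ((f ^^ N) q) \<in> C" using C(2) by (simp add: inv_funpow_funpow[OF bij_f])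
  obtain K where K: "strict_deriv (c \<circ> (inv f ^^ N) \<circ> inv_into U \<phi>) K (\<phi> ((f ^^ N) q))"
    using smooth_iterates(2)[OF coord lcC qU q_C] by blast
  have KL: "K (L v) = v" for v
    using strict_deriv_inverse[OF C' chart_U C(2) qU continuous_on_funpow[OF cont_f] inv_funpow_funpow[OF bij_f] L K] .
  have "linear K" using K by (simp add: strict_deriv_def bounded_linear.linear)
  define J where "J = {t \<in> {-\<epsilon><..<\<epsilon>}. \<gamma> t \<in> C \<inter> (f ^^ N) -` V}"
  have oV: "open ((f ^^ N) -` V)" using continuous_on_funpow[OF cont_f, of N] open_V by (simp add: continuous_on_open_vimage)
  have J: "open J" "0 \<in> J"
    using arc_open_preimage[OF arc open_Int[OF chart_open[OF C'] oV]] \<epsilon> C(2) EV qE(1) by (auto simp: J_def)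
  have "Cr_on r {t \<in> {-\<epsilon><..<\<epsilon>}. \<gamma> t \<in> C} (c \<circ> \<gamma>)" using arc C(1) by (auto simp: stable_arc_def)
  then have "(c \<circ> \<gamma>) differentiable (at 0)"
    by (rule Cr_on_second_derivative(1)[OF _ r]) (use \<epsilon> C(2) in simp)
  then have \<eta>: "((c \<circ> \<gamma>) has_derivative (\<lambda>h. h *\<^sub>R vector_derivative (c \<circ> \<gamma>) (at 0))) (at 0)"
    by (simp add: vector_derivative_works has_vector_derivative_def)
  define v where "v = vector_derivative (c \<circ> \<gamma>) (at 0)"
  have v: "v \<noteq> 0" using arc C \<epsilon> by (auto simp: stable_arc_def v_def)
  have P\<gamma>: "S' ((\<phi> \<circ> (f ^^ N) \<circ> inv_into C c) ((c \<circ> \<gamma>) t)) = P ((f ^^ N) (\<gamma> t))" if "t \<in> J" for t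
    using that chart_inverse[OF C'] by (simp add: J_def P_def)
  have "((\<phi> \<circ> (f ^^ N) \<circ> inv_into C c) has_derivative L) (at ((c \<circ> \<gamma>) 0))"
    using strict_deriv_has_derivative[OF L] \<epsilon> by simp
  from diff_chain_at[OF \<eta> this]
  have D1: "((\<phi> \<circ> (f ^^ N) \<circ> inv_into C c) \<circ> (c \<circ> \<gamma>) has_derivative L \<circ> (\<lambda>h. h *\<^sub>R v)) (at 0)"
    unfolding v_def .
  have blS': "bounded_linear S'" using S(2) by (simp add: linear_conv_bounded_linear)
  have linL: "linear L" using L by (simp add: strict_deriv_def bounded_linear.linear)
  have "((\<lambda>t. P ((f ^^ N) (\<gamma> t))) has_derivative (\<lambda>h. S' (L (h *\<^sub>R v)))) (at 0)"
  proof (rule has_derivative_transform_within_open[OF _ J])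
    show "((\<lambda>t. S' ((\<phi> \<circ> (f ^^ N) \<circ> inv_into C c) ((c \<circ> \<gamma>) t))) has_derivative (\<lambda>h. S' (L (h *\<^sub>R v)))) (at 0)"
      using bounded_linear.has_derivative[OF blS' D1] by (simp add: o_def)
  qed (rule P\<gamma>)
  moreover have "S' (L (h *\<^sub>R v)) = h *\<^sub>R S' (L v)" for h
    by (simp only: linear_cmul[OF linL] linear_cmul[OF S(2)])
  ultimately have D2: "((\<lambda>t. P ((f ^^ N) (\<gamma> t))) has_derivative (\<lambda>h. h *\<^sub>R S' (L v))) (at 0)" by simp
  have vertical: "fst (P ((f ^^ N) (\<gamma> t))) = 0" if "t \<in> {-\<epsilon><..<\<epsilon>}" for t
  proof (rule local_stable_vertical)
    have 0: "(f ^^ n) (\<gamma> t) \<in> local_stable_mfd U f p" using n(1) that by blast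
    have "(f ^^ j) x \<in> local_stable_mfd U f p" if "x \<in> local_stable_mfd U f p" for x j
    proof -
      have "(f ^^ (i + j)) x \<in> U" for i using that unfolding local_stable_mfd_def by blast
      then have "(f ^^ i) ((f ^^ j) x) \<in> U" for i unfolding funpow_add o_apply .
      moreover have "(f ^^ j) x \<in> stable_mfd f p"
        using that stable_mfd_image[where f = f and p = p] by (induction j) (simp_all add: local_stable_mfd_def)
      ultimately show ?thesis by (simp add: local_stable_mfd_def)
    qed
    from this[OF 0, of "N - n"] show "(f ^^ N) (\<gamma> t) \<in> local_stable_mfd U f p"
      using funpow_add[of "N - n" n f] n(2) by simp
  qed
  have nz: "S' (L v) \<noteq> 0"
  proof
    assume "S' (L v) = 0"
    then have "L v = 0" using S(4)[of "L v"] linear_0[OF S(1)] by simp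
    then show False using KL[of v] linear_0[OF \<open>linear K\<close>] v by simp
  qed
  have "fst (S' (L v)) = 0"
  proof -
    have "((\<lambda>t. fst (P ((f ^^ N) (\<gamma> t)))) has_derivative (\<lambda>h. fst (h *\<^sub>R S' (L v)))) (at 0)"
      by (rule has_derivative_fst[OF D2])
    then have "((\<lambda>t. 0) has_derivative (\<lambda>h. fst (h *\<^sub>R S' (L v)))) (at 0)"
      by (rule has_derivative_transform_within_open[OF _ J]) (simp add: vertical J_def)
    then have "(\<lambda>h. fst (h *\<^sub>R S' (L v))) = (\<lambda>h. 0)" by (rule has_derivative_unique) simp
    then have "fst (1 *\<^sub>R S' (L v)) = 0" by metis
    then show ?thesis by simp
  qed
  then have w: "snd (S' (L v)) \<noteq> 0" using nz by (simp add: prod_eq_iff)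
  define \<kappa> where "\<kappa> t = snd (P ((f ^^ N) (\<gamma> t)))" for t
  have "(\<kappa> has_derivative (\<lambda>h. snd (h *\<^sub>R S' (L v)))) (at 0)" unfolding \<kappa>_def[abs_def] by (rule has_derivative_snd[OF D2])
  then have \<kappa>': "(\<kappa> has_real_derivative snd (S' (L v))) (at 0)"
    by (simp add: has_field_derivative_def mult_commute_abs)
  have cont\<kappa>: "continuous_on J \<kappa>"
  proof -
    have 1: "continuous_on J (\<lambda>t. (f ^^ N) (\<gamma> t))"
      by (rule continuous_on_compose2[OF continuous_on_funpow[OF cont_f] continuous_on_subset[OF cont\<gamma>]]) (auto simp: J_def)
    have contV: "continuous_on V P" using contP by (simp add: V_def)
    have "continuous_on J (\<lambda>t. P ((f ^^ N) (\<gamma> t)))"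
      by (rule continuous_on_compose2[OF contV 1]) (auto simp: J_def)
    then show ?thesis unfolding \<kappa>_def[abs_def] by (rule continuous_on_snd)
  qed
  have \<kappa>0: "\<kappa> 0 = ts" using PE[of 0 ts] qE \<delta> \<epsilon> by (simp add: \<kappa>_def)
  obtain e where e: "e > 0" "\<And>t. \<bar>t - ts\<bar> < e \<Longrightarrow> \<exists>s\<in>J. \<bar>s\<bar> < d \<and> \<kappa> s = t"
    using covers_neighbourhood[OF J cont\<kappa> \<kappa>' w d] unfolding \<kappa>0 by blast
  show thesis
  proof (rule that[OF e(1)])
    fix t assume "\<bar>t - ts\<bar> < e"
    then obtain s where s: "s \<in> J" "\<bar>s\<bar> < d" "\<kappa> s = t" using e(2) by blast
    have "P ((f ^^ N) (\<gamma> s)) = (0, t)" using vertical[of s] s by (simp add: prod_eq_iff \<kappa>_def J_def)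
    moreover have "(f ^^ N) (\<gamma> s) \<in> V" using s(1) by (simp add: J_def)
    ultimately have "(f ^^ N) (\<gamma> s) = E (0, t)" using V_P by metis
    moreover have "\<bar>s\<bar> < \<epsilon>" using s(1) by (auto simp: J_def)
    moreover have "s = 0 \<longrightarrow> t = ts" using s(3) \<kappa>0 by auto
    ultimately show "\<exists>s. \<bar>s\<bar> < \<epsilon> \<and> \<bar>s\<bar> < d \<and> (f ^^ N) (\<gamma> s) = E (0, t) \<and> (s = 0 \<longrightarrow> t = ts)" using s(2) by blast
  qed
qed

end

text \<open>
Near \<open>(0, ts)\<close> the points of the stable axis are iterates of points on the tangent arc, and \<open>\<Phi>\<close> at
such a point is the height of the arc over the unstable sheet. The arc stays on one side of the sheet.\<close>

lemma (in linearized_saddle) tangency_chart_exists: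
  assumes tang: "homoclinic_quadratic_tangency r A f p U q"
  shows "\<exists>N ts zq D \<sigma> \<epsilon>. tangency_chart f p \<mu> lam \<delta> E P q N ts zq D \<sigma> \<epsilon> (\<lambda>x. snd (P ((inv f ^^ (N + N)) (E x))))"
proof -
  have q: "q \<in> unstable_mfd f p" "q \<in> stable_mfd f p" "q \<noteq> p"
    using tang by (simp_all add: homoclinic_quadratic_tangency_def)
  obtain W \<psi> m \<epsilon> \<gamma> where W: "local_coord r A W \<psi>" "q \<in> W"
    and sheet: "openin (top_of_set ((f ^^ m) ` local_unstable_mfd U f p)) {x \<in> W. \<psi> x $ 3 = 0}"
    and arc: "stable_arc r A f p U q \<epsilon> \<gamma>"
    and \<tau>: "\<psi> (\<gamma> 0) $ 3 = 0" "deriv (\<lambda>t. \<psi> (\<gamma> t) $ 3) 0 = 0" "deriv (deriv (\<lambda>t. \<psi> (\<gamma> t) $ 3)) 0 \<noteq> 0"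
    using tang unfolding homoclinic_quadratic_tangency_def Let_def by blast
  obtain n where n: "(f ^^ n) ` \<gamma> ` {-\<epsilon><..<\<epsilon>} \<subseteq> local_stable_mfd U f p" using arc unfolding stable_arc_def by blast
  have \<gamma>0: "\<gamma> 0 = q" "\<epsilon> > 0" "continuous_on {-\<epsilon><..<\<epsilon>} \<gamma>" using arc by (simp_all add: stable_arc_def)
  obtain Nu where Nu: "\<And>i. i \<ge> Nu \<Longrightarrow> (inv f ^^ i) q \<in> V" "\<And>i. i \<ge> Nu \<Longrightarrow> \<exists>z. norm z < \<delta> \<and> (inv f ^^ i) q = E (z, 0)"
    using unstable_eventually[OF q(1)] by blast
  obtain Ns where Ns: "\<And>i. i \<ge> Ns \<Longrightarrow> (f ^^ i) q \<in> V" "\<And>i. i \<ge> Ns \<Longrightarrow> \<exists>t. \<bar>t\<bar> < \<delta> \<and> (f ^^ i) q = E (0, t)"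
    using stable_eventually[OF q(2)] by blast
  define N where "N = Nu + Ns + m + n"
  have N: "Nu \<le> N" "Ns \<le> N" "m \<le> N" "n \<le> N" by (simp_all add: N_def)
  obtain ts where ts: "\<bar>ts\<bar> < \<delta>" "(f ^^ N) q = E (0, ts)" using Ns(2)[OF N(2)] by blast
  obtain zq where zq: "norm zq < \<delta>" "(inv f ^^ N) q = E (zq, 0)" using Nu(2)[OF N(1)] by blast
  have ts0: "ts \<noteq> 0"
  proof
    assume "ts = 0"
    then have "(f ^^ N) q = p" using ts(2) E0 by simp
    then have "q = p" using inv_funpow_funpow[OF bij_f, of N q] fixed_point_funpow(2)[of N] by simp
    then show False using q(3) by simp
  qed
  define \<Phi> where "\<Phi> = (\<lambda>x. snd (P ((inv f ^^ (N + N)) (E x))))"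
  have U: "(f ^^ N) q \<in> U" "(inv f ^^ N) q \<in> U" using Ns(1) Nu(1) N V_subset_U by auto
  obtain L where L: "strict_deriv (\<phi> \<circ> (inv f ^^ (N + N)) \<circ> inv_into U \<phi>) L (\<phi> ((f ^^ N) q))"
    using smooth_iterates(2)[OF coord coord U(1), of "N + N"] U(2) unfolding inv_funpow_double by blast
  obtain K where K: "strict_deriv (\<phi> \<circ> (f ^^ (N + N)) \<circ> inv_into U \<phi>) K (\<phi> ((inv f ^^ N) q))"
    using smooth_iterates(1)[OF coord coord U(2), of "N + N"] U(1) unfolding funpow_double by blast
  have LK: "L (K v) = v" for v
    by (rule strict_deriv_inverse[OF chart_U chart_U U(2) _ continuous_on_funpow[OF cont_f] inv_funpow_funpow[OF bij_f] K])
      (use U(1) L in \<open>simp_all add: funpow_double\<close>)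
  define D where "D = (\<lambda>x. snd (S' (L (S x))))"
  have \<phi>q: "\<phi> ((f ^^ N) q) = S (0, ts)" using \<phi>_E[of 0 ts] ts \<delta> by simp
  have "bounded_linear S" "bounded_linear S'" using S(1,2) by (simp_all add: linear_conv_bounded_linear)
  then have bl: "bounded_linear S" "bounded_linear (\<lambda>v. snd (S' v))" by (auto intro: bounded_linear_compose[OF bounded_linear_snd])
  have "strict_deriv ((\<phi> \<circ> (inv f ^^ (N + N)) \<circ> inv_into U \<phi>) \<circ> S) (L \<circ> S) (0, ts)"
    by (rule strict_deriv_compose[OF strict_deriv_bounded_linear[OF bl(1)]]) (use L in \<open>simp only: \<phi>q\<close>)
  from strict_deriv_compose[OF this strict_deriv_bounded_linear[OF bl(2)]]
  have strict: "strict_deriv \<Phi> D (0, ts)" by (simp add: \<Phi>_def D_def E_def P_def o_def)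
  have "D (S' (K (S (0, 1)))) = 1" by (simp add: D_def S(3,4) LK)
  then have D_nz: "\<exists>x. D x \<noteq> 0" by (metis zero_neq_one)
  obtain s d0 where s: "s \<noteq> 0" "d0 > 0" "\<And>t. 0 < \<bar>t\<bar> \<Longrightarrow> \<bar>t\<bar> < d0 \<Longrightarrow> s * \<psi> (\<gamma> t) $ 3 > 0"
    by (rule tangent_arc_on_one_side[OF W arc \<tau>]) blast
  have \<psi>q: "\<psi> q $ 3 = 0" using \<tau>(1) \<gamma>0 by simp
  obtain W' where W': "open W'" "q \<in> W'" "W' \<subseteq> W"
    and W'V: "\<forall>x\<in>W'. (inv f ^^ N) x \<in> V" "\<forall>x\<in>W'. snd (P ((inv f ^^ N) x)) = 0 \<longrightarrow> \<psi> x $ 3 = 0"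
    by (rule sheet_is_level_set[OF W \<psi>q sheet N(3) Nu(1)[OF N(1)]]) blast
  have cW: "chart W \<psi>" using W(1) by (simp add: local_coord_def)
  obtain \<sigma> B where \<sigma>: "\<sigma> \<noteq> 0" "open B" "q \<in> B"
    "\<And>x. x \<in> B \<Longrightarrow> s * \<psi> x $ 3 > 0 \<Longrightarrow> \<sigma> * snd (P ((inv f ^^ N) x)) > 0"
    by (rule half_sheet_sign[OF cW W' s(1) W'V]) (rule that; assumption)
  have "open {t \<in> {-\<epsilon><..<\<epsilon>}. \<gamma> t \<in> B}" "0 \<in> {t \<in> {-\<epsilon><..<\<epsilon>}. \<gamma> t \<in> B}"
    using arc_open_preimage[OF arc \<sigma>(2)] \<gamma>0 \<sigma>(3) by auto
  then obtain d1 where "d1 > 0" "ball 0 d1 \<subseteq> {t \<in> {-\<epsilon><..<\<epsilon>}. \<gamma> t \<in> B}" unfolding open_contains_ball by blast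
  then have d1: "d1 > 0" "\<And>t. \<bar>t\<bar> < d1 \<Longrightarrow> \<gamma> t \<in> B" by (auto simp: subset_iff)
  have "min d0 d1 > 0" using s d1 by simp
  then obtain e where e: "e > 0"
    "\<And>t. \<bar>t - ts\<bar> < e \<Longrightarrow> \<exists>s. \<bar>s\<bar> < \<epsilon> \<and> \<bar>s\<bar> < min d0 d1 \<and> (f ^^ N) (\<gamma> s) = E (0, t) \<and> (s = 0 \<longrightarrow> t = ts)"
    by (rule arc_covers_vertical_segment[OF arc n N(4) ts(2,1)]) blast
  have one_sided: "\<sigma> * \<Phi> (0, t) > 0" if t: "0 < \<bar>t - ts\<bar>" "\<bar>t - ts\<bar> < e" for t
  proof -
    obtain x where x: "\<bar>x\<bar> < min d0 d1" "(f ^^ N) (\<gamma> x) = E (0, t)" "x \<noteq> 0" using e(2)[OF t(2)] t(1) by auto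
    have "\<Phi> (0, t) = snd (P ((inv f ^^ N) (\<gamma> x)))" unfolding \<Phi>_def x(2)[symmetric] inv_funpow_double ..
    moreover have "s * \<psi> (\<gamma> x) $ 3 > 0" "\<gamma> x \<in> B" using x s(3)[of x] d1(2)[of x] by auto
    ultimately show ?thesis using \<sigma>(4) by simp
  qed
  have "tangency_chart f p \<mu> lam \<delta> E P q N ts zq D \<sigma> e \<Phi>"
  proof
    show "\<forall>i\<ge>N. (f ^^ i) q \<in> V" "\<forall>i\<ge>N. (inv f ^^ i) q \<in> V" using Ns(1) Nu(1) N order_trans by blast+
  qed (use ts zq ts0 strict D_nz \<sigma>(1) e(1) one_sided in \<open>simp_all add: \<Phi>_def\<close>)
  then show ?thesis unfolding \<Phi>_def by blast
qed

text \<open>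
Since \<open>f\<close> is linear on \<open>U\<close>, its derivative at \<open>p\<close> in the coordinate is that linear map itself.\<close>

lemma linearized_saddle_exists:
  fixes f :: "'m::{t2_space, first_countable_topology} \<Rightarrow> 'm"
  assumes r: "3 \<le> r" and A: "Cr_atlas r A" and f: "f \<in> Diff r A" and fp: "f p = p"
    and nbhd: "linearizing_nbhd r A f p U \<phi>"
    and ev: "complex_eigenvalues (deriv_in_coord U \<phi> f p) = {rcis R \<theta>, rcis R (- \<theta>), complex_of_real lam}"
    and R: "R > 1" and \<theta>: "\<forall>k::int. \<theta> \<noteq> of_int k * pi" and lam: "0 < lam" "lam < 1"
  obtains S S' \<delta> where
    "linearized_saddle r A f p U \<phi> (rcis R \<theta>) lam \<delta> S S' (\<lambda>x. inv_into U \<phi> (S x)) (\<lambda>x. S' (\<phi> x))"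
    "unstable_mfd (deriv_in_coord U \<phi> f p) 0 = range (\<lambda>z. S (z, 0))"
proof -
  have coord: "local_coord r A U \<phi>" and pU: "p \<in> U" and \<phi>p: "\<phi> p = 0" and lin: "linear_in_coord U \<phi> f"
    using nbhd by (simp_all add: linearizing_nbhd_def)
  then have cU: "chart U \<phi>" by (simp add: local_coord_def)
  have cont: "continuous_on UNIV f" using f by (simp add: Diff_def Cr_map_def)
  obtain L where L: "linear L" "\<And>x. x \<in> U \<Longrightarrow> f x \<in> U \<Longrightarrow> \<phi> (f x) = L (\<phi> x)"
    using lin unfolding linear_in_coord_def by blast
  define G where "G = \<phi> ` (U \<inter> f -` U)"
  have "open (U \<inter> f -` U)" using cont chart_open[OF cU]
    by (metis continuous_on_open_vimage open_Int open_UNIV inf_top.right_neutral)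
  then have G: "open G" unfolding G_def by (intro chart_open_image[OF cU]) auto
  have 0: "0 \<in> G" unfolding G_def using pU fp \<phi>p by (metis IntI image_eqI vimageI)
  have "(L has_derivative L) (at 0)" using L(1) by (rule linear_imp_has_derivative)
  then have "(\<phi> \<circ> f \<circ> inv_into U \<phi> has_derivative L) (at 0)"
    by (rule has_derivative_transform_within_open[OF _ G 0]) (auto simp: G_def L(2) chart_inverse[OF cU])
  then have DL: "deriv_in_coord U \<phi> f p = L"
    unfolding deriv_in_coord_def \<phi>p by (rule frechet_derivative_at[symmetric])
  have "sin \<theta> \<noteq> 0" using \<theta> by (auto simp: sin_zero_iff_int2)
  then have im: "Im (rcis R \<theta>) \<noteq> 0" using R by simp
  have "cnj (rcis R \<theta>) = rcis R (- \<theta>)" by (simp add: rcis_def cis_cnj)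
  then have ev': "cnj (rcis R \<theta>) \<in> complex_eigenvalues L" "complex_of_real lam \<in> complex_eigenvalues L"
    using ev unfolding DL by simp_all
  obtain S :: "complex \<times> real \<Rightarrow> real ^ 3" and S' where S: "linear S" "linear S'" "\<And>x. S' (S x) = x" "\<And>v. S (S' v) = v"
    and LS: "\<And>z t. L (S (z, t)) = S (rcis R \<theta> * z, lam * t)"
    by (rule saddle_focus_normal_form[OF L(1) ev'(1) im ev'(2)]) blast
  have nR: "norm (rcis R \<theta>) > 1" using R by simp
  have "open (S -` G)" using S(1) G by (intro open_vimage) (simp_all add: linear_continuous_on linear_conv_bounded_linear)
  moreover have "0 \<in> S -` G" using 0 linear_0[OF S(1)] by simp
  ultimately obtain e where e: "e > 0" "ball 0 e \<subseteq> S -` G" unfolding open_contains_ball by blast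
  define \<delta> where "\<delta> = e / 2"
  have box: "S (z, t) \<in> \<phi> ` U \<and> f (inv_into U \<phi> (S (z, t))) \<in> U" if "norm z < \<delta>" "\<bar>t\<bar> < \<delta>" for z t
  proof -
    have "norm (z, t) < e" using norm_Pair_le[of z t] that by (simp add: \<delta>_def)
    then have "S (z, t) \<in> G" using e(2) by auto
    then show ?thesis unfolding G_def using chart_inverse[OF cU] by auto
  qed
  have "linearized_saddle r A f p U \<phi> (rcis R \<theta>) lam \<delta> S S' (\<lambda>x. inv_into U \<phi> (S x)) (\<lambda>x. S' (\<phi> x))"
  proof (rule linearized_saddle.intro)
    show "S' (\<phi> (f x)) = (rcis R \<theta> * fst (S' (\<phi> x)), lam * snd (S' (\<phi> x)))" if "x \<in> U" "f x \<in> U" for x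
    proof -
      have "\<phi> (f x) = L (S (fst (S' (\<phi> x)), snd (S' (\<phi> x))))" using L(2)[OF that] S(4) by simp
      then show ?thesis unfolding LS S(3) using S(3) by simp
    qed
    show "\<delta> > 0" using e(1) by (simp add: \<delta>_def)
  qed (fact r A f fp coord pU \<phi>p S box nR lam refl)+
  moreover have "unstable_mfd (deriv_in_coord U \<phi> f p) 0 = range (\<lambda>z. S (z, 0))"
    unfolding DL by (rule linear_unstable_mfd[OF S LS nR lam])
  ultimately show thesis using that by blast
qed

text \<open>
What the comparison of two maps needs to know about each of them: a global coordinate \<open>Z\<close> of the
unstable manifold with continuous inverse \<open>G\<close>, itself continuous near \<open>p\<close> in the sense of the backward
orbits, in which the points reached by double passages fill half-planes.\<close>

locale unstable_chart =
  fixes f :: "'m::{t2_space, first_countable_topology} \<Rightarrow> 'm" and p q :: 'm and R \<theta> lam :: real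
    and Z :: "'m \<Rightarrow> complex" and G :: "complex \<Rightarrow> 'm" and V :: "'m set" and s :: real
  assumes bij_f: "bij f" and R: "R > 1" and lam: "0 < lam" "lam < 1" and s: "s \<noteq> 0"
    and GZ: "\<And>x. x \<in> unstable_mfd f p \<Longrightarrow> G (Z x) = x" and ZG: "\<And>z. Z (G z) = z"
    and G_mem: "\<And>z. G z \<in> unstable_mfd f p" and f_G: "\<And>z. f (G z) = G (rcis R \<theta> * z)"
    and cont_G: "continuous_on UNIV G" and G0: "G 0 = p"
    and V: "open V" "p \<in> V" and cont_Z: "continuous_on {x. \<forall>n. (inv f ^^ n) x \<in> V} Z"
    and halfplane: "\<And>n m \<rho> u x. \<lbrakk>filterlim n at_top sequentially; filterlim m at_top sequentially;
        (\<lambda>k. R ^ m k * lam ^ n k) \<longlonglongrightarrow> \<rho>; (\<lambda>k. cis \<theta> ^ m k) \<longlonglongrightarrow> u; x \<in> unstable_mfd f p\<rbrakk> \<Longrightarrow>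
      (reach f p q n m x \<longrightarrow> s * (\<rho> - Re (cnj u * Z x)) \<ge> 0) \<and>
      (s * (\<rho> - Re (cnj u * Z x)) > 0 \<longrightarrow> reach f p q n m x)"

text \<open>
The conjugate coordinate is recorded too: it is the one to use when the conjugacy reverses the
orientation of the unstable planes.\<close>

lemma unstable_chart_exists:
  fixes f :: "'m::{t2_space, first_countable_topology} \<Rightarrow> 'm"
  assumes r: "3 \<le> r" and A: "Cr_atlas r A" and f: "f \<in> Diff r A" and fp: "f p = p"
    and nbhd: "linearizing_nbhd r A f p U \<phi>"
    and ev: "complex_eigenvalues (deriv_in_coord U \<phi> f p) = {rcis R \<theta>, rcis R (- \<theta>), complex_of_real lam}"
    and R: "R > 1" and \<theta>: "\<forall>k::int. \<theta> \<noteq> of_int k * pi" and lam: "0 < lam" "lam < 1"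
    and tang: "homoclinic_quadratic_tangency r A f p U q"
  obtains Z G V s where "unstable_chart f p q R \<theta> lam Z G V s"
    "unstable_complex_coord U \<phi> f p R \<theta> Z" "unstable_complex_coord U \<phi> f p R \<theta> (\<lambda>x. cnj (Z x))"
proof -
  obtain S S' \<delta> where ls: "linearized_saddle r A f p U \<phi> (rcis R \<theta>) lam \<delta> S S' (\<lambda>x. inv_into U \<phi> (S x)) (\<lambda>x. S' (\<phi> x))"
    and Eu: "unstable_mfd (deriv_in_coord U \<phi> f p) 0 = range (\<lambda>z. S (z, 0))"
    by (rule linearized_saddle_exists[OF r A f fp nbhd ev R \<theta> lam]) blast
  interpret linearized_saddle r A f p U \<phi> "rcis R \<theta>" lam \<delta> S S' "\<lambda>x. inv_into U \<phi> (S x)" "\<lambda>x. S' (\<phi> x)" by (rule ls)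
  let ?E = "\<lambda>x. inv_into U \<phi> (S x)" and ?P = "\<lambda>x. S' (\<phi> x)"
  obtain N ts zq D \<sigma> \<epsilon> where "tangency_chart f p (rcis R \<theta>) lam \<delta> ?E ?P q N ts zq D \<sigma> \<epsilon> (\<lambda>x. snd (?P ((inv f ^^ (N + N)) (?E x))))"
    using tangency_chart_exists[OF tang] by blast
  then interpret tc: tangency_chart f p "rcis R \<theta>" lam \<delta> ?E ?P q N ts zq D \<sigma> \<epsilon> "\<lambda>x. snd (?P ((inv f ^^ (N + N)) (?E x)))" .
  obtain c s where c: "c \<noteq> 0" and s: "s \<noteq> 0"
    and hp: "\<And>n m \<rho> u x. \<lbrakk>filterlim n at_top sequentially; filterlim m at_top sequentially;
        (\<lambda>k. norm (rcis R \<theta>) ^ m k * lam ^ n k) \<longlonglongrightarrow> \<rho>; (\<lambda>k. sgn (rcis R \<theta>) ^ m k) \<longlonglongrightarrow> u; x \<in> unstable_mfd f p\<rbrakk> \<Longrightarrow>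
      (reach f p q n m x \<longrightarrow> s * (\<rho> - Re (cnj u * (c * ucoord x))) \<ge> 0) \<and>
      (s * (\<rho> - Re (cnj u * (c * ucoord x))) > 0 \<longrightarrow> reach f p q n m x)"
    by (rule tc.reach_halfplane) blast
  have polar: "norm (rcis R \<theta>) = R" "sgn (rcis R \<theta>) = cis \<theta>" using R by (simp_all add: sgn_eq rcis_def norm_mult)
  define Z where "Z x = c * ucoord x" for x
  define G where "G z = upoint (z / c)" for z
  have uc: "unstable_chart f p q R \<theta> lam Z G V s"
  proof
    show "bij f" "R > 1" "0 < lam" "lam < 1" "s \<noteq> 0" "open V" "p \<in> V" by (fact bij_f R lam s open_V p_V)+
    show "G (Z x) = x" if "x \<in> unstable_mfd f p" for x using c upoint_ucoord[OF that] by (simp add: G_def Z_def)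
    show "Z (G z) = z" "G z \<in> unstable_mfd f p" "f (G z) = G (rcis R \<theta> * z)" for z
      using c f_upoint upoint_unstable by (simp_all add: G_def Z_def)
    show "continuous_on UNIV G" unfolding G_def
      by (rule continuous_on_compose2[OF continuous_upoint]) (use c in \<open>auto intro!: continuous_intros\<close>)
    show "G 0 = p" by (simp add: G_def upoint_0)
    have contV: "continuous_on V ?P" using contP by (simp add: V_def)
    have "continuous_on {x. \<forall>n. (inv f ^^ n) x \<in> V} ?P"
      by (rule continuous_on_subset[OF contV]) (auto dest: spec[of _ 0])
    then have "continuous_on {x. \<forall>n. (inv f ^^ n) x \<in> V} (\<lambda>x. c * fst (?P x))" by (intro continuous_intros)
    then show "continuous_on {x. \<forall>n. (inv f ^^ n) x \<in> V} Z"
      by (rule continuous_on_eq) (use ucoord_eq_P in \<open>simp add: Z_def\<close>)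
    fix n m :: "nat \<Rightarrow> nat" and \<rho> u x
    assume "filterlim n at_top sequentially" "filterlim m at_top sequentially"
      "(\<lambda>k. R ^ m k * lam ^ n k) \<longlonglongrightarrow> \<rho>" "(\<lambda>k. cis \<theta> ^ m k) \<longlonglongrightarrow> u" "x \<in> unstable_mfd f p"
    then show "(reach f p q n m x \<longrightarrow> s * (\<rho> - Re (cnj u * Z x)) \<ge> 0) \<and>
        (s * (\<rho> - Re (cnj u * Z x)) > 0 \<longrightarrow> reach f p q n m x)"
      unfolding Z_def by (rule hp[unfolded polar])
  qed
  define T where "T v = c * fst (S' v)" for v
  have linT: "linear T" unfolding T_def
    by (rule linearI) (simp_all add: linear_add[OF S(2)] linear_cmul[OF S(2)] algebra_simps)
  have bijT: "bij_betw T (unstable_mfd (deriv_in_coord U \<phi> f p) 0) UNIV"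
    unfolding Eu by (rule bij_betwI[where g = "\<lambda>z. S (z / c, 0)"]) (use c in \<open>auto simp: T_def S(3)\<close>)
  have ZT: "Z x = T (\<phi> x)" if "x \<in> local_unstable_mfd U f p" for x
    using local_unstable_ucoord[OF that] by (simp add: Z_def T_def)
  have Zf: "Z (f x) = rcis R \<theta> * Z x" if "x \<in> local_unstable_mfd U f p" for x
    using that ucoord_f[of x] by (simp add: Z_def local_unstable_mfd_def local_stable_mfd_def unstable_mfd_def)
  have 1: "unstable_complex_coord U \<phi> f p R \<theta> Z"
    unfolding unstable_complex_coord_def using linT bijT ZT Zf by blast
  have lin': "linear (\<lambda>v. cnj (T v))" using linear_compose[OF linT, of cnj] by (simp add: o_def linear_cnj)
  have bij': "bij_betw (\<lambda>v. cnj (T v)) (unstable_mfd (deriv_in_coord U \<phi> f p) 0) UNIV"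
  proof -
    have "bij_betw cnj UNIV UNIV" by (rule bij_betwI[where g = cnj]) auto
    from bij_betw_trans[OF bijT this] show ?thesis by (simp add: o_def)
  qed
  have conj': "cnj (Z (f x)) = cnj (rcis R \<theta>) * cnj (Z x)" if "x \<in> local_unstable_mfd U f p" for x
    using Zf[OF that] by simp
  have 2: "unstable_complex_coord U \<phi> f p R \<theta> (\<lambda>x. cnj (Z x))"
    unfolding unstable_complex_coord_def
  proof (intro conjI)
    show "\<exists>T. linear T \<and> bij_betw T (unstable_mfd (deriv_in_coord U \<phi> f p) 0) UNIV \<and>
        (\<forall>x\<in>local_unstable_mfd U f p. cnj (Z x) = T (\<phi> x))"
      using lin' bij' ZT by (intro exI[of _ "\<lambda>v. cnj (T v)"]) simp
    show "\<exists>c\<in>{rcis R \<theta>, cnj (rcis R \<theta>)}. \<forall>x\<in>local_unstable_mfd U f p.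
        f x \<in> local_unstable_mfd U f p \<longrightarrow> cnj (Z (f x)) = c * cnj (Z x)"
      using conj' by blast
  qed
  show thesis using that[OF uc 1 2] .
qed

section \<open>Conjugacies in the unstable coordinate\<close>

lemma conjugacy_inverse_maps:
  assumes h: "conjugacy f g h" and f: "bij f"
  shows "conjugacy (inv f) (inv g) h"
proof -
  have hom: "homeomorphism UNIV UNIV h (inv h)" and g: "g = h \<circ> f \<circ> inv h" using h by (simp_all add: conjugacy_def)
  have i: "inv h (h x) = x" "h (inv h x) = x" for x using hom by (simp_all add: homeomorphism_def)
  have "inv g = h \<circ> inv f \<circ> inv h"
  proof (rule inv_equality)
    show "(h \<circ> inv f \<circ> inv h) (g x) = x" "g ((h \<circ> inv f \<circ> inv h) x) = x" for x
      using f by (simp_all add: g i bij_is_inj bij_is_surj surj_f_inv_f)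
  qed
  then show ?thesis using hom by (simp add: conjugacy_def)
qed

lemma conjugacy_unstable_mfd:
  assumes h: "conjugacy f g h" and f: "bij f" and x: "x \<in> unstable_mfd f p"
  shows "h x \<in> unstable_mfd g (h p)"
proof -
  have cont: "continuous_on UNIV h" using h by (simp add: conjugacy_def homeomorphism_def)
  have "(\<lambda>n. (inv f ^^ n) x) \<longlonglongrightarrow> p" using x by (simp add: unstable_mfd_def stable_mfd_def)
  then have "(\<lambda>n. h ((inv f ^^ n) x)) \<longlonglongrightarrow> h p" by (rule continuous_UNIV_tendsto[OF cont])
  then show ?thesis
    unfolding conjugacy_funpow[OF conjugacy_inverse_maps[OF h f]] by (simp add: unstable_mfd_def stable_mfd_def)
qed

context unstable_chart
begin

lemma rcis_nz: "rcis R \<theta> \<noteq> 0"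
  using R by simp

lemma f_funpow_G: "(f ^^ n) (G z) = G (rcis R \<theta> ^ n * z)"
  by (induction n arbitrary: z) (simp_all add: f_G mult.assoc)

lemma inv_funpow_G: "(inv f ^^ n) (G z) = G (z / rcis R \<theta> ^ n)"
proof -
  have "G z = (f ^^ n) (G (z / rcis R \<theta> ^ n))" using rcis_nz by (simp add: f_funpow_G)
  then show ?thesis using inv_funpow_funpow[OF bij_f] by metis
qed

lemma over_power_small:
  assumes "\<eta> > 0" obtains n where "norm (z / rcis R \<theta> ^ n) < \<eta>"
proof -
  have "(\<lambda>n. norm z * (1 / R) ^ n) \<longlonglongrightarrow> 0" using R by (intro tendsto_mult_right_zero LIMSEQ_power_zero) simp
  then have "\<forall>\<^sub>F n in sequentially. norm z * (1 / R) ^ n < \<eta>" using assms by (rule order_tendstoD)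
  then obtain n where "norm z * (1 / R) ^ n < \<eta>" by (auto simp: eventually_sequentially)
  moreover have "norm (z / rcis R \<theta> ^ n) = norm z * (1 / R) ^ n"
    using R by (simp add: norm_divide norm_power power_one_over)
  ultimately show thesis using that[of n] by simp
qed

lemma Z_p: "Z p = 0"
  using ZG[of 0] G0 by simp

end

text \<open>
Near \<open>0\<close> the backward orbits of image points stay close to \<open>p\<^sub>1\<close>, where \<open>Z\<^sub>1\<close> is continuous;
equivariance spreads continuity over the plane.\<close>

lemma conjugacy_in_charts_continuous:
  assumes c0: "unstable_chart f\<^sub>0 p\<^sub>0 q\<^sub>0 R\<^sub>0 \<theta>\<^sub>0 lam\<^sub>0 Z\<^sub>0 G\<^sub>0 V\<^sub>0 s\<^sub>0" and c1: "unstable_chart f\<^sub>1 p\<^sub>1 q\<^sub>1 R\<^sub>1 \<theta>\<^sub>1 lam\<^sub>1 Z\<^sub>1 G\<^sub>1 V\<^sub>1 s\<^sub>1"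
    and h: "conjugacy f\<^sub>0 f\<^sub>1 h" "h p\<^sub>0 = p\<^sub>1"
    and H_def: "H = (\<lambda>z. Z\<^sub>1 (h (G\<^sub>0 z)))"
  shows "continuous_on UNIV H" "H (rcis R\<^sub>0 \<theta>\<^sub>0 * z) = rcis R\<^sub>1 \<theta>\<^sub>1 * H z" "G\<^sub>1 (H z) = h (G\<^sub>0 z)"
proof -
  interpret c0: unstable_chart f\<^sub>0 p\<^sub>0 q\<^sub>0 R\<^sub>0 \<theta>\<^sub>0 lam\<^sub>0 Z\<^sub>0 G\<^sub>0 V\<^sub>0 s\<^sub>0 by (rule c0)
  interpret c1: unstable_chart f\<^sub>1 p\<^sub>1 q\<^sub>1 R\<^sub>1 \<theta>\<^sub>1 lam\<^sub>1 Z\<^sub>1 G\<^sub>1 V\<^sub>1 s\<^sub>1 by (rule c1)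
  have cont_h: "continuous_on UNIV h" using h by (simp add: conjugacy_def homeomorphism_def)
  have GH: "G\<^sub>1 (H z) = h (G\<^sub>0 z)" for z
    using c1.GZ conjugacy_unstable_mfd[OF h(1) c0.bij_f c0.G_mem] h(2) by (simp add: H_def)
  show "G\<^sub>1 (H z) = h (G\<^sub>0 z)" by (rule GH)
  have equiv: "H (rcis R\<^sub>0 \<theta>\<^sub>0 ^ n * z) = rcis R\<^sub>1 \<theta>\<^sub>1 ^ n * H z" for n z
  proof -
    have "G\<^sub>1 (H (rcis R\<^sub>0 \<theta>\<^sub>0 ^ n * z)) = G\<^sub>1 (rcis R\<^sub>1 \<theta>\<^sub>1 ^ n * H z)"
      unfolding GH c0.f_funpow_G[symmetric] conjugacy_funpow[OF h(1)] c1.f_funpow_G[symmetric] ..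
    then show ?thesis using c1.ZG by metis
  qed
  show "H (rcis R\<^sub>0 \<theta>\<^sub>0 * z) = rcis R\<^sub>1 \<theta>\<^sub>1 * H z" using equiv[of 1 z] by simp
  have cont_hG: "continuous_on UNIV (\<lambda>z. h (G\<^sub>0 z))" by (rule continuous_on_compose2[OF cont_h c0.cont_G]) simp
  then have "open ((\<lambda>z. h (G\<^sub>0 z)) -` V\<^sub>1)" using c1.V(1) by (intro open_vimage)
  moreover have "0 \<in> (\<lambda>z. h (G\<^sub>0 z)) -` V\<^sub>1" using c0.G0 h(2) c1.V(2) by simp
  ultimately obtain \<eta> where \<eta>: "\<eta> > 0" "ball 0 \<eta> \<subseteq> (\<lambda>z. h (G\<^sub>0 z)) -` V\<^sub>1" unfolding open_contains_ball by blast
  have stay: "(inv f\<^sub>1 ^^ n) (h (G\<^sub>0 z)) \<in> V\<^sub>1" if "z \<in> ball 0 \<eta>" for n z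
  proof -
    have "(inv f\<^sub>1 ^^ n) (h (G\<^sub>0 z)) = h (G\<^sub>0 (z / rcis R\<^sub>0 \<theta>\<^sub>0 ^ n))"
      unfolding c0.inv_funpow_G[symmetric] conjugacy_funpow[OF conjugacy_inverse_maps[OF h(1) c0.bij_f]] ..
    moreover have "norm (z / rcis R\<^sub>0 \<theta>\<^sub>0 ^ n) \<le> norm z"
    proof -
      have "1 \<le> R\<^sub>0 ^ n" using c0.R by (intro one_le_power) simp
      then show ?thesis using c0.R by (simp add: norm_divide norm_power divide_le_eq mult_le_cancel_left1)
    qed
    moreover have "z / rcis R\<^sub>0 \<theta>\<^sub>0 ^ n \<in> ball 0 \<eta>" using calculation(2) that by simp
    ultimately show ?thesis using \<eta>(2) by auto
  qed
  have local: "continuous_on (ball 0 \<eta>) H" unfolding H_def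
    by (rule continuous_on_compose2[OF c1.cont_Z continuous_on_subset[OF cont_hG]]) (use stay in auto)
  have "isCont H z" for z
  proof -
    obtain n where n: "norm (z / rcis R\<^sub>0 \<theta>\<^sub>0 ^ n) < \<eta>" using c0.over_power_small[OF \<eta>(1)] .
    define S where "S = {w. norm (w / rcis R\<^sub>0 \<theta>\<^sub>0 ^ n) < \<eta>}"
    have "open S" unfolding S_def using c0.rcis_nz by (intro open_Collect_less continuous_intros) auto
    have "continuous_on S (\<lambda>w. H (w / rcis R\<^sub>0 \<theta>\<^sub>0 ^ n))"
      by (rule continuous_on_compose2[OF local]) (use c0.rcis_nz in \<open>auto simp: S_def intro!: continuous_intros\<close>)
    then have "continuous_on S (\<lambda>w. rcis R\<^sub>1 \<theta>\<^sub>1 ^ n * H (w / rcis R\<^sub>0 \<theta>\<^sub>0 ^ n))" by (intro continuous_intros)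
    then have "continuous_on S H"
      by (rule continuous_on_eq) (use c0.rcis_nz in \<open>simp add: equiv[symmetric]\<close>)
    then show ?thesis using \<open>open S\<close> n by (simp add: continuous_on_eq_continuous_at S_def)
  qed
  then show "continuous_on UNIV H" by (simp add: continuous_on_eq_continuous_at)
qed

text \<open>
Conjugation by \<open>h\<close> and by its inverse shows that a point can be reached for \<open>f\<^sub>0\<close> exactly when its
image can be reached for \<open>f\<^sub>1\<close>, with the same lengths of the passages; this matches the half-planes.\<close>

theorem conjugacy_rigid_on_unstable_mfd:
  assumes c0: "unstable_chart f\<^sub>0 p\<^sub>0 q\<^sub>0 R\<^sub>0 \<theta>\<^sub>0 lam\<^sub>0 Z\<^sub>0 G\<^sub>0 V\<^sub>0 s\<^sub>0" and c1: "unstable_chart f\<^sub>1 p\<^sub>1 q\<^sub>1 R\<^sub>1 \<theta>\<^sub>1 lam\<^sub>1 Z\<^sub>1 G\<^sub>1 V\<^sub>1 s\<^sub>1"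
    and h: "conjugacy f\<^sub>0 f\<^sub>1 h" "h p\<^sub>0 = p\<^sub>1" "h q\<^sub>0 = q\<^sub>1"
    and \<theta>: "sin \<theta>\<^sub>0 \<noteq> 0" "\<theta>\<^sub>0 / (2 * pi) \<notin> \<rat>"
  shows "R\<^sub>0 = R\<^sub>1 \<and> lam\<^sub>0 = lam\<^sub>1 \<and>
    ((cis \<theta>\<^sub>1 = cis \<theta>\<^sub>0 \<and> (\<forall>x\<in>unstable_mfd f\<^sub>0 p\<^sub>0. Z\<^sub>1 (h x) = Z\<^sub>0 x)) \<or>
     (cis \<theta>\<^sub>1 = cnj (cis \<theta>\<^sub>0) \<and> (\<forall>x\<in>unstable_mfd f\<^sub>0 p\<^sub>0. Z\<^sub>1 (h x) = cnj (Z\<^sub>0 x))))"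
proof -
  interpret c0: unstable_chart f\<^sub>0 p\<^sub>0 q\<^sub>0 R\<^sub>0 \<theta>\<^sub>0 lam\<^sub>0 Z\<^sub>0 G\<^sub>0 V\<^sub>0 s\<^sub>0 by (rule c0)
  interpret c1: unstable_chart f\<^sub>1 p\<^sub>1 q\<^sub>1 R\<^sub>1 \<theta>\<^sub>1 lam\<^sub>1 Z\<^sub>1 G\<^sub>1 V\<^sub>1 s\<^sub>1 by (rule c1)
  define H where "H = (\<lambda>z. Z\<^sub>1 (h (G\<^sub>0 z)))"
  define K where "K = (\<lambda>z. Z\<^sub>0 (inv h (G\<^sub>1 z)))"
  have inv_h: "inv h (h x) = x" "h (inv h x) = x" for x using h(1) by (simp_all add: conjugacy_def homeomorphism_def)
  have h': "conjugacy f\<^sub>1 f\<^sub>0 (inv h)" "inv h p\<^sub>1 = p\<^sub>0" "inv h q\<^sub>1 = q\<^sub>0"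
    using conjugacy_sym[OF h(1)] inv_h h(2,3) by auto
  note H = conjugacy_in_charts_continuous[OF c0 c1 h(1,2) H_def]
  note K = conjugacy_in_charts_continuous[OF c1 c0 h'(1,2) K_def]
  have HK: "H (K z) = z" for z
  proof -
    have "H (K z) = Z\<^sub>1 (h (G\<^sub>0 (K z)))" by (simp add: H_def)
    then show ?thesis using c1.ZG by (simp only: K(3) inv_h)
  qed
  have KH: "K (H z) = z" for z
  proof -
    have "K (H z) = Z\<^sub>0 (inv h (G\<^sub>1 (H z)))" by (simp add: K_def)
    then show ?thesis using c0.ZG by (simp only: H(3) inv_h)
  qed
  interpret halfplane_conjugacy H K R\<^sub>0 lam\<^sub>0 s\<^sub>0 R\<^sub>1 lam\<^sub>1 s\<^sub>1 "cis \<theta>\<^sub>0" "cis \<theta>\<^sub>1"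
  proof
    show "homeomorphism UNIV UNIV H K"
      unfolding homeomorphism_def using H(1) K(1) HK KH surjI[of H K] surjI[of K H] by auto
    show "H 0 = 0" using c0.G0 h(2) c1.Z_p by (simp add: H_def)
    fix n m :: "nat \<Rightarrow> nat" and \<rho>\<^sub>0 \<rho>\<^sub>1 :: real and u\<^sub>0 u\<^sub>1 z :: complex
    assume lim: "filterlim n at_top sequentially" "filterlim m at_top sequentially"
      "(\<lambda>k. R\<^sub>0 ^ m k * lam\<^sub>0 ^ n k) \<longlonglongrightarrow> \<rho>\<^sub>0" "(\<lambda>k. R\<^sub>1 ^ m k * lam\<^sub>1 ^ n k) \<longlonglongrightarrow> \<rho>\<^sub>1"
      "(\<lambda>k. cis \<theta>\<^sub>0 ^ m k) \<longlonglongrightarrow> u\<^sub>0" "(\<lambda>k. cis \<theta>\<^sub>1 ^ m k) \<longlonglongrightarrow> u\<^sub>1"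
    have mem: "h (G\<^sub>0 z) \<in> unstable_mfd f\<^sub>1 p\<^sub>1"
      using conjugacy_unstable_mfd[OF h(1) c0.bij_f c0.G_mem] h(2) by simp
    have "reach f\<^sub>0 p\<^sub>0 q\<^sub>0 n m (G\<^sub>0 z) \<longleftrightarrow> reach f\<^sub>1 p\<^sub>1 q\<^sub>1 n m (h (G\<^sub>0 z))"
      using reach_conjugacy[OF h(1), of p\<^sub>0 q\<^sub>0 n m "G\<^sub>0 z"] reach_conjugacy[OF h'(1), of p\<^sub>1 q\<^sub>1 n m "h (G\<^sub>0 z)"]
      unfolding h h' inv_h by blast
    with c0.halfplane[OF lim(1,2,3,5) c0.G_mem, of z] c1.halfplane[OF lim(1,2,4,6) mem]
    show "(s\<^sub>0 * (\<rho>\<^sub>0 - Re (cnj u\<^sub>0 * z)) > 0 \<longrightarrow> s\<^sub>1 * (\<rho>\<^sub>1 - Re (cnj u\<^sub>1 * H z)) \<ge> 0) \<and>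
      (s\<^sub>1 * (\<rho>\<^sub>1 - Re (cnj u\<^sub>1 * H z)) > 0 \<longrightarrow> s\<^sub>0 * (\<rho>\<^sub>0 - Re (cnj u\<^sub>0 * z)) \<ge> 0)"
      unfolding c0.ZG H_def by blast
  qed (fact c0.R c1.R c0.lam c1.lam c0.s c1.s norm_cis)+
  have P: "R\<^sub>0 = R\<^sub>1 \<and> lam\<^sub>0 = lam\<^sub>1 \<and> ((cis \<theta>\<^sub>1 = cis \<theta>\<^sub>0 \<and> (\<forall>z. H z = z)) \<or> (cis \<theta>\<^sub>1 = cnj (cis \<theta>\<^sub>0) \<and> (\<forall>z. H z = cnj z)))"
  proof (rule planar_rigidity)
    show "Im (cis \<theta>\<^sub>0) \<noteq> 0" using \<theta>(1) by simp
    show "\<exists>m. filterlim m at_top sequentially \<and> (\<lambda>k. cis \<theta>\<^sub>0 ^ m k) \<longlonglongrightarrow> u" if "norm u = 1" for u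
      using irrational_rotation_dense[OF \<theta>(2) that] .
    show "H (R\<^sub>0 * cis \<theta>\<^sub>0 * z) = R\<^sub>1 * cis \<theta>\<^sub>1 * H z" for z using H(2)[of z] by (simp add: rcis_def)
  qed
  have "H (Z\<^sub>0 x) = Z\<^sub>1 (h x)" if "x \<in> unstable_mfd f\<^sub>0 p\<^sub>0" for x using c0.GZ[OF that] by (simp add: H_def)
  with P show ?thesis by metis
qed

theorem theorem2:
  fixes A :: "('m::{t2_space, second_countable_topology}) chart3 set"
    and r :: enat
    and f\<^sub>0 f\<^sub>1 h :: "'m \<Rightarrow> 'm"
    and p\<^sub>0 p\<^sub>1 q\<^sub>0 q\<^sub>1 :: 'm
    and U\<^sub>0 U\<^sub>1 :: "'m set"
    and \<phi>\<^sub>0 \<phi>\<^sub>1 :: "'m \<Rightarrow> real ^ 3"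
    and r\<^sub>0 r\<^sub>1 \<theta>\<^sub>0 \<theta>\<^sub>1 lam\<^sub>0 lam\<^sub>1 :: real
  assumes "3 \<le> r" and "Cr_atlas r A"
    and "f\<^sub>0 \<in> Diff r A" and "f\<^sub>1 \<in> Diff r A"
    and "hyperbolic_fixed_point A f\<^sub>0 p\<^sub>0" and "hyperbolic_fixed_point A f\<^sub>1 p\<^sub>1"
    and "linearizing_nbhd r A f\<^sub>0 p\<^sub>0 U\<^sub>0 \<phi>\<^sub>0" and "linearizing_nbhd r A f\<^sub>1 p\<^sub>1 U\<^sub>1 \<phi>\<^sub>1"
    and "complex_eigenvalues (deriv_in_coord U\<^sub>0 \<phi>\<^sub>0 f\<^sub>0 p\<^sub>0) =
           {rcis r\<^sub>0 \<theta>\<^sub>0, rcis r\<^sub>0 (- \<theta>\<^sub>0), complex_of_real lam\<^sub>0}"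
    and "complex_eigenvalues (deriv_in_coord U\<^sub>1 \<phi>\<^sub>1 f\<^sub>1 p\<^sub>1) =
           {rcis r\<^sub>1 \<theta>\<^sub>1, rcis r\<^sub>1 (- \<theta>\<^sub>1), complex_of_real lam\<^sub>1}"
    and "r\<^sub>0 > 1" and "r\<^sub>1 > 1"
    and "\<forall>k::int. \<theta>\<^sub>0 \<noteq> of_int k * pi" and "\<forall>k::int. \<theta>\<^sub>1 \<noteq> of_int k * pi"
    and "0 < lam\<^sub>0" and "lam\<^sub>0 < 1" and "0 < lam\<^sub>1" and "lam\<^sub>1 < 1"
    and "homoclinic_quadratic_tangency r A f\<^sub>0 p\<^sub>0 U\<^sub>0 q\<^sub>0"
    and "homoclinic_quadratic_tangency r A f\<^sub>1 p\<^sub>1 U\<^sub>1 q\<^sub>1"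
    and "positively_associated r A f\<^sub>0 p\<^sub>0 U\<^sub>0 q\<^sub>0"
    and "positively_associated r A f\<^sub>1 p\<^sub>1 U\<^sub>1 q\<^sub>1"
    and "conjugacy f\<^sub>0 f\<^sub>1 h" and "h p\<^sub>0 = p\<^sub>1" and "h q\<^sub>0 = q\<^sub>1"
    and "\<theta>\<^sub>0 / (2 * pi) \<notin> \<rat>"
  shows "lam\<^sub>0 = lam\<^sub>1 \<and> r\<^sub>0 = r\<^sub>1 \<and>
    (\<exists>z\<^sub>0 z\<^sub>1. unstable_complex_coord U\<^sub>0 \<phi>\<^sub>0 f\<^sub>0 p\<^sub>0 r\<^sub>0 \<theta>\<^sub>0 z\<^sub>0 \<and>
       unstable_complex_coord U\<^sub>1 \<phi>\<^sub>1 f\<^sub>1 p\<^sub>1 r\<^sub>1 \<theta>\<^sub>1 z\<^sub>1 \<and>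
       (\<forall>D. small_unstable_nbhd (local_unstable_mfd U\<^sub>0 f\<^sub>0 p\<^sub>0) p\<^sub>0
              (local_unstable_mfd U\<^sub>1 f\<^sub>1 p\<^sub>1) h D \<longrightarrow> linear_conformal_on D z\<^sub>0 z\<^sub>1 h)) \<and>
    (\<forall>h' D. conjugacy f\<^sub>0 f\<^sub>1 h' \<and> h' p\<^sub>0 = p\<^sub>1 \<and> h' q\<^sub>0 = q\<^sub>1 \<and>
       small_unstable_nbhd (local_unstable_mfd U\<^sub>0 f\<^sub>0 p\<^sub>0) p\<^sub>0
         (local_unstable_mfd U\<^sub>1 f\<^sub>1 p\<^sub>1) h D \<and>
       small_unstable_nbhd (local_unstable_mfd U\<^sub>0 f\<^sub>0 p\<^sub>0) p\<^sub>0
         (local_unstable_mfd U\<^sub>1 f\<^sub>1 p\<^sub>1) h' D \<longrightarrow>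
       (\<forall>x\<in>D. h x = h' x))"
proof -
  have fixed: "f\<^sub>0 p\<^sub>0 = p\<^sub>0" "f\<^sub>1 p\<^sub>1 = p\<^sub>1" using assms(5,6) by (simp_all add: hyperbolic_fixed_point_def)
  obtain Z\<^sub>0 G\<^sub>0 V\<^sub>0 s\<^sub>0 where c0: "unstable_chart f\<^sub>0 p\<^sub>0 q\<^sub>0 r\<^sub>0 \<theta>\<^sub>0 lam\<^sub>0 Z\<^sub>0 G\<^sub>0 V\<^sub>0 s\<^sub>0"
    and z0: "unstable_complex_coord U\<^sub>0 \<phi>\<^sub>0 f\<^sub>0 p\<^sub>0 r\<^sub>0 \<theta>\<^sub>0 Z\<^sub>0"
    by (rule unstable_chart_exists[OF assms(1,2,3) fixed(1) assms(7,9,11,13,15,16,19)]) blast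
  obtain Z\<^sub>1 G\<^sub>1 V\<^sub>1 s\<^sub>1 where c1: "unstable_chart f\<^sub>1 p\<^sub>1 q\<^sub>1 r\<^sub>1 \<theta>\<^sub>1 lam\<^sub>1 Z\<^sub>1 G\<^sub>1 V\<^sub>1 s\<^sub>1"
    and z1: "unstable_complex_coord U\<^sub>1 \<phi>\<^sub>1 f\<^sub>1 p\<^sub>1 r\<^sub>1 \<theta>\<^sub>1 Z\<^sub>1"
      "unstable_complex_coord U\<^sub>1 \<phi>\<^sub>1 f\<^sub>1 p\<^sub>1 r\<^sub>1 \<theta>\<^sub>1 (\<lambda>x. cnj (Z\<^sub>1 x))"
    by (rule unstable_chart_exists[OF assms(1,2,4) fixed(2) assms(8,10,12,14,17,18,20)]) blast
  interpret c0: unstable_chart f\<^sub>0 p\<^sub>0 q\<^sub>0 r\<^sub>0 \<theta>\<^sub>0 lam\<^sub>0 Z\<^sub>0 G\<^sub>0 V\<^sub>0 s\<^sub>0 by (rule c0)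
  interpret c1: unstable_chart f\<^sub>1 p\<^sub>1 q\<^sub>1 r\<^sub>1 \<theta>\<^sub>1 lam\<^sub>1 Z\<^sub>1 G\<^sub>1 V\<^sub>1 s\<^sub>1 by (rule c1)
  have sin: "sin \<theta>\<^sub>0 \<noteq> 0" using assms(13) by (auto simp: sin_zero_iff_int2)
  note rigid = conjugacy_rigid_on_unstable_mfd[OF c0 c1 _ _ _ sin assms(26)]
  note rigid_h = rigid[OF assms(23,24,25)]
  have D_sub: "D \<subseteq> unstable_mfd f\<^sub>0 p\<^sub>0" if "small_unstable_nbhd (local_unstable_mfd U\<^sub>0 f\<^sub>0 p\<^sub>0) p\<^sub>0 (local_unstable_mfd U\<^sub>1 f\<^sub>1 p\<^sub>1) g D" for g D
    using that by (auto simp: small_unstable_nbhd_def local_unstable_mfd_def local_stable_mfd_def unstable_mfd_def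
        dest!: openin_imp_subset)
  have conformal: "linear_conformal_on D Z\<^sub>0 w h" if "D \<subseteq> unstable_mfd f\<^sub>0 p\<^sub>0" "\<And>x. x \<in> unstable_mfd f\<^sub>0 p\<^sub>0 \<Longrightarrow> w (h x) = Z\<^sub>0 x" for D w
    unfolding linear_conformal_on_def using that by (intro exI[of _ 1] exI[of _ 0]) auto
  have "\<exists>w. unstable_complex_coord U\<^sub>1 \<phi>\<^sub>1 f\<^sub>1 p\<^sub>1 r\<^sub>1 \<theta>\<^sub>1 w \<and> (\<forall>x\<in>unstable_mfd f\<^sub>0 p\<^sub>0. w (h x) = Z\<^sub>0 x)"
    using rigid_h z1 by (metis complex_cnj_cnj)
  then have "\<exists>z\<^sub>0 z\<^sub>1. unstable_complex_coord U\<^sub>0 \<phi>\<^sub>0 f\<^sub>0 p\<^sub>0 r\<^sub>0 \<theta>\<^sub>0 z\<^sub>0 \<and>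
       unstable_complex_coord U\<^sub>1 \<phi>\<^sub>1 f\<^sub>1 p\<^sub>1 r\<^sub>1 \<theta>\<^sub>1 z\<^sub>1 \<and>
       (\<forall>D. small_unstable_nbhd (local_unstable_mfd U\<^sub>0 f\<^sub>0 p\<^sub>0) p\<^sub>0
              (local_unstable_mfd U\<^sub>1 f\<^sub>1 p\<^sub>1) h D \<longrightarrow> linear_conformal_on D z\<^sub>0 z\<^sub>1 h)"
    using z0 conformal D_sub by blast
  moreover have "h x = h' x" if h': "conjugacy f\<^sub>0 f\<^sub>1 h'" "h' p\<^sub>0 = p\<^sub>1" "h' q\<^sub>0 = q\<^sub>1"
    and D: "small_unstable_nbhd (local_unstable_mfd U\<^sub>0 f\<^sub>0 p\<^sub>0) p\<^sub>0 (local_unstable_mfd U\<^sub>1 f\<^sub>1 p\<^sub>1) h D" and x: "x \<in> D" for h' D x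
  proof -
    have xu: "x \<in> unstable_mfd f\<^sub>0 p\<^sub>0" using D_sub[OF D] x by blast
    have "cis \<theta>\<^sub>0 \<noteq> cnj (cis \<theta>\<^sub>0)" using sin by (simp add: complex_eq_iff)
    then have "Z\<^sub>1 (h x) = Z\<^sub>1 (h' x)" using rigid_h rigid[OF h'] xu by metis
    moreover have "h x \<in> unstable_mfd f\<^sub>1 p\<^sub>1" "h' x \<in> unstable_mfd f\<^sub>1 p\<^sub>1"
      using conjugacy_unstable_mfd[OF _ c0.bij_f xu] assms(23,24) h' by metis+
    ultimately show ?thesis using c1.GZ by metis
  qed
  ultimately show ?thesis using rigid_h by blast
qed

end
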